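(* Let $\mathbb G$ be a step-two group of Métivier type as in the context. Then: (1) $\mathbb M=\big\{\big(x,-\tfrac14\nabla_\theta\langle U(\theta)\cot U(\theta)x,x\rangle\big):\ x\neq0,\ \theta\in\Omega_*\big\}$. (2) For every $g=(x,t)$ with $x\neq0$ there is exactly one $\theta\in\overline{\Omega_*}$ such that $\mathrm{cl}\,\phi(g;\theta)=\sup_{\tau\in\Omega_*}\phi(g;\tau)$. Moreover $d(g)^2=\max_{\tau\in\Omega_*}\phi(g;\tau)$ for $g\in\mathbb M$, and $d(g)^2=\sup_{\tau\in\Omega_*}\phi(g;\tau)$ for $g\in\overline{\mathbb M}$.
   Context: Let $q,m\ge1$, $U^{(1)},\dots,U^{(m)}$ linearly independent real skew-symmetric $q\times q$ matrices with $U(\lambda)=i\sum_j\lambda_jU^{(j)}$ invertible for all $\lambda\neq0$ (Métivier). $\mathbb G=\mathbb R^q\times\mathbb R^m$ with law $(x,t)\cdot(x',t')=(x+x',t+t'+\frac12\langle\mathbb Ux,x'\rangle)$, $\langle\mathbb Ux,x'\rangle=(\langle U^{(j)}x,x'\rangle)_j$, identity $o$; $d(g)$ = Carnot–Carathéodory distance from $o$ (infimum of $\int_0^1|x'|$ over absolutely continuous curves from $o$ to $g$ with $t'=\frac12\langle\mathbb Ux,x'\rangle$). $\Omega_*=\{\tau:\|U(\tau)\|<\pi\}$, $\phi((x,t);\tau)=\langle U(\tau)\cot U(\tau)x,x\rangle+4t\cdot\tau$ on $\Omega_*$, and $\mathrm{cl}\,\phi(g;\tau)=\limsup_{\tau'\to\tau,\tau'\in\Omega_*}\phi(g;\tau')$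 for $\tau\in\overline{\Omega_*}$. $\mathbb M$ is the set of $g$ such that $\phi(g;\cdot)$ has a nondegenerate critical point in $\Omega_*$. *)

theory Defs
  imports "HOL-Analysis.Analysis"
begin

definition metivier :: "('m::finite \<Rightarrow> real^'q::finite^'q) \<Rightarrow> bool" where
  "metivier U \<longleftrightarrow>
     (\<forall>j. transpose (U j) = - U j) \<and>
     (\<forall>c :: 'm \<Rightarrow> real. (\<Sum>j\<in>UNIV. c j *\<^sub>R U j) = 0 \<longrightarrow> (\<forall>j. c j = 0)) \<and>
     (\<forall>l::real^'m. l \<noteq> 0 \<longrightarrow> invertible (\<Sum>j\<in>UNIV. (l $ j) *\<^sub>R U j))"

text \<open>S(\<tau>) = \<Sum>_j \<tau>_j U^(j) (real skew-symmetric); U(\<tau>) = i S(\<tau>).\<close>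
definition Smat :: "('m::finite \<Rightarrow> real^'q::finite^'q) \<Rightarrow> real^'m \<Rightarrow> real^'q^'q" where
  "Smat U \<tau> = (\<Sum>j\<in>UNIV. (\<tau> $ j) *\<^sub>R U j)"

definition Uform :: "('m::finite \<Rightarrow> real^'q::finite^'q) \<Rightarrow> real^'q \<Rightarrow> real^'q \<Rightarrow> real^'m" where
  "Uform U x y = (\<chi> j. (U j *v x) \<bullet> y)"

definition gmult :: "('m::finite \<Rightarrow> real^'q::finite^'q) \<Rightarrow> ((real^'q) \<times> (real^'m)) \<Rightarrow> ((real^'q) \<times> (real^'m)) \<Rightarrow> (real^'q) \<times> (real^'m)" where
  "gmult U g h = (fst g + fst h, snd g + snd h + (1/2) *\<^sub>R Uform U (fst g) (fst h))"

definition gid :: "(real^'q::finite) \<times> (real^'m::finite)" where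
  "gid = (0, 0)"

text \<open>Matrix function of a real symmetric matrix A: the matrix acting as f(s) on every
  eigenvector of A with eigenvalue s (spectral calculus).\<close>
definition matfun :: "(real \<Rightarrow> real) \<Rightarrow> real^'q::finite^'q \<Rightarrow> real^'q^'q" where
  "matfun f A = (THE M. \<forall>v s. A *v v = s *\<^sub>R v \<longrightarrow> M *v v = f s *\<^sub>R v)"

text \<open>z cot z, an even entire-near-0 function; as a function of s = z^2 \<ge> 0.\<close>
definition zcotz_sq :: "real \<Rightarrow> real" where
  "zcotz_sq s = (if s = 0 then 1 else sqrt s * cot (sqrt s))"

text \<open>U(\<tau>) cot U(\<tau>) = g(U(\<tau>)^2) with U(\<tau>)^2 = -S(\<tau>)^2 = S(\<tau>)^T S(\<tau>) and g(z^2) = z cot z;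
  it is a real symmetric matrix.\<close>
definition UcotU :: "('m::finite \<Rightarrow> real^'q::finite^'q) \<Rightarrow> real^'m \<Rightarrow> real^'q^'q" where
  "UcotU U \<tau> = matfun zcotz_sq (transpose (Smat U \<tau>) ** Smat U \<tau>)"

text \<open>\<Omega>_* = {\<tau>. ||U(\<tau>)|| < \<pi>}; the operator norm of U(\<tau>) = i S(\<tau>) equals that of S(\<tau>).\<close>
definition Omega :: "('m::finite \<Rightarrow> real^'q::finite^'q) \<Rightarrow> (real^'m) set" where
  "Omega U = {\<tau>. onorm (\<lambda>x. Smat U \<tau> *v x) < pi}"

definition phi :: "('m::finite \<Rightarrow> real^'q::finite^'q) \<Rightarrow> (real^'q) \<times> (real^'m) \<Rightarrow> real^'m \<Rightarrow> real" where
  "phi U g \<tau> = (UcotU U \<tau> *v fst g) \<bullet> fst g + 4 * (snd g \<bullet> \<tau>)"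

definition cl_phi :: "('m::finite \<Rightarrow> real^'q::finite^'q) \<Rightarrow> (real^'q) \<times> (real^'m) \<Rightarrow> real^'m \<Rightarrow> ereal" where
  "cl_phi U g \<tau> = Limsup (at \<tau> within Omega U) (\<lambda>\<sigma>. ereal (phi U g \<sigma>))"

text \<open>Horizontal absolutely continuous curves from the identity o to g, written in
  integral form: x(s) = \<integral>_0^s x', t(s) = \<integral>_0^s (1/2) <U x, x'> with x' integrable on [0,1]
  (this is exactly absolute continuity of (x,t) with t' = 1/2 <U x, x'> a.e.).
  The length is \<integral>_0^1 |x'|.\<close>
definition horiz_lengths :: "('m::finite \<Rightarrow> real^'q::finite^'q) \<Rightarrow> (real^'q) \<times> (real^'m) \<Rightarrow> real set" where
  "horiz_lengths U g =
     {integral {0..1} (\<lambda>s. norm (x' s)) | (x' :: real \<Rightarrow> real^'q) (x :: real \<Rightarrow> real^'q) (t :: real \<Rightarrow> real^'m).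
        x' absolutely_integrable_on {0..1} \<and>
        (\<forall>s\<in>{0..1}. x s = integral {0..s} x') \<and>
        (\<lambda>s. (1/2) *\<^sub>R Uform U (x s) (x' s)) absolutely_integrable_on {0..1} \<and>
        (\<forall>s\<in>{0..1}. t s = integral {0..s} (\<lambda>r. (1/2) *\<^sub>R Uform U (x r) (x' r))) \<and>
        (x 1, t 1) = g}"

definition cc_dist :: "('m::finite \<Rightarrow> real^'q::finite^'q) \<Rightarrow> (real^'q) \<times> (real^'m) \<Rightarrow> real" where
  "cc_dist U g = Inf (horiz_lengths U g)"

definition Mset :: "('m::finite \<Rightarrow> real^'q::finite^'q) \<Rightarrow> ((real^'q) \<times> (real^'m)) set" where
  "Mset U = {g. \<exists>\<tau>\<in>Omega U. \<exists>D H.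
      (\<forall>\<sigma>\<in>Omega U. (phi U g has_derivative (\<lambda>h. D \<sigma> \<bullet> h)) (at \<sigma>)) \<and>
      D \<tau> = 0 \<and> (D has_derivative H) (at \<tau>) \<and> inj H}"

end

theory Submission
  imports Defs
begin

text \<open>
  Write \<open>S = S(\<tau>)\<close> for the real skew matrix with \<open>U(\<tau>) = i S\<close>. For \<open>\<tau> \<in> \<Omega>\<^sub>*\<close> the form
  \<open>\<langle>U cot U x, x\<rangle>\<close> is the minimum of \<open>\<integral> |z'|\<^sup>2 - 2 S z \<bullet> z'\<close> over curves from \<open>0\<close> to \<open>x\<close>.
  The lower bound is a discrete Riccati argument: the addition theorem of the cotangent makes the
  value function decrease along polygons, whence \<open>\<phi>(g; \<tau>) \<le> d(g)\<^sup>2\<close>. The minimizer solves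
  \<open>y' = p + 2 S y\<close> with \<open>p = (U cot U - S) x\<close>, so \<open>y(1) = E(2 S) p\<close> with the entire function
  \<open>E(X) = (e\<^sup>X - 1) / X\<close>, and \<open>U cot U - S\<close> is the inverse of \<open>E(2 S)\<close>; this makes the form smooth in \<open>\<tau>\<close>.
  As a minimum of affine functions of \<open>\<tau>\<close> it is concave, its gradient is \<open>-4\<close> times the vertical endpoint
  of the geodesic, and perturbing the geodesic shows that its Hessian is negative definite when
  \<open>x \<noteq> 0\<close>. Uniqueness of the maximizer on the closure follows from strict convexity of \<open>\<Omega>\<^sub>*\<close>.
  On the closure of \<open>\<M>\<close> one passes to a limit of geodesics, the supremum being recovered along the
  ray \<open>r \<theta>\<close>, \<open>r \<rightarrow> 1\<close>, by concavity.
\<close>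

section \<open>Spectral calculus of symmetric matrices\<close>

text \<open>The vector \<open>\<tau>\<close> is a Lagrange multiplier for the vertical endpoint:
  along a horizontal curve to \<open>(x, t)\<close> the integral of
  \<open>2 * (S z \<bullet> z')\<close> equals \<open>4 * (t \<bullet> \<tau>)\<close>, so
  \<open>phi \<le> d^2\<close> is weak duality and the geodesic of \<open>\<tau>\<close> closes the
  gap. The obstacle is that \<open>U cot U\<close> is given by spectral calculus, and eigenvectors
  need not vary continuously with \<open>\<tau>\<close> where eigenvalues cross. Spectral data are
  therefore never differentiated: they serve at a fixed \<open>\<tau>\<close> to reduce matrix
  identities to scalar ones, while smoothness is read off from the inverse operator, a power series
  in \<open>S\<close>. The number \<open>pi\<close> is where \<open>sin\<close> first vanishes and
  the endpoint map stops being invertible. Invertibility of \<open>U(\<lambda>)\<close> enters only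
  as \<open>S h v \<noteq> 0\<close> for nonzero \<open>h\<close> and \<open>v\<close>; this makes
  \<open>\<Omega>\<^sub>*\<close> bounded and strictly convex and the concavity strict. At the
  boundary the form may tend to minus infinity, hence the detours through interior points.\<close>

lemma matrix_vector_inner_transpose:
  fixes A :: "real^'n::finite^'n"
  shows "(A *v x) \<bullet> y = x \<bullet> (transpose A *v y)"
  by (simp add: dot_lmul_matrix[symmetric] inner_commute transpose_matrix_vector)

lemma symmetric_inner:
  fixes A :: "real^'n::finite^'n"
  assumes "transpose A = A"
  shows "(A *v x) \<bullet> y = x \<bullet> (A *v y)"
  using matrix_vector_inner_transpose[of A x y] assms by simp

text \<open>First-order condition for the Rayleigh quotient on the unit sphere of \<open>W\<close>:
  the residual \<open>w\<close> of a maximizer \<open>v\<close> lies in \<open>W\<close> by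
  invariance, and moving from \<open>v\<close> along \<open>w\<close> would increase the quotient
  unless \<open>w = 0\<close>.\<close>

lemma symmetric_eigenvector_in_subspace:
  fixes A :: "real^'n::finite^'n"
  assumes sym: "transpose A = A" and sub: "subspace W" and inv: "\<And>x. x \<in> W \<Longrightarrow> A *v x \<in> W"
    and ne: "u \<in> W" "u \<noteq> 0"
  shows "\<exists>v\<in>W. norm v = 1 \<and> (\<exists>s. A *v v = s *\<^sub>R v)"
proof -
  let ?K = "W \<inter> sphere 0 1"
  let ?q = "\<lambda>x. (A *v x) \<bullet> x"
  have cq: "continuous_on ?K ?q"
    by (intro continuous_intros linear_continuous_on matrix_vector_mul_bounded_linear)
  have "compact ?K"
    using closed_subspace[OF sub] by (simp add: closed_Int_compact)
  moreover have "(1 / norm u) *\<^sub>R u \<in> ?K"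
    using ne sub by (auto simp: subspace_scale)
  ultimately obtain v where v: "v \<in> ?K" and vmax: "\<And>y. y \<in> ?K \<Longrightarrow> ?q y \<le> ?q v"
    using continuous_attains_sup[OF _ _ cq] by blast
  define m where "m = ?q v"
  define w where "w = A *v v - m *\<^sub>R v"
  have vW: "v \<in> W" and nv: "norm v = 1" using v by auto
  have wW: "w \<in> W" unfolding w_def using vW sub inv by (simp add: subspace_diff subspace_scale)
  have le: "?q x \<le> m * (norm x)\<^sup>2" if "x \<in> W" for x
  proof (cases "x = 0")
    case False
    have "(1 / norm x) *\<^sub>R x \<in> ?K" using that False sub by (auto simp: subspace_scale)
    from vmax[OF this] have "?q x / (norm x)\<^sup>2 \<le> m"
      by (simp add: m_def matrix_vector_mult_scaleR power2_eq_square)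
    with False show ?thesis by (simp add: field_simps)
  qed simp
  define B where "B = m * (norm w)\<^sup>2 - ?q w"
  have B0: "B \<ge> 0" using le[OF wW] by (simp add: B_def)
  have expand: "m * (norm (v + t *\<^sub>R w))\<^sup>2 - ?q (v + t *\<^sub>R w) = t\<^sup>2 * B - 2 * t * (norm w)\<^sup>2" for t
  proof -
    have 1: "(norm w)\<^sup>2 = (A *v v) \<bullet> w - m * (v \<bullet> w)"
      unfolding power2_norm_eq_inner by (subst (1) w_def) (simp add: inner_diff_left)
    have 2: "(A *v w) \<bullet> v = (A *v v) \<bullet> w"
      using symmetric_inner[OF sym, of w v] by (simp add: inner_commute)
    have 3: "v \<bullet> v = 1" using nv by (simp add: norm_eq_1)
    have 4: "(A *v v) \<bullet> v = m" by (simp add: m_def)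
    have "m * (norm (v + t *\<^sub>R w))\<^sup>2 = m * (1 + 2 * t * (v \<bullet> w) + t\<^sup>2 * (w \<bullet> w))"
      unfolding power2_norm_eq_inner by (simp add: inner_add_left inner_add_right 3 inner_commute power2_eq_square algebra_simps)
    moreover have "?q (v + t *\<^sub>R w) = m + 2 * t * ((A *v v) \<bullet> w) + t\<^sup>2 * ?q w"
      by (simp add: matrix_vector_right_distrib matrix_vector_mult_scaleR inner_add_left inner_add_right 2 4
          power2_eq_square algebra_simps)
    ultimately show ?thesis
      using 1 by (simp only: B_def power2_norm_eq_inner) (simp add: algebra_simps)
  qed
  have key: "0 \<le> t\<^sup>2 * B - 2 * t * (norm w)\<^sup>2" for t
    using le[of "v + t *\<^sub>R w"] expand[of t] vW wW sub by (simp add: subspace_add subspace_scale)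
  have "w = 0"
  proof (rule ccontr)
    assume "w \<noteq> 0"
    define c where "c = (norm w)\<^sup>2"
    have c: "c > 0" using \<open>w \<noteq> 0\<close> by (simp add: c_def)
    \<comment> \<open>The step size \<open>c / (B + 1)\<close> is small enough for the linear term
      to dominate; the \<open>+ 1\<close> covers \<open>B = 0\<close>.\<close>
    have "0 \<le> (c / (B + 1))\<^sup>2 * B - 2 * (c / (B + 1)) * c" using key[of "c / (B+1)"] by (simp add: c_def)
    also have "\<dots> = (c / (B + 1))\<^sup>2 * (B - 2 * (B + 1))"
      using B0 by (simp add: power2_eq_square divide_simps) (simp add: algebra_simps)
    also have "\<dots> < 0" using B0 c by (intro mult_pos_neg) auto
    finally show False by simp
  qed
  then show ?thesis using vW nv unfolding w_def by auto
qed

text \<open>An orthonormal set of eigenvectors of largest cardinality is taken: its orthogonal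
  complement is invariant under \<open>A\<close>, so a nonzero vector there would supply one more
  eigenvector.\<close>

lemma symmetric_eigenbasis:
  fixes A :: "real^'n::finite^'n"
  assumes sym: "transpose A = A"
  shows "\<exists>B s. finite B \<and> (\<forall>b\<in>B. norm b = 1 \<and> A *v b = s b *\<^sub>R b) \<and> (\<forall>x. (\<Sum>b\<in>B. (x \<bullet> b) *\<^sub>R b) = x)"
proof -
  define P where "P B \<longleftrightarrow> finite B \<and> (\<forall>b\<in>B. norm b = 1 \<and> (\<exists>s. A *v b = s *\<^sub>R b)) \<and>
     (\<forall>b\<in>B. \<forall>c\<in>B. b \<noteq> c \<longrightarrow> b \<bullet> c = 0)" for B :: "(real^'n) set"
  have bound: "card B < Suc (DIM(real^'n))" if "P B" for B
  proof -
    have "pairwise orthogonal B" using that by (auto simp: P_def pairwise_def orthogonal_def)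
    moreover have "0 \<notin> B" using that by (force simp: P_def)
    ultimately have "independent B" by (rule pairwise_orthogonal_independent)
    then have "card B \<le> DIM(real^'n)" using independent_bound by blast
    then show ?thesis by simp
  qed
  have "P {}" by (simp add: P_def)
  then obtain B where PB: "P B" and mx: "\<And>C. P C \<Longrightarrow> card C \<le> card B"
    using ex_has_greatest_nat[of P "{}" card "Suc (DIM(real^'n))"] bound by (auto simp: less_imp_le)
  have fin: "finite B" and nb: "\<And>b. b \<in> B \<Longrightarrow> norm b = 1" and ev: "\<And>b. b \<in> B \<Longrightarrow> \<exists>s. A *v b = s *\<^sub>R b"
    and orth: "\<And>b c. b \<in> B \<Longrightarrow> c \<in> B \<Longrightarrow> b \<noteq> c \<Longrightarrow> b \<bullet> c = 0"
    using PB by (auto simp: P_def)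
  define W where "W = {x. \<forall>b\<in>B. x \<bullet> b = 0}"
  have subW: "subspace W" unfolding W_def subspace_def by (auto simp: inner_add_left)
  have invW: "A *v x \<in> W" if "x \<in> W" for x
    unfolding W_def
  proof (intro CollectI ballI)
    fix b assume b: "b \<in> B"
    then obtain s where "A *v b = s *\<^sub>R b" using ev by blast
    then show "(A *v x) \<bullet> b = 0" using that b symmetric_inner[OF sym, of x b] by (simp add: W_def)
  qed
  have W0: "x = 0" if "x \<in> W" for x
  proof (rule ccontr)
    assume x0: "x \<noteq> 0"
    obtain v where v: "v \<in> W" "norm v = 1" "\<exists>s. A *v v = s *\<^sub>R v"
      using symmetric_eigenvector_in_subspace[OF sym subW invW \<open>x \<in> W\<close> x0] by blast
    have vB: "v \<notin> B" using v by (auto simp: W_def)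
    have "P (insert v B)"
      unfolding P_def using fin nb ev orth v by (auto simp: W_def inner_commute)
    from mx[OF this] show False using fin vB by simp
  qed
  have ex: "(\<Sum>b\<in>B. (x \<bullet> b) *\<^sub>R b) = x" for x
  proof -
    have "(\<Sum>b\<in>B. (x \<bullet> b) *\<^sub>R b) \<bullet> c = x \<bullet> c" if c: "c \<in> B" for c
    proof -
      have "(\<Sum>b\<in>B. (x \<bullet> b) *\<^sub>R b) \<bullet> c = (\<Sum>b\<in>B. (x \<bullet> b) * (b \<bullet> c))"
        by (simp add: inner_sum_left)
      also have "\<dots> = (\<Sum>b\<in>B. if b = c then x \<bullet> c else 0)"
        using nb orth c by (intro sum.cong) (auto simp: norm_eq_1)
      also have "\<dots> = x \<bullet> c" using fin c by simp
      finally show ?thesis .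
    qed
    then have "x - (\<Sum>b\<in>B. (x \<bullet> b) *\<^sub>R b) \<in> W" unfolding W_def by (simp add: inner_diff_left)
    from W0[OF this] show ?thesis by simp
  qed
  obtain s where "\<forall>b\<in>B. A *v b = s b *\<^sub>R b" using bchoice[of B "\<lambda>b s. A *v b = s *\<^sub>R b"] ev by blast
  with fin nb ex show ?thesis by blast
qed

text \<open>Eigenvectors of \<open>A\<close> span, so identities between matrices reduce to scalar
  identities in the eigenvalue. Testing only unit eigenvectors makes the norm bound on eigenvalues
  available in the test.\<close>

lemma matrix_eq_on_eigenvectors:
  fixes A M N :: "real^'n::finite^'n"
  assumes sym: "transpose A = A" and eq: "\<And>v s. A *v v = s *\<^sub>R v \<Longrightarrow> norm v = 1 \<Longrightarrow> M *v v = N *v v"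
  shows "M = N"
proof -
  obtain B s
    where B: "finite B" "\<And>b. b \<in> B \<Longrightarrow> A *v b = s b *\<^sub>R b" "\<And>x. (\<Sum>b\<in>B. (x \<bullet> b) *\<^sub>R b) = x"
      "\<And>b. b \<in> B \<Longrightarrow> norm b = 1"
    using symmetric_eigenbasis[OF sym] by blast
  have "M *v x = N *v x" for x
  proof -
    have "M *v x = M *v (\<Sum>b\<in>B. (x \<bullet> b) *\<^sub>R b)" using B(3) by simp
    also have "\<dots> = (\<Sum>b\<in>B. (x \<bullet> b) *\<^sub>R (M *v b))"
      by (simp add: linear_sum[OF matrix_vector_mul_linear] matrix_vector_mult_scaleR)
    also have "\<dots> = (\<Sum>b\<in>B. (x \<bullet> b) *\<^sub>R (N *v b))" using eq[OF B(2) B(4)] by (intro sum.cong) auto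
    also have "\<dots> = N *v (\<Sum>b\<in>B. (x \<bullet> b) *\<^sub>R b)"
      by (simp add: linear_sum[OF matrix_vector_mul_linear] matrix_vector_mult_scaleR)
    finally show ?thesis using B(3) by simp
  qed
  then show ?thesis by (simp add: matrix_eq)
qed

lemma matfun_eigenvector:
  fixes A :: "real^'n::finite^'n"
  assumes sym: "transpose A = A" and ev: "A *v v = s *\<^sub>R v"
  shows "matfun f A *v v = f s *\<^sub>R v"
proof -
  obtain B r
    where B: "finite B" "\<And>b. b \<in> B \<Longrightarrow> A *v b = r b *\<^sub>R b" "\<And>x. (\<Sum>b\<in>B. (x \<bullet> b) *\<^sub>R b) = x"
    using symmetric_eigenbasis[OF sym] by blast
  define L where "L x = (\<Sum>b\<in>B. (f (r b) * (x \<bullet> b)) *\<^sub>R b)" for x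
  have "linear L"
    unfolding L_def
    by (intro linearI) (simp_all add: inner_add_left distrib_left scaleR_left_distrib sum.distrib
        scaleR_right.sum mult.left_commute)
  then have L: "matrix L *v x = L x" for x by (simp add: matrix_works)
  have ex: "\<forall>v s. A *v v = s *\<^sub>R v \<longrightarrow> matrix L *v v = f s *\<^sub>R v"
  proof (intro allI impI)
    fix v s assume v: "A *v v = s *\<^sub>R v"
    \<comment> \<open>For an arbitrary eigenvector \<open>v\<close>, symmetry gives
      \<open>(s - r b) * (v \<bullet> b) = 0\<close>, so only basis vectors with eigenvalue
      \<open>s\<close> contribute. Thus the description in \<open>matfun\<close> has a solution even
      when eigenvalues are repeated.\<close>
    have "(f (r b) * (v \<bullet> b)) = f s * (v \<bullet> b)" if b: "b \<in> B" for b
    proof -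
      have "s * (v \<bullet> b) = r b * (v \<bullet> b)" using symmetric_inner[OF sym, of v b] v B(2)[OF b] by simp
      then show ?thesis by auto
    qed
    then have "L v = (\<Sum>b\<in>B. (f s * (v \<bullet> b)) *\<^sub>R b)" unfolding L_def by (intro sum.cong) auto
    also have "\<dots> = f s *\<^sub>R (\<Sum>b\<in>B. (v \<bullet> b) *\<^sub>R b)" by (simp add: scaleR_right.sum)
    finally show "matrix L *v v = f s *\<^sub>R v" using L B(3) by simp
  qed
  have "\<exists>!M. \<forall>v s. A *v v = s *\<^sub>R v \<longrightarrow> M *v v = f s *\<^sub>R v"
    using ex by (intro ex1I[of _ "matrix L"] ex matrix_eq_on_eigenvectors[OF sym]) metis
  from theI'[OF this] ev show ?thesis unfolding matfun_def by blast
qed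

lemma matfun_symmetric:
  fixes A :: "real^'n::finite^'n"
  assumes sym: "transpose A = A"
  shows "(matfun f A *v x) \<bullet> y = x \<bullet> (matfun f A *v y)"
proof -
  obtain B r
    where B: "finite B" "\<And>b. b \<in> B \<Longrightarrow> A *v b = r b *\<^sub>R b" "\<And>x. (\<Sum>b\<in>B. (x \<bullet> b) *\<^sub>R b) = x"
    using symmetric_eigenbasis[OF sym] by blast
  have M: "matfun f A *v x = (\<Sum>b\<in>B. (f (r b) * (x \<bullet> b)) *\<^sub>R b)" for x
  proof -
    have "matfun f A *v x = matfun f A *v (\<Sum>b\<in>B. (x \<bullet> b) *\<^sub>R b)" using B(3) by simp
    also have "\<dots> = (\<Sum>b\<in>B. (x \<bullet> b) *\<^sub>R (matfun f A *v b))"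
      by (simp add: linear_sum[OF matrix_vector_mul_linear] matrix_vector_mult_scaleR)
    also have "\<dots> = (\<Sum>b\<in>B. (f (r b) * (x \<bullet> b)) *\<^sub>R b)"
      using matfun_eigenvector[OF sym B(2)] by (intro sum.cong) (auto simp: mult.commute)
    finally show ?thesis .
  qed
  show ?thesis unfolding M by (simp add: inner_sum_left inner_sum_right inner_commute mult_ac)
qed

text \<open>The sign of \<open>f\<close> is demanded only at actual eigenvalues, since the functions
  to which this is applied are controlled only below the first pole of the cotangent.\<close>

lemma matfun_nonneg:
  fixes A :: "real^'n::finite^'n"
  assumes sym: "transpose A = A" and f: "\<And>v s. A *v v = s *\<^sub>R v \<Longrightarrow> norm v = 1 \<Longrightarrow> 0 \<le> f s"
  shows "0 \<le> (matfun f A *v x) \<bullet> x"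
proof -
  obtain B r
    where B: "finite B" "\<And>b. b \<in> B \<Longrightarrow> A *v b = r b *\<^sub>R b" "\<And>x. (\<Sum>b\<in>B. (x \<bullet> b) *\<^sub>R b) = x"
     "\<And>b. b \<in> B \<Longrightarrow> norm b = 1" using symmetric_eigenbasis[OF sym] by blast
  have "(matfun f A *v x) \<bullet> x = (\<Sum>b\<in>B. (x \<bullet> b) *\<^sub>R b) \<bullet> (matfun f A *v x)"
    unfolding B(3) by (simp add: inner_commute)
  also have "\<dots> = (\<Sum>b\<in>B. (x \<bullet> b) * (b \<bullet> (matfun f A *v x)))" by (simp add: inner_sum_left)
  also have "\<dots> = (\<Sum>b\<in>B. f (r b) * (x \<bullet> b)\<^sup>2)"
  proof (intro sum.cong refl)
    fix b assume "b \<in> B"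
    have "b \<bullet> (matfun f A *v x) = f (r b) * (x \<bullet> b)"
      using matfun_symmetric[OF sym, of f b x] matfun_eigenvector[OF sym B(2)[OF \<open>b \<in> B\<close>], of f]
      by (simp add: inner_commute)
    then show "(x \<bullet> b) * (b \<bullet> (matfun f A *v x)) = f (r b) * (x \<bullet> b)\<^sup>2" by (simp add: power2_eq_square)
  qed
  also have "\<dots> \<ge> 0" by (intro sum_nonneg mult_nonneg_nonneg f[OF B(2) B(4)]) auto
  finally show ?thesis .
qed

lemma matfun_mono:
  fixes A :: "real^'n::finite^'n"
  assumes sym: "transpose A = A" and f: "\<And>v s. A *v v = s *\<^sub>R v \<Longrightarrow> norm v = 1 \<Longrightarrow> f s \<le> g s"
  shows "(matfun f A *v x) \<bullet> x \<le> (matfun g A *v x) \<bullet> x"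
proof -
  have "matfun (\<lambda>s. g s - f s) A = matfun g A - matfun f A"
  proof (rule matrix_eq_on_eigenvectors[OF sym])
    fix v s assume "A *v v = s *\<^sub>R v"
    note e = matfun_eigenvector[OF sym this]
    show "matfun (\<lambda>s. g s - f s) A *v v = (matfun g A - matfun f A) *v v"
      by (simp add: e matrix_vector_mult_diff_rdistrib scaleR_left_diff_distrib)
  qed
  moreover have "0 \<le> (matfun (\<lambda>s. g s - f s) A *v x) \<bullet> x"
    using f by (intro matfun_nonneg[OF sym]) simp
  ultimately show ?thesis by (simp add: matrix_vector_mult_diff_rdistrib inner_diff_left)
qed

lemma matfun_const:
  fixes A :: "real^'n::finite^'n"
  assumes sym: "transpose A = A"
  shows "matfun (\<lambda>s. c) A *v x = c *\<^sub>R x"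
proof -
  have "matfun (\<lambda>s. c) A = c *\<^sub>R mat 1"
  proof (rule matrix_eq_on_eigenvectors[OF sym])
    fix v s assume "A *v v = s *\<^sub>R v"
    note e = matfun_eigenvector[OF sym this]
    show "matfun (\<lambda>s. c) A *v v = (c *\<^sub>R mat 1) *v v"
      by (simp add: e scaleR_matrix_vector_assoc[symmetric])
  qed
  then show ?thesis by (simp add: scaleR_matrix_vector_assoc[symmetric])
qed

lemma skew_inner:
  fixes S :: "real^'n::finite^'n"
  assumes "transpose S = - S"
  shows "(S *v x) \<bullet> y = - (x \<bullet> (S *v y))"
  using matrix_vector_inner_transpose[of S x y] assms matrix_vector_mult_diff_rdistrib[of 0 S y] by simp

section \<open>The length bound for the cotangent form\<close>

lemma transpose_mult_self_symmetric:
  fixes S :: "real^'n::finite^'n"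
  shows "transpose (transpose S ** S) = transpose S ** S"
  by (simp add: matrix_transpose_mul)

lemma eigenvalue_transpose_mult_self:
  fixes S :: "real^'n::finite^'n"
  assumes "(transpose S ** S) *v v = l *\<^sub>R v" "norm v = 1"
  shows "l = (norm (S *v v))\<^sup>2"
proof -
  have "(norm (S *v v))\<^sup>2 = v \<bullet> ((transpose S ** S) *v v)"
    unfolding power2_norm_eq_inner matrix_vector_inner_transpose by (simp add: matrix_vector_mul_assoc)
  then show ?thesis using assms by (simp add: norm_eq_1)
qed

lemma eigenvalue_transpose_mult_self_bounds:
  fixes S :: "real^'n::finite^'n"
  assumes "(transpose S ** S) *v v = l *\<^sub>R v" "norm v = 1" "onorm ((*v) S) \<le> r"
  shows "0 \<le> l" "sqrt l \<le> r"
proof -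
  have l: "l = (norm (S *v v))\<^sup>2" using eigenvalue_transpose_mult_self assms by blast
  then show "0 \<le> l" by simp
  have "norm (S *v v) \<le> onorm ((*v) S) * norm v"
    by (rule onorm[OF matrix_vector_mul_bounded_linear])
  then show "sqrt l \<le> r" using assms by (simp add: l)
qed

text \<open>\<open>S\<close> commutes with \<open>S^T S = - S^2\<close>. Hence the span of
  \<open>v\<close> and \<open>S *v v\<close> is invariant under \<open>S\<close>, and functions of
  \<open>S^T S\<close> act on it as scalars.\<close>

lemma skew_sq_eigenvector:
  fixes S :: "real^'n::finite^'n"
  assumes skew: "transpose S = - S" and ev: "(transpose S ** S) *v v = l *\<^sub>R v"
  shows "S *v (S *v v) = - (l *\<^sub>R v)" "(transpose S ** S) *v (S *v v) = l *\<^sub>R (S *v v)"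
proof -
  have m: "(- S) *v u = - (S *v u)" for u
    using matrix_vector_mult_diff_rdistrib[of 0 S u] by simp
  have A: "(transpose S ** S) *v u = - (S *v (S *v u))" for u
    by (simp add: skew matrix_vector_mul_assoc[symmetric] m)
  show 1: "S *v (S *v v) = - (l *\<^sub>R v)" using ev unfolding A by (metis minus_equation_iff)
  show "(transpose S ** S) *v (S *v v) = l *\<^sub>R (S *v v)"
    unfolding A 1 using matrix_vector_mult_scaleR[of S "-l" v] by simp
qed

section \<open>Scalar cotangent estimates and the addition theorem\<close>

lemma mult_cot_le_1:
  assumes "0 < z" "z < pi"
  shows "z * cot z \<le> 1"
proof -
  define f where "f = (\<lambda>z::real. sin z - z * cos z)"
  have "f 0 \<le> f z"
  proof (rule DERIV_nonneg_imp_nondecreasing[OF less_imp_le[OF assms(1)]])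
    fix y assume "0 \<le> y" "y \<le> z"
    then show "\<exists>d. (f has_real_derivative d) (at y) \<and> 0 \<le> d"
      using assms unfolding f_def
      by (intro exI[of _ "y * sin y"] conjI derivative_eq_intros | simp add: sin_ge_zero)+
  qed
  then have "z * cos z \<le> sin z" by (simp add: f_def)
  then show ?thesis using sin_gt_zero[OF assms] by (simp add: cot_def)
qed

text \<open>For positive \<open>s\<close> and \<open>l\<close> this is
  \<open>sqrt l * cot (s * sqrt l)\<close>, the solution of the Riccati equation
  \<open>k' = - k^2 - l\<close> that behaves like \<open>1 / s\<close> at \<open>0\<close>. It
  belongs to curves run in time \<open>s\<close>; time \<open>1\<close> gives back
  \<open>zcotz_sq\<close>.\<close>

definition kcot :: "real \<Rightarrow> real \<Rightarrow> real" where
  "kcot s l = zcotz_sq (s\<^sup>2 * l) / s"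

lemma kcot_1: "kcot 1 = zcotz_sq"
  by (auto simp: kcot_def)

lemma kcot_cot: "s > 0 \<Longrightarrow> l > 0 \<Longrightarrow> kcot s l = sqrt l * cot (s * sqrt l)"
  by (simp add: kcot_def zcotz_sq_def real_sqrt_mult)

lemma kcot_0: "kcot s 0 = 1 / s"
  by (simp add: kcot_def zcotz_sq_def)

lemma kcot_le:
  assumes "s > 0" "l \<ge> 0" "s * sqrt l < pi"
  shows "kcot s l \<le> 1 / s"
proof (cases "l = 0")
  case False
  then have l: "l > 0" using assms by simp
  have "(s * sqrt l) * cot (s * sqrt l) \<le> 1" using l assms by (intro mult_cot_le_1) auto
  then show ?thesis using assms l by (simp add: kcot_cot field_simps)
qed (simp add: kcot_0)

text \<open>With \<open>w = sqrt l\<close>, the sum of the two cotangents is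
  \<open>w * sin ((a + b) * w)\<close> over a product of positive sines, so its sign is where the
  total angle must stay below \<open>pi\<close>. The other identity is the addition theorem cleared
  of denominators.\<close>

lemma kcot_add:
  assumes "a > 0" "b > 0" "l \<ge> 0" "(a + b) * sqrt l < pi"
  shows "kcot a l + kcot b l > 0" "kcot (a + b) l * (kcot a l + kcot b l) = kcot a l * kcot b l - l"
proof -
  have "kcot a l + kcot b l > 0 \<and> kcot (a + b) l * (kcot a l + kcot b l) = kcot a l * kcot b l - l"
  proof (cases "l = 0")
    case True
    then show ?thesis using assms by (simp add: kcot_0 field_simps)
  next
    case False
    then have l: "l > 0" using assms by simp
    define w where "w = sqrt l"
    have w: "w > 0" "l = w * w" using l by (auto simp: w_def)
    have "a * w > 0" "b * w > 0" "a * w + b * w < pi"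
      using assms(1,2,4) w(1) unfolding w_def[symmetric] distrib_right by simp_all
    then have s: "sin (a * w) > 0" "sin (b * w) > 0" "sin (a * w + b * w) > 0"
      by (auto intro!: sin_gt_zero)
    have ka: "kcot a l = w * cos (a * w) / sin (a * w)" "kcot b l = w * cos (b * w) / sin (b * w)"
      "kcot (a + b) l = w * cos (a * w + b * w) / sin (a * w + b * w)"
      using kcot_cot[OF assms(1) l] kcot_cot[OF assms(2) l] kcot_cot[OF add_pos_pos[OF assms(1,2)] l]
      unfolding w_def[symmetric] cot_def distrib_right by simp_all
    define sa ca sb cb where "sa = sin (a * w)" and "ca = cos (a * w)" and "sb = sin (b * w)" and "cb = cos (b * w)"
    note defs = sa_def[symmetric] ca_def[symmetric] sb_def[symmetric] cb_def[symmetric]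
    note ka' = ka[unfolded sin_add cos_add, unfolded defs] and s' = s[unfolded sin_add, unfolded defs]
    have sum: "kcot a l + kcot b l = w * (sa * cb + ca * sb) / (sa * sb)"
      unfolding ka' using s' by (simp add: field_simps)
    show ?thesis
    proof
      show "kcot a l + kcot b l > 0" unfolding sum using s' w by simp
      have "kcot (a + b) l * (kcot a l + kcot b l) = w * w * (ca * cb - sa * sb) / (sa * sb)"
        unfolding sum ka'(3) using s' by simp
      also have "\<dots> = (w * ca / sa) * (w * cb / sb) - w * w"
        using s' by (simp add: field_simps)
      also have "\<dots> = kcot a l * kcot b l - l"
        by (simp only: ka' w(2)[symmetric])
      finally show "kcot (a + b) l * (kcot a l + kcot b l) = kcot a l * kcot b l - l" .
    qed
  qed
  then show "kcot a l + kcot b l > 0" "kcot (a + b) l * (kcot a l + kcot b l) = kcot a l * kcot b l - l" by auto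
qed

text \<open>The defect of the inequality is a square: with \<open>C = (K\<^sub>a + K\<^sub>b)\<inverse>\<close> and
  \<open>w = (K\<^sub>a + S) x - (K\<^sub>b - S) v\<close>, the addition theorem of the cotangent gives
  \<open>K\<^sub>a x \<bullet> x + K\<^sub>b v \<bullet> v - 2 (S x \<bullet> v) - K\<^sub>a\<^sub>+\<^sub>b (x + v) \<bullet> (x + v) = C w \<bullet> w\<close>.\<close>
lemma kcot_step:
  fixes S :: "real^'n::finite^'n"
  assumes skew: "transpose S = - S" and on: "onorm ((*v) S) < pi"
    and ab: "0 < a" "0 < b" "a + b \<le> 1"
  defines "K \<equiv> \<lambda>s. matfun (kcot s) (transpose S ** S)"
  shows "(K (a + b) *v (x + v)) \<bullet> (x + v) \<le> (K a *v x) \<bullet> x + (norm v)\<^sup>2 / b - 2 * ((S *v x) \<bullet> v)"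
proof -
  let ?A = "transpose S ** S"
  note sym = transpose_mult_self_symmetric[of S]
  define c where "c l = 1 / (kcot a l + kcot b l)" for l
  define C where "C = matfun c ?A"
  have bnd: "0 \<le> l" "sqrt l < pi" if "?A *v u = l *\<^sub>R u" "norm u = 1" for u l
    using eigenvalue_transpose_mult_self_bounds[OF that order_refl] on by auto
  have sc: "s * sqrt l < pi" if "0 \<le> s" "s \<le> 1" "?A *v u = l *\<^sub>R u" "norm u = 1" for s u l
  proof -
    have "s * sqrt l \<le> 1 * sqrt l" using that bnd(1)[OF that(3,4)] by (intro mult_right_mono) auto
    then show ?thesis using bnd[OF that(3,4)] by simp
  qed
  have Ssym: "(matfun f ?A *v y) \<bullet> z = y \<bullet> (matfun f ?A *v z)" for f y z
    by (rule matfun_symmetric[OF sym])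
  \<comment> \<open>The products \<open>m1\<close>, \<open>m2\<close> and \<open>m3\<close> below
    all have this shape. On the span of \<open>u\<close> and \<open>S u\<close>, where
    \<open>S\<close> squares to \<open>- l\<close>, the product expands into the two scalar
    coefficients listed for \<open>X\<close>.\<close>
  have prod: "(M + S) ** C ** (N + S) = X" if
    "\<And>u l. ?A *v u = l *\<^sub>R u \<Longrightarrow> norm u = 1 \<Longrightarrow> M *v u = m l *\<^sub>R u \<and> M *v (S *v u) = m l *\<^sub>R (S *v u) \<and> N *v u = n l *\<^sub>R u
     \<and> X *v u = (c l * (m l * n l - l)) *\<^sub>R u + (c l * (m l + n l)) *\<^sub>R (S *v u)" for M N X m n
  proof (rule matrix_eq_on_eigenvectors[OF sym])
    fix u l assume u: "?A *v u = l *\<^sub>R u" "norm u = 1"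
    note h = that[OF u]
    note S = skew_sq_eigenvector[OF skew u(1)]
    have "((M + S) ** C ** (N + S)) *v u = (M + S) *v (C *v (n l *\<^sub>R u + S *v u))"
      using h by (simp add: matrix_vector_mul_assoc[symmetric] matrix_vector_mult_add_rdistrib)
    also have "C *v (n l *\<^sub>R u + S *v u) = c l *\<^sub>R (n l *\<^sub>R u + S *v u)"
      unfolding C_def matrix_vector_right_distrib matrix_vector_mult_scaleR
        matfun_eigenvector[OF sym u(1)] matfun_eigenvector[OF sym S(2)] by (simp add: algebra_simps)
    also have "(M + S) *v (c l *\<^sub>R (n l *\<^sub>R u + S *v u)) = X *v u"
      using h by (simp add: matrix_vector_mult_add_rdistrib matrix_vector_right_distrib matrix_vector_mult_scaleR S
          algebra_simps)
    finally show "((M + S) ** C ** (N + S)) *v u = X *v u" .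
  qed
  have neg: "(- M) *v u = - (M *v u)" for M :: "real^'n^'n" and u
    using matrix_vector_mult_diff_rdistrib[of 0 M u] by simp
  have cab: "c l * (kcot a l + kcot b l) = 1" "kcot (a+b) l = c l * (kcot a l * kcot b l - l)"
    if u: "?A *v u = l *\<^sub>R u" "norm u = 1" for u l
  proof -
    note k = kcot_add[OF ab(1,2) bnd(1)[OF u] sc[OF _ ab(3) u]]
    have p: "kcot a l + kcot b l > 0" and q: "kcot (a + b) l * (kcot a l + kcot b l) = kcot a l * kcot b l - l"
      using k ab by auto
    show "c l * (kcot a l + kcot b l) = 1" using p by (simp add: c_def)
    show "kcot (a+b) l = c l * (kcot a l * kcot b l - l)" using p q by (simp add: c_def field_simps)
  qed
  have kd: "kcot s l - kcot (a+b) l = c l * (kcot s l * kcot s l + l)"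
    if u: "?A *v u = l *\<^sub>R u" "norm u = 1" and s: "s = a \<or> s = b" for u l s
  proof -
    have "c l * (kcot s l * kcot s l + l) = c l * (kcot s l * (kcot a l + kcot b l)) - c l * (kcot a l * kcot b l - l)"
      using s by (auto simp: algebra_simps)
    also have "c l * (kcot s l * (kcot a l + kcot b l)) = kcot s l * (c l * (kcot a l + kcot b l))"
      by (simp only: mult.left_commute)
    also have "\<dots> = kcot s l" by (simp only: cab(1)[OF u] mult_1_right)
    also have "c l * (kcot a l * kcot b l - l) = kcot (a+b) l" by (simp only: cab(2)[OF u])
    finally show ?thesis by simp
  qed
  have ev: "matfun f ?A *v u = f l *\<^sub>R u" "matfun f ?A *v (S *v u) = f l *\<^sub>R (S *v u)" if "?A *v u = l *\<^sub>R u" for f u l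
    using matfun_eigenvector[OF sym that] matfun_eigenvector[OF sym skew_sq_eigenvector(2)[OF skew that]] by auto
  have m1: "(- K a + S) ** C ** (K a + S) = K (a + b) - K a"
  proof (rule prod[of _ "\<lambda>l. - kcot a l" _ "kcot a"])
    fix u l assume u: "?A *v u = l *\<^sub>R u" "norm u = 1"
    have "kcot (a + b) l - kcot a l = c l * (- kcot a l * kcot a l - l)"
      using kd[OF u, of a] by (simp add: algebra_simps)
    then show "- K a *v u = - kcot a l *\<^sub>R u \<and> - K a *v (S *v u) = - kcot a l *\<^sub>R (S *v u) \<and> K a *v u = kcot a l *\<^sub>R u
     \<and> (K (a + b) - K a) *v u = (c l * (- kcot a l * kcot a l - l)) *\<^sub>R u + (c l * (- kcot a l + kcot a l)) *\<^sub>R (S *v u)"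
      unfolding K_def neg matrix_vector_mult_diff_rdistrib ev[OF u(1)] scaleR_left_diff_distrib[symmetric] by simp
  qed
  have m2: "(K b + S) ** C ** (- K b + S) = K (a + b) - K b"
  proof (rule prod[of _ "kcot b" _ "\<lambda>l. - kcot b l"])
    fix u l assume u: "?A *v u = l *\<^sub>R u" "norm u = 1"
    have "kcot (a + b) l - kcot b l = c l * (kcot b l * - kcot b l - l)"
      using kd[OF u, of b] by (simp add: algebra_simps)
    then show "K b *v u = kcot b l *\<^sub>R u \<and> K b *v (S *v u) = kcot b l *\<^sub>R (S *v u) \<and> - K b *v u = - kcot b l *\<^sub>R u
     \<and> (K (a + b) - K b) *v u = (c l * (kcot b l * - kcot b l - l)) *\<^sub>R u + (c l * (kcot b l + - kcot b l)) *\<^sub>R (S *v u)"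
      unfolding K_def neg matrix_vector_mult_diff_rdistrib ev[OF u(1)] scaleR_left_diff_distrib[symmetric] by simp
  qed
  have m3: "(K b + S) ** C ** (K a + S) = K (a + b) + S"
  proof (rule prod[of _ "kcot b" _ "kcot a"])
    fix u l assume u: "?A *v u = l *\<^sub>R u" "norm u = 1"
    have "kcot (a + b) l = c l * (kcot b l * kcot a l - l)" "c l * (kcot b l + kcot a l) = 1"
      using cab[OF u] by (simp_all add: mult.commute add.commute)
    then show "K b *v u = kcot b l *\<^sub>R u \<and> K b *v (S *v u) = kcot b l *\<^sub>R (S *v u) \<and> K a *v u = kcot a l *\<^sub>R u
     \<and> (K (a + b) + S) *v u = (c l * (kcot b l * kcot a l - l)) *\<^sub>R u + (c l * (kcot b l + kcot a l)) *\<^sub>R (S *v u)"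
      unfolding K_def matrix_vector_mult_add_rdistrib ev[OF u(1)] by simp
  qed
  define X where "X = K a *v x + S *v x"
  define Y where "Y = K b *v v - S *v v"
  have KC: "(C *v X) \<bullet> (K s *v y) = (K s *v (C *v X)) \<bullet> y" "(C *v Y) \<bullet> (K s *v y) = (K s *v (C *v Y)) \<bullet> y" for s y
    unfolding K_def Ssym by simp_all
  have sk: "z \<bullet> (S *v y) = - ((S *v z) \<bullet> y)" for z y using skew_inner[OF skew, of z y] by simp
  have CX: "C *v X = (C ** (K a + S)) *v x"
    unfolding X_def by (simp add: matrix_vector_mul_assoc[symmetric] matrix_vector_mult_add_rdistrib)
  have CY: "C *v Y = - ((C ** (- K b + S)) *v v)"
    unfolding Y_def by (simp add: matrix_vector_mul_assoc[symmetric] matrix_vector_mult_add_rdistrib neg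
        matrix_vector_mult_diff_distrib matrix_vector_mult_diff_rdistrib)
  have "(C *v X) \<bullet> X = - (((- K a + S) *v (C *v X)) \<bullet> x)"
    by (subst (2) X_def) (simp add: inner_add_right KC sk neg matrix_vector_mult_add_rdistrib inner_add_left inner_diff_left matrix_vector_mult_diff_rdistrib)
  also have "\<dots> = (K a *v x) \<bullet> x - (K (a + b) *v x) \<bullet> x"
    unfolding CX matrix_vector_mul_assoc matrix_mul_assoc m1 by (simp add: matrix_vector_mult_diff_rdistrib inner_diff_left)
  finally have e1: "(C *v X) \<bullet> X = (K a *v x) \<bullet> x - (K (a + b) *v x) \<bullet> x" .
  have "(C *v Y) \<bullet> Y = ((K b + S) *v (C *v Y)) \<bullet> v"
    by (subst (2) Y_def) (simp add: inner_diff_right KC sk matrix_vector_mult_add_rdistrib inner_add_left)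
  also have "\<dots> = - ((((K b + S) ** C ** (- K b + S)) *v v) \<bullet> v)"
    unfolding CY by (simp add: linear_neg[OF matrix_vector_mul_linear] matrix_vector_mul_assoc matrix_mul_assoc)
  also have "\<dots> = (K b *v v) \<bullet> v - (K (a + b) *v v) \<bullet> v"
    unfolding m2 by (simp add: matrix_vector_mult_diff_rdistrib inner_diff_left)
  finally have e2: "(C *v Y) \<bullet> Y = (K b *v v) \<bullet> v - (K (a + b) *v v) \<bullet> v" .
  have "(C *v X) \<bullet> Y = ((K b + S) *v (C *v X)) \<bullet> v"
    by (subst Y_def) (simp add: inner_diff_right KC sk matrix_vector_mult_add_rdistrib inner_add_left)
  also have "\<dots> = (K (a + b) *v x) \<bullet> v + (S *v x) \<bullet> v"
    unfolding CX matrix_vector_mul_assoc matrix_mul_assoc m3 by (simp add: matrix_vector_mult_add_rdistrib inner_add_left)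
  finally have e3: "(C *v X) \<bullet> Y = (K (a + b) *v x) \<bullet> v + (S *v x) \<bullet> v" .
  have e3': "(C *v Y) \<bullet> X = (C *v X) \<bullet> Y" unfolding C_def by (subst Ssym) (rule inner_commute)
  have "0 \<le> (C *v (X - Y)) \<bullet> (X - Y)"
    unfolding C_def
  proof (rule matfun_nonneg[OF sym])
    fix u l assume u: "?A *v u = l *\<^sub>R u" "norm u = 1"
    show "0 \<le> c l" using kcot_add(1)[OF ab(1,2) bnd(1)[OF u] sc[OF _ ab(3) u]] ab by (simp add: c_def)
  qed
  then have pos: "0 \<le> (K a *v x) \<bullet> x - (K (a + b) *v x) \<bullet> x + (K b *v v) \<bullet> v - (K (a + b) *v v) \<bullet> v
     - 2 * ((K (a + b) *v x) \<bullet> v + (S *v x) \<bullet> v)"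
    by (simp add: matrix_vector_mult_diff_distrib inner_diff_left inner_diff_right e1 e2 e3 e3')
  have sv: "(K (a + b) *v v) \<bullet> x = (K (a + b) *v x) \<bullet> v" unfolding K_def by (subst Ssym) (rule inner_commute)
  \<comment> \<open>The form for time \<open>b\<close> is replaced by the larger energy of a
    straight segment run in that time.\<close>
  have "(K b *v v) \<bullet> v \<le> (matfun (\<lambda>l. 1 / b) ?A *v v) \<bullet> v"
    unfolding K_def
  proof (rule matfun_mono[OF sym])
    fix u l assume u: "?A *v u = l *\<^sub>R u" "norm u = 1"
    show "kcot b l \<le> 1 / b" using kcot_le[OF ab(2) bnd(1)[OF u] sc[OF _ _ u]] ab by simp
  qed
  also have "\<dots> = (norm v)\<^sup>2 / b" by (simp add: matfun_const[OF sym] dot_square_norm)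
  finally show ?thesis using pos sv by (simp add: matrix_vector_right_distrib inner_add_left inner_add_right)
qed

text \<open>Side \<open>i\<close> is run in time \<open>b i\<close>, and the form at the elapsed
  time is a value function that each side raises by at most its cost. The sums always contain one
  side, because \<open>kcot_step\<close> needs positive elapsed time.\<close>

lemma kcot_polygon:
  fixes S :: "real^'n::finite^'n" and x :: "nat \<Rightarrow> real^'n"
  assumes skew: "transpose S = - S" and on: "onorm ((*v) S) < pi"
    and b: "\<And>i. 0 < b i" and x0: "x 0 = 0"
  defines "K \<equiv> \<lambda>s. matfun (kcot s) (transpose S ** S)"
  shows "(\<Sum>i<Suc n. b i) \<le> 1 \<Longrightarrow> (K (\<Sum>i<Suc n. b i) *v x (Suc n)) \<bullet> x (Suc n) \<le>
    (\<Sum>i<Suc n. (norm (x (Suc i) - x i))\<^sup>2 / b i - 2 * ((S *v x i) \<bullet> (x (Suc i) - x i)))"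
proof (induction n)
  case 0
  note sym = transpose_mult_self_symmetric[of S]
  have "(K (b 0) *v x 1) \<bullet> x 1 \<le> (matfun (\<lambda>l. 1 / b 0) (transpose S ** S) *v x 1) \<bullet> x 1"
    unfolding K_def
  proof (rule matfun_mono[OF sym])
    fix u l assume u: "(transpose S ** S) *v u = l *\<^sub>R u" "norm u = 1"
    note bd = eigenvalue_transpose_mult_self_bounds[OF u order_refl]
    have "b 0 * sqrt l \<le> 1 * sqrt l" using 0 bd by (intro mult_right_mono) auto
    then have "b 0 * sqrt l < pi" using bd on by simp
    then show "kcot (b 0) l \<le> 1 / b 0" using kcot_le b bd by blast
  qed
  also have "\<dots> = (norm (x 1))\<^sup>2 / b 0" by (simp add: matfun_const[OF sym] dot_square_norm)
  finally show ?case by (simp add: x0)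
next
  case (Suc n)
  let ?a = "\<Sum>i<Suc n. b i"
  have a: "?a > 0" using b by (intro sum_pos) auto
  have le: "?a + b (Suc n) \<le> 1" using Suc.prems by simp
  have "(K (?a + b (Suc n)) *v (x (Suc n) + (x (Suc (Suc n)) - x (Suc n)))) \<bullet> (x (Suc n) + (x (Suc (Suc n)) - x (Suc n)))
    \<le> (K ?a *v x (Suc n)) \<bullet> x (Suc n) + (norm (x (Suc (Suc n)) - x (Suc n)))\<^sup>2 / b (Suc n)
      - 2 * ((S *v x (Suc n)) \<bullet> (x (Suc (Suc n)) - x (Suc n)))"
    unfolding K_def by (rule kcot_step[OF skew on a b le])
  moreover have "?a \<le> 1" using le b[of "Suc n"] by linarith
  ultimately show ?case using Suc.IH by simp
qed

text \<open>With times proportional to side lengths, the sum of \<open>|v|^2 / b\<close> becomes the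
  square of the total length. The summand \<open>e\<close> keeps the times positive when a side has
  length zero; it is removed by letting \<open>e\<close> tend to \<open>0\<close>.\<close>

lemma zcotz_polygon:
  fixes S :: "real^'n::finite^'n" and x :: "nat \<Rightarrow> real^'n"
  assumes skew: "transpose S = - S" and on: "onorm ((*v) S) < pi" and x0: "x 0 = 0"
  shows "(matfun zcotz_sq (transpose S ** S) *v x (Suc n)) \<bullet> x (Suc n) \<le>
    (\<Sum>i<Suc n. norm (x (Suc i) - x i))\<^sup>2 - 2 * (\<Sum>i<Suc n. (S *v x i) \<bullet> (x (Suc i) - x i))"
proof -
  let ?Q = "(matfun zcotz_sq (transpose S ** S) *v x (Suc n)) \<bullet> x (Suc n)"
  let ?v = "\<lambda>i. norm (x (Suc i) - x i)"
  let ?V = "\<Sum>i<Suc n. ?v i"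
  let ?T = "\<Sum>i<Suc n. (S *v x i) \<bullet> (x (Suc i) - x i)"
  have eps: "?Q \<le> (?V + real (Suc n) * e)\<^sup>2 - 2 * ?T" if e: "e > 0" for e
  proof -
    define W where "W = ?V + real (Suc n) * e"
    have W: "W > 0" unfolding W_def using e by (intro add_nonneg_pos sum_nonneg) auto
    define b where "b i = (?v i + e) / W" for i
    have b: "b i > 0" for i using W e unfolding b_def by (intro divide_pos_pos add_nonneg_pos) auto
    have sb: "(\<Sum>i<Suc n. b i) = 1"
      using W unfolding b_def sum_divide_distrib[symmetric] sum.distrib by (simp add: W_def)
    have "?Q \<le> (\<Sum>i<Suc n. (?v i)\<^sup>2 / b i - 2 * ((S *v x i) \<bullet> (x (Suc i) - x i)))"
      using kcot_polygon[where b=b and x=x and n=n, OF skew on b x0] unfolding sb kcot_1 by simp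
    also have "\<dots> = (\<Sum>i<Suc n. (?v i)\<^sup>2 / b i) - 2 * ?T"
      by (simp only: sum_subtractf sum_distrib_left)
    also have "(\<Sum>i<Suc n. (?v i)\<^sup>2 / b i) \<le> (\<Sum>i<Suc n. W * (?v i + e))"
    proof (rule sum_mono)
      fix i
      have "(?v i)\<^sup>2 \<le> (?v i + e)\<^sup>2" using e by (intro power_mono) auto
      then have "(?v i)\<^sup>2 * W \<le> W * (?v i + e) * (?v i + e)" using W by (simp add: power2_eq_square mult.commute mult.left_commute)
      then show "(?v i)\<^sup>2 / b i \<le> W * (?v i + e)"
        unfolding b_def using W e by (simp add: divide_simps add_nonneg_pos)
    qed
    also have "(\<Sum>i<Suc n. W * (?v i + e)) = W * W"
      unfolding sum_distrib_left[symmetric] sum.distrib by (simp add: W_def)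
    finally show ?thesis by (simp add: W_def power2_eq_square)
  qed
  have "((\<lambda>e. (?V + real (Suc n) * e)\<^sup>2 - 2 * ?T) \<longlongrightarrow> (?V + real (Suc n) * 0)\<^sup>2 - 2 * ?T) (at_right 0)"
    by (intro tendsto_intros)
  then have "?Q \<le> (?V + real (Suc n) * 0)\<^sup>2 - 2 * ?T"
    by (rule tendsto_lowerbound[OF _ eventually_mono[OF eventually_at_right_less eps] trivial_limit_at_right_real])
  then show ?thesis by simp
qed

section \<open>From inscribed polygons to absolutely continuous curves\<close>

lemma integrable_on_subinterval_01:
  fixes f :: "real \<Rightarrow> 'a::banach"
  assumes "f integrable_on {0..1}" "0 \<le> a" "b \<le> 1"
  shows "f integrable_on {a..b}"
  using integrable_subinterval_real[OF assms(1)] assms by auto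

lemma curve_continuous:
  fixes x :: "real \<Rightarrow> 'a::banach"
  assumes "x' integrable_on {0..1}" "\<And>s. s \<in> {0..1} \<Longrightarrow> x s = integral {0..s} x'"
  shows "continuous_on {0..1} x"
  by (subst continuous_on_cong[OF refl assms(2)]) (simp_all add: indefinite_integral_continuous_1[OF assms(1)])

text \<open>Inscribed polygons are no longer than the curve. As \<open>x'\<close> is merely
  integrable, the area sum is not treated as a Riemann sum: on each piece the integral of
  \<open>S x \<bullet> x'\<close> is compared with the one where \<open>x\<close> is frozen at the
  left endpoint, and uniform continuity of \<open>x\<close> bounds the total error by
  \<open>N * e\<close> times the length.\<close>

lemma zcotz_quad_le_length:
  fixes S :: "real^'n::finite^'n" and x :: "real \<Rightarrow> real^'n"
  assumes skew: "transpose S = - S" and on: "onorm ((*v) S) < pi"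
    and ai: "x' absolutely_integrable_on {0..1}"
    and x: "\<And>s. s \<in> {0..1} \<Longrightarrow> x s = integral {0..s} x'"
    and ii: "(\<lambda>s. (S *v x s) \<bullet> x' s) integrable_on {0..1}"
  shows "(matfun zcotz_sq (transpose S ** S) *v x 1) \<bullet> x 1 \<le>
    (integral {0..1} (\<lambda>s. norm (x' s)))\<^sup>2 - 2 * integral {0..1} (\<lambda>s. (S *v x s) \<bullet> x' s)"
proof -
  let ?Q = "(matfun zcotz_sq (transpose S ** S) *v x 1) \<bullet> x 1"
  let ?L = "\<lambda>s. integral {0..s} (\<lambda>s. norm (x' s))"
  let ?T = "\<lambda>s. integral {0..s} (\<lambda>s. (S *v x s) \<bullet> x' s)"
  define N where "N = onorm ((*v) S)"
  have N0: "0 \<le> N" unfolding N_def by (rule onorm_pos_le[OF matrix_vector_mul_bounded_linear])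
  have Nle: "norm (S *v y) \<le> N * norm y" for y unfolding N_def by (rule onorm[OF matrix_vector_mul_bounded_linear])
  have xi: "x' integrable_on {0..1}" and ni: "(\<lambda>s. norm (x' s)) integrable_on {0..1}"
    using ai by (auto simp: absolutely_integrable_on_def)
  have L0: "0 \<le> ?L s" if "0 \<le> s" "s \<le> 1" for s
    using that by (intro integral_nonneg integrable_on_subinterval_01[OF ni]) auto
  have ucont: "uniformly_continuous_on {0..1} x"
    using curve_continuous[OF xi x] by (intro compact_uniformly_continuous) auto
  have eps: "?Q \<le> (?L 1)\<^sup>2 - 2 * (?T 1 - N * e * ?L 1)" if e: "e > 0" for e
  proof -
    obtain d where d: "d > 0" "\<And>s r. s \<in> {0..1} \<Longrightarrow> r \<in> {0..1} \<Longrightarrow> dist r s < d \<Longrightarrow> dist (x r) (x s) < e"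
      using ucont e unfolding uniformly_continuous_on_def by metis
    obtain n where n: "1 / real (Suc n) < d" using nat_approx_posE[OF d(1)] by blast
    define p where "p i = real i / real (Suc n)" for i
    have p01: "0 \<le> p i" for i by (simp add: p_def)
    have p1: "p i \<le> 1" if "i \<le> Suc n" for i using that by (simp add: p_def)
    have pm: "p i \<le> p (Suc i)" for i by (simp add: p_def divide_right_mono)
    have pd: "p (Suc i) - p i < d" for i using n by (simp add: p_def add_divide_distrib)
    have v: "x (p (Suc i)) - x (p i) = integral {p i..p (Suc i)} x'" if "i < Suc n" for i
      using Henstock_Kurzweil_Integration.integral_combine[OF p01[of i] pm[of i] integrable_on_subinterval_01[OF xi order_refl p1[of "Suc i"]]]
        x[of "p i"] x[of "p (Suc i)"] p01[of i] p01[of "Suc i"] p1[of i] p1[of "Suc i"] that by (simp add: algebra_simps)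
    have comb: "integral {0..p (Suc i)} f = integral {0..p i} f + integral {p i..p (Suc i)} f"
      if "f integrable_on {0..1}" "i < Suc n" for f :: "real \<Rightarrow> real" and i
      using Henstock_Kurzweil_Integration.integral_combine[OF p01[of i] pm[of i] integrable_on_subinterval_01[OF that(1) order_refl p1[of "Suc i"]]] that by simp
    have sub: "f integrable_on {p i..p (Suc i)}" if "f integrable_on {0..1}" "i < Suc n" for f :: "real \<Rightarrow> 'b::banach" and i
      using integrable_on_subinterval_01[OF that(1) p01 p1] that by simp
    have len: "(\<Sum>i<m. norm (x (p (Suc i)) - x (p i))) \<le> ?L (p m)" if "m \<le> Suc n" for m
      using that
    proof (induction m)
      case (Suc m)
      have "norm (x (p (Suc m)) - x (p m)) \<le> integral {p m..p (Suc m)} (\<lambda>s. norm (x' s))"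
        using Suc.prems unfolding v[OF Suc_le_lessD[OF Suc.prems]]
        by (intro integral_norm_bound_integral sub xi ni) auto
      then show ?case using Suc comb[OF ni, of m] by simp
    qed (simp add: p_def)
    have area: "\<bar>(\<Sum>i<m. (S *v x (p i)) \<bullet> (x (p (Suc i)) - x (p i))) - ?T (p m)\<bar> \<le> N * e * ?L (p m)" if "m \<le> Suc n" for m
      using that
    proof (induction m)
      case (Suc m)
      have m: "m < Suc n" using Suc.prems by simp
      let ?I = "{p m..p (Suc m)}"
      have i1: "(\<lambda>s. (S *v x (p m)) \<bullet> x' s) integrable_on ?I"
        using integrable_linear[OF sub[OF xi m] bounded_linear_inner_right] by (simp add: o_def)
      have eq1: "(S *v x (p m)) \<bullet> (x (p (Suc m)) - x (p m)) = integral ?I (\<lambda>s. (S *v x (p m)) \<bullet> x' s)"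
        unfolding v[OF m] using integral_linear[OF sub[OF xi m] bounded_linear_inner_right] by (simp add: o_def)
      have "norm (integral ?I (\<lambda>s. (S *v x (p m)) \<bullet> x' s - (S *v x s) \<bullet> x' s)) \<le> integral ?I (\<lambda>s. N * e * norm (x' s))"
      proof (rule integral_norm_bound_integral)
        show "(\<lambda>s. (S *v x (p m)) \<bullet> x' s - (S *v x s) \<bullet> x' s) integrable_on ?I"
          by (intro integrable_diff i1 sub ii m)
        show "(\<lambda>s. N * e * norm (x' s)) integrable_on ?I"
          using sub[OF ni m] by (rule integrable_on_mult_right)
        fix s assume s: "s \<in> ?I"
        have "dist (x (p m)) (x s) < e"
          using s pd[of m] p01[of m] p1[of m] p1[of "Suc m"] m by (intro d(2)) (auto simp: dist_real_def)
        then have "norm (x (p m) - x s) \<le> e" by (simp add: dist_norm)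
        then have "norm (S *v (x (p m) - x s)) \<le> N * e"
          using Nle[of "x (p m) - x s"] N0 by (meson mult_left_mono order_trans)
        then have "norm (S *v (x (p m) - x s)) * norm (x' s) \<le> N * e * norm (x' s)"
          by (intro mult_right_mono) auto
        moreover have "norm ((S *v (x (p m) - x s)) \<bullet> x' s) \<le> norm (S *v (x (p m) - x s)) * norm (x' s)"
          by (simp add: Cauchy_Schwarz_ineq2)
        ultimately show "norm ((S *v x (p m)) \<bullet> x' s - (S *v x s) \<bullet> x' s) \<le> N * e * norm (x' s)"
          by (simp add: matrix_vector_mult_diff_distrib inner_diff_left)
      qed
      then have "\<bar>(S *v x (p m)) \<bullet> (x (p (Suc m)) - x (p m)) - integral ?I (\<lambda>s. (S *v x s) \<bullet> x' s)\<bar>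
          \<le> N * e * integral ?I (\<lambda>s. norm (x' s))"
        using integral_diff[OF i1 sub[OF ii m]] by (simp add: eq1)
      then show ?case using Suc comb[OF ni m] comb[OF ii m] by (simp add: distrib_left) 
    qed (simp add: p_def)
    have pS: "p (Suc n) = 1" by (simp add: p_def)
    have x0: "x (p 0) = 0" using x[of 0] by (simp add: p_def)
    have "?Q \<le> (\<Sum>i<Suc n. norm (x (p (Suc i)) - x (p i)))\<^sup>2 - 2 * (\<Sum>i<Suc n. (S *v x (p i)) \<bullet> (x (p (Suc i)) - x (p i)))"
      using zcotz_polygon[OF skew on, of "\<lambda>i. x (p i)" n] x0 unfolding pS by simp
    moreover have "(\<Sum>i<Suc n. norm (x (p (Suc i)) - x (p i)))\<^sup>2 \<le> (?L 1)\<^sup>2"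
      using len[of "Suc n"] unfolding pS by (intro power_mono sum_nonneg) auto
    moreover have "(\<Sum>i<Suc n. (S *v x (p i)) \<bullet> (x (p (Suc i)) - x (p i))) \<ge> ?T 1 - N * e * ?L 1"
      using area[of "Suc n"] unfolding pS by linarith
    moreover have "q \<le> l - 2 * t" if "q \<le> v - 2 * u" "v \<le> l" "t \<le> u" for q l t v u :: real
      using that by linarith
    ultimately show ?thesis by blast
  qed
  have "((\<lambda>e. (?L 1)\<^sup>2 - 2 * (?T 1 - N * e * ?L 1)) \<longlongrightarrow> (?L 1)\<^sup>2 - 2 * (?T 1 - N * 0 * ?L 1)) (at_right 0)"
    by (intro tendsto_intros)
  then have "?Q \<le> (?L 1)\<^sup>2 - 2 * (?T 1 - N * 0 * ?L 1)"
    by (rule tendsto_lowerbound[OF _ eventually_mono[OF eventually_at_right_less eps] trivial_limit_at_right_real])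
  then show ?thesis by simp
qed

section \<open>The operator function \<open>(e\<^sup>X - 1) / X\<close>\<close>

primrec bpow :: "nat \<Rightarrow> ('a::real_normed_vector \<Rightarrow>\<^sub>L 'a) \<Rightarrow> 'a \<Rightarrow>\<^sub>L 'a" where
  "bpow 0 X = id_blinfun"
| "bpow (Suc n) X = (X o\<^sub>L bpow n X)"

text \<open>\<open>X\<close> and \<open>H\<close> need not commute, so the derivatives of the powers
  are encoded by the product rule itself.\<close>

primrec dpow :: "nat \<Rightarrow> ('a::real_normed_vector \<Rightarrow>\<^sub>L 'a) \<Rightarrow> ('a \<Rightarrow>\<^sub>L 'a) \<Rightarrow> 'a \<Rightarrow>\<^sub>L 'a" where
  "dpow 0 X H = 0"
| "dpow (Suc n) X H = (H o\<^sub>L bpow n X) + (X o\<^sub>L dpow n X H)"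

primrec d2pow :: "nat \<Rightarrow> ('a::real_normed_vector \<Rightarrow>\<^sub>L 'a) \<Rightarrow> ('a \<Rightarrow>\<^sub>L 'a) \<Rightarrow> ('a \<Rightarrow>\<^sub>L 'a) \<Rightarrow> 'a \<Rightarrow>\<^sub>L 'a" where
  "d2pow 0 X H K = 0"
| "d2pow (Suc n) X H K = (H o\<^sub>L dpow n X K) + ((K o\<^sub>L dpow n X H) + (X o\<^sub>L d2pow n X H K))"

lemma norm_compose_le:
  "norm X \<le> a \<Longrightarrow> norm Y \<le> b \<Longrightarrow> norm (X o\<^sub>L Y) \<le> a * b"
  by (meson norm_blinfun_compose mult_mono norm_ge_zero order_trans)

lemma norm_bpow_le: "norm X \<le> r \<Longrightarrow> norm (bpow n X) \<le> r ^ n"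
proof (induction n)
  case (Suc n)
  then show ?case by (simp add: norm_compose_le)
qed (simp add: norm_blinfun_id_le)

text \<open>With \<open>1 \<le> r\<close> the exponent \<open>n\<close> may replace the sharp
  \<open>n - 1\<close>, which keeps the induction free of subtraction.\<close>

lemma norm_dpow_le:
  assumes "norm X \<le> r" "1 \<le> r"
  shows "norm (dpow n X H) \<le> real n * r ^ n * norm H"
proof (induction n)
  case (Suc n)
  have "norm (dpow (Suc n) X H) \<le> norm H * r ^ n + r * (real n * r ^ n * norm H)"
    using norm_compose_le[OF order_refl norm_bpow_le[OF assms(1)], of H n] norm_compose_le[OF assms(1) Suc.IH]
    by (simp add: norm_triangle_le)
  also have "norm H * r ^ n \<le> norm H * r ^ Suc n"
    using assms by (intro mult_left_mono power_increasing) auto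
  finally show ?case by (simp add: algebra_simps)
qed simp

lemma norm_d2pow_le:
  assumes "norm X \<le> r" "1 \<le> r"
  shows "norm (d2pow n X H K) \<le> (real n)\<^sup>2 * r ^ n * norm H * norm K"
proof (induction n)
  case (Suc n)
  have "norm (d2pow (Suc n) X H K) \<le> norm H * (real n * r ^ n * norm K) + (norm K * (real n * r ^ n * norm H)
     + r * ((real n)\<^sup>2 * r ^ n * norm H * norm K))"
    using norm_compose_le[OF order_refl norm_dpow_le[OF assms], of H n K]
      norm_compose_le[OF order_refl norm_dpow_le[OF assms], of K n H] norm_compose_le[OF assms(1) Suc.IH]
    by (simp only: d2pow.simps) (intro norm_triangle_le add_mono, assumption+)
  also have "\<dots> = 2 * real n * (r ^ n * (norm H * norm K)) + (real n)\<^sup>2 * (r ^ Suc n * (norm H * norm K))"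
    by (simp add: algebra_simps)
  also have "\<dots> \<le> 2 * real n * (r ^ Suc n * (norm H * norm K)) + (real n)\<^sup>2 * (r ^ Suc n * (norm H * norm K))"
    using assms by (intro add_right_mono mult_left_mono mult_right_mono power_increasing) auto
  also have "\<dots> = (2 * real n + (real n)\<^sup>2) * (r ^ Suc n * (norm H * norm K))" by (simp only: distrib_right)
  also have "\<dots> \<le> (real (Suc n))\<^sup>2 * (r ^ Suc n * (norm H * norm K))"
    using assms by (intro mult_right_mono) (auto simp: power2_eq_square algebra_simps)
  finally show ?case by (simp only: mult.assoc)
qed simp

lemma has_derivative_bpow: "(bpow n has_derivative dpow n X) (at X)"
proof (induction n)
  case (Suc n)
  from bounded_bilinear.FDERIV[OF bounded_bilinear_blinfun_compose has_derivative_ident Suc.IH]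
  show ?case by (simp add: add.commute)
qed simp

lemma has_derivative_dpow: "((\<lambda>X. dpow n X H) has_derivative d2pow n X H) (at X)"
proof (induction n)
  case (Suc n)
  have 1: "((\<lambda>X. (H o\<^sub>L bpow n X)) has_derivative (\<lambda>K. (H o\<^sub>L dpow n X K))) (at X)"
    using bounded_bilinear.FDERIV[OF bounded_bilinear_blinfun_compose has_derivative_const[of H] has_derivative_bpow[of n X]] by simp
  have 2: "((\<lambda>X. (X o\<^sub>L dpow n X H)) has_derivative (\<lambda>K. (X o\<^sub>L d2pow n X H K) + (K o\<^sub>L dpow n X H))) (at X)"
    using bounded_bilinear.FDERIV[OF bounded_bilinear_blinfun_compose has_derivative_ident Suc.IH] by simp
  from has_derivative_add[OF 1 2] show ?case by (simp add: add.commute add.left_commute)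
qed simp

text \<open>Weierstrass test: \<open>a\<close> dominates the derivatives uniformly on
  \<open>S\<close>, so the tails of the differentiated series are uniformly small.\<close>

lemma has_derivative_suminf_dominated:
  fixes f :: "nat \<Rightarrow> 'a::real_normed_vector \<Rightarrow> 'b::banach"
  assumes S: "convex S" "open S" "x \<in> S"
    and d: "\<And>n x. x \<in> S \<Longrightarrow> (f n has_derivative f' n x) (at x)"
    and b: "\<And>n x h. x \<in> S \<Longrightarrow> norm (f' n x h) \<le> a n * norm h"
    and a: "summable a" and sf: "\<And>x. x \<in> S \<Longrightarrow> summable (\<lambda>n. f n x)"
  shows "((\<lambda>x. \<Sum>n. f n x) has_derivative (\<lambda>h. \<Sum>n. f' n x h)) (at x)"
proof -
  have sum': "summable (\<lambda>n. f' n x h)" if "x \<in> S" for x h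
    by (rule summable_comparison_test'[OF summable_mult2[OF a, of "norm h"]]) (use b that in auto)
  have "\<exists>g. \<forall>x\<in>S. (\<lambda>n. f n x) sums g x \<and> (g has_derivative (\<lambda>h. \<Sum>n. f' n x h)) (at x within S)"
  proof (rule has_derivative_series[where f = f and f' = f' and x = x, OF S(1) _ _ S(3) summable_sums[OF sf[OF S(3)]]])
    show "(f n has_derivative f' n x) (at x within S)" if "x \<in> S" for n x
      using d[OF that] by (rule has_derivative_at_withinI)
    fix e :: real assume e: "e > 0"
    obtain N where N: "\<And>n. n \<ge> N \<Longrightarrow> norm (\<Sum>i. a (i + n)) < e" using suminf_exist_split[OF e a] by blast
    show "\<forall>\<^sub>F n in sequentially. \<forall>x\<in>S. \<forall>h. norm ((\<Sum>i<n. f' i x h) - (\<Sum>n. f' n x h)) \<le> e * norm h"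
    proof (rule eventually_sequentiallyI[of N], intro ballI allI)
      fix n x and h :: 'a assume n: "N \<le> n" and x: "x \<in> S"
      have sa: "summable (\<lambda>i. a (i + n) * norm h)" by (intro summable_mult2 summable_ignore_initial_segment a)
      have "norm ((\<Sum>i<n. f' i x h) - (\<Sum>n. f' n x h)) = norm (\<Sum>i. f' (i + n) x h)"
        using suminf_split_initial_segment[OF sum'[OF x], of h n] by simp
      also have "\<dots> \<le> (\<Sum>i. a (i + n) * norm h)"
        by (rule norm_suminf_le[OF b[OF x] sa])
      also have "\<dots> = (\<Sum>i. a (i + n)) * norm h"
        by (rule suminf_mult2[symmetric, OF summable_ignore_initial_segment[OF a]])
      also have "\<dots> \<le> e * norm h" using N[OF n] by (intro mult_right_mono) auto
      finally show "norm ((\<Sum>i<n. f' i x h) - (\<Sum>n. f' n x h)) \<le> e * norm h" .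
    qed
  qed
  then obtain g where g: "\<And>x. x \<in> S \<Longrightarrow> (\<lambda>n. f n x) sums g x"
    "\<And>x. x \<in> S \<Longrightarrow> (g has_derivative (\<lambda>h. \<Sum>n. f' n x h)) (at x within S)" by blast
  have "(g has_derivative (\<lambda>h. \<Sum>n. f' n x h)) (at x)"
    using g(2)[OF S(3)] at_within_open[OF S(3) S(2)] by simp
  then show ?thesis
    by (rule has_derivative_transform_within_open[OF _ S(2,3)]) (use g(1) in \<open>simp add: sums_iff\<close>)
qed

definition expm1_div :: "('a::banach \<Rightarrow>\<^sub>L 'a) \<Rightarrow> 'a \<Rightarrow>\<^sub>L 'a" where
  "expm1_div X = (\<Sum>n. bpow n X /\<^sub>R fact (Suc n))"

definition dexpm1_div :: "('a::banach \<Rightarrow>\<^sub>L 'a) \<Rightarrow> ('a \<Rightarrow>\<^sub>L 'a) \<Rightarrow> 'a \<Rightarrow>\<^sub>L 'a" where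
  "dexpm1_div X H = (\<Sum>n. dpow n X H /\<^sub>R fact (Suc n))"

definition d2expm1_div :: "('a::banach \<Rightarrow>\<^sub>L 'a) \<Rightarrow> ('a \<Rightarrow>\<^sub>L 'a) \<Rightarrow> ('a \<Rightarrow>\<^sub>L 'a) \<Rightarrow> 'a \<Rightarrow>\<^sub>L 'a" where
  "d2expm1_div X H K = (\<Sum>n. d2pow n X H K /\<^sub>R fact (Suc n))"

text \<open>The weights \<open>1\<close>, \<open>n\<close> and \<open>n^2\<close> are at most
  \<open>4 ^ n\<close>, so all three series are dominated by the exponential series at
  \<open>4 * r\<close>.\<close>

lemma summable_majorant:
  fixes r :: real
  assumes "0 \<le> r"
  shows "summable (\<lambda>n. (real n)\<^sup>2 * r ^ n / fact (Suc n) * C)" "summable (\<lambda>n. real n * r ^ n / fact (Suc n) * C)"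
    "summable (\<lambda>n. r ^ n / fact (Suc n) * C)"
proof -
  have base: "summable (\<lambda>n. (4 * r) ^ n / fact n)"
    using summable_exp[of "4 * r"] by (simp add: field_simps)
  have n2: "(real n)\<^sup>2 \<le> 4 ^ n" for n
  proof -
    have "(real n)\<^sup>2 \<le> (2 ^ n)\<^sup>2" using of_nat_less_two_power[of n] by (intro power_mono) (auto simp: less_imp_le)
    also have "\<dots> = (4::real) ^ n" by (simp add: power2_eq_square power_mult_distrib[symmetric])
    finally show ?thesis .
  qed
  have c: "summable (\<lambda>n. w n * r ^ n / fact (Suc n) * C)" if w: "\<And>n. 0 \<le> w n" "\<And>n. w n \<le> 4 ^ n" for w
  proof (rule summable_mult2, rule summable_comparison_test'[OF base])
    fix n
    have "w n * r ^ n / fact (Suc n) \<le> 4 ^ n * r ^ n / fact n"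
      using w assms by (intro frac_le mult_right_mono) (auto intro: fact_mono)
    then show "norm (w n * r ^ n / fact (Suc n)) \<le> (4 * r) ^ n / fact n"
      using w assms by (simp add: power_mult_distrib)
  qed
  show "summable (\<lambda>n. (real n)\<^sup>2 * r ^ n / fact (Suc n) * C)" by (rule c) (auto simp: n2)
  have "real n \<le> 4 ^ n" for n
    using order_trans[OF _ n2[of n], of "real n"] by (cases n) (auto simp: power2_eq_square)
  then show "summable (\<lambda>n. real n * r ^ n / fact (Suc n) * C)" by (intro c) auto
  show "summable (\<lambda>n. r ^ n / fact (Suc n) * C)" using c[of "\<lambda>n. 1"] by simp
qed

lemma summable_expm1_div: "summable (\<lambda>n. bpow n (X :: 'a::banach \<Rightarrow>\<^sub>L 'a) /\<^sub>R fact (Suc n))"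
proof (rule summable_comparison_test'[OF summable_majorant(3)[of "norm X" 1]])
  show "norm (bpow n X /\<^sub>R fact (Suc n)) \<le> norm X ^ n / fact (Suc n) * 1" for n
    using divide_right_mono[OF norm_bpow_le[of X, OF order_refl, of n], of "fact (Suc n)"]
    by (simp only: norm_scaleR) (simp add: divide_inverse mult.commute)
qed simp

lemma summable_dexpm1_div: "summable (\<lambda>n. dpow n (X :: 'a::banach \<Rightarrow>\<^sub>L 'a) H /\<^sub>R fact (Suc n))"
proof (rule summable_comparison_test'[OF summable_majorant(2)[of "norm X + 1" "norm H"]])
  show "norm (dpow n X H /\<^sub>R fact (Suc n)) \<le> real n * (norm X + 1) ^ n / fact (Suc n) * norm H" for n
    using divide_right_mono[OF norm_dpow_le[of X "norm X + 1" n H], of "fact (Suc n)"]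
    by (simp only: norm_scaleR) (simp add: divide_inverse mult.commute mult.left_commute)
qed simp

lemma has_derivative_expm1_div: "(expm1_div has_derivative dexpm1_div X) (at X)"
proof -
  let ?r = "norm X + 1"
  have nb: "norm Y \<le> ?r" if "Y \<in> ball X 1" for Y
    using that norm_triangle_ineq2[of Y X] by (simp add: dist_norm norm_minus_commute)
  have "((\<lambda>X. \<Sum>n. bpow n X /\<^sub>R fact (Suc n)) has_derivative (\<lambda>H. \<Sum>n. dpow n X H /\<^sub>R fact (Suc n))) (at X)"
  proof (rule has_derivative_suminf_dominated[where S = "ball X 1" and a = "\<lambda>n. real n * ?r ^ n / fact (Suc n) * 1"])
    show "summable (\<lambda>n. real n * ?r ^ n / fact (Suc n) * 1)" by (rule summable_majorant) simp
    show "((\<lambda>X. bpow n X /\<^sub>R fact (Suc n)) has_derivative (\<lambda>H. dpow n Y H /\<^sub>R fact (Suc n))) (at Y)" for n Y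
      by (intro has_derivative_scaleR_right has_derivative_bpow)
    show "norm (dpow n Y H /\<^sub>R fact (Suc n)) \<le> real n * ?r ^ n / fact (Suc n) * 1 * norm H" if "Y \<in> ball X 1" for n Y H
      using divide_right_mono[OF norm_dpow_le[OF nb[OF that], of n H], of "fact (Suc n)"]
      by (simp only: norm_scaleR) (simp add: divide_inverse mult.commute mult.left_commute)
  qed (use summable_expm1_div in \<open>simp_all del: fact_Suc\<close>)
  then show ?thesis unfolding expm1_div_def[abs_def] dexpm1_div_def[abs_def] .
qed

lemma has_derivative_dexpm1_div: "((\<lambda>X. dexpm1_div X H) has_derivative d2expm1_div X H) (at X)"
proof -
  let ?r = "norm X + 1"
  have nb: "norm Y \<le> ?r" if "Y \<in> ball X 1" for Y
    using that norm_triangle_ineq2[of Y X] by (simp add: dist_norm norm_minus_commute)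
  have "((\<lambda>X. \<Sum>n. dpow n X H /\<^sub>R fact (Suc n)) has_derivative (\<lambda>K. \<Sum>n. d2pow n X H K /\<^sub>R fact (Suc n))) (at X)"
  proof (rule has_derivative_suminf_dominated[where S = "ball X 1" and a = "\<lambda>n. (real n)\<^sup>2 * ?r ^ n / fact (Suc n) * norm H"])
    show "summable (\<lambda>n. (real n)\<^sup>2 * ?r ^ n / fact (Suc n) * norm H)" by (rule summable_majorant) simp
    show "((\<lambda>X. dpow n X H /\<^sub>R fact (Suc n)) has_derivative (\<lambda>K. d2pow n Y H K /\<^sub>R fact (Suc n))) (at Y)" for n Y
      by (intro has_derivative_scaleR_right has_derivative_dpow)
    show "norm (d2pow n Y H K /\<^sub>R fact (Suc n)) \<le> (real n)\<^sup>2 * ?r ^ n / fact (Suc n) * norm H * norm K" if "Y \<in> ball X 1" for n Y K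
      using divide_right_mono[OF norm_d2pow_le[OF nb[OF that], of n H K], of "fact (Suc n)"]
      by (simp only: norm_scaleR) (simp add: divide_inverse mult.commute mult.left_commute)
  qed (use summable_dexpm1_div in \<open>simp_all del: fact_Suc\<close>)
  then show ?thesis unfolding dexpm1_div_def[abs_def] d2expm1_div_def[abs_def] .
qed

lemma dpow_self: "dpow n X X = real n *\<^sub>R bpow n X"
  by (induction n) (simp_all add: bounded_bilinear.scaleR_right[OF bounded_bilinear_blinfun_compose] scaleR_left_distrib)

text \<open>Both sides are \<open>e^X\<close>: the left one is the derivative of
  \<open>s * E(s X)\<close> at \<open>s = 1\<close>, and coefficients agree because
  \<open>(1 + n) / (n + 1)! = 1 / n!\<close>. Applied to multiples of \<open>2 S\<close>, this is
  the differential equation of the geodesics.\<close>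

lemma expm1_div_add_dexpm1_div_self: "expm1_div X + dexpm1_div X X = id_blinfun + (X o\<^sub>L expm1_div X)"
proof -
  have s: "summable (\<lambda>n. bpow n X /\<^sub>R fact n)"
  proof -
    have "summable (\<lambda>n. X o\<^sub>L (bpow n X /\<^sub>R fact (Suc n)))"
      by (rule bounded_linear.summable[OF bounded_bilinear.bounded_linear_right[OF bounded_bilinear_blinfun_compose] summable_expm1_div])
    then have "summable (\<lambda>n. bpow (Suc n) X /\<^sub>R fact (Suc n))" by (simp add: bounded_bilinear.scaleR_right[OF bounded_bilinear_blinfun_compose])
    then show ?thesis using summable_Suc_iff[of "\<lambda>n. bpow n X /\<^sub>R fact n"] by blast
  qed
  have t: "(1 + real n) * inverse (fact (Suc n)) = inverse (fact n)" for n
    by (simp add: mult.assoc[symmetric] add_eq_0_iff)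
  have "expm1_div X + dexpm1_div X X = (\<Sum>n. bpow n X /\<^sub>R fact (Suc n) + dpow n X X /\<^sub>R fact (Suc n))"
    unfolding expm1_div_def dexpm1_div_def by (rule suminf_add[OF summable_expm1_div summable_dexpm1_div])
  also have "\<dots> = (\<Sum>n. bpow n X /\<^sub>R fact n)"
  proof (rule suminf_cong)
    fix n
    have "bpow n X /\<^sub>R fact (Suc n) + dpow n X X /\<^sub>R fact (Suc n) = ((1 + real n) * inverse (fact (Suc n))) *\<^sub>R bpow n X"
      unfolding dpow_self distrib_right scaleR_left_distrib by (simp add: mult.commute del: fact_Suc)
    then show "bpow n X /\<^sub>R fact (Suc n) + dpow n X X /\<^sub>R fact (Suc n) = bpow n X /\<^sub>R fact n"
      by (simp only: t)
  qed
  also have "\<dots> = id_blinfun + (\<Sum>n. bpow (Suc n) X /\<^sub>R fact (Suc n))"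
    using suminf_split_head[OF s] by simp
  also have "(\<Sum>n. bpow (Suc n) X /\<^sub>R fact (Suc n)) = (X o\<^sub>L expm1_div X)"
    unfolding expm1_div_def
    by (subst bounded_linear.suminf[OF bounded_bilinear.bounded_linear_right[OF bounded_bilinear_blinfun_compose] summable_expm1_div])
      (simp add: bounded_bilinear.scaleR_right[OF bounded_bilinear_blinfun_compose])
  finally show ?thesis .
qed

section \<open>The convex set \<open>\<Omega>\<^sub>*\<close> and geodesics\<close>

text \<open>Used twice: geodesics have constant speed, and a solution of the homogeneous equation
  that starts at zero stays zero, which yields uniqueness.\<close>

lemma skew_flow_norm_const:
  fixes d :: "real \<Rightarrow> real^'n::finite"
  assumes skew: "transpose S = - S" and d: "\<And>s. (d has_vector_derivative c *\<^sub>R (S *v d s)) (at s)"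
  shows "norm (d s) = norm (d r)"
proof -
  have "((\<lambda>s. d s \<bullet> d s) has_real_derivative 0) (at s)" for s
  proof -
    have "(S *v d s) \<bullet> d s = 0" using skew_inner[OF skew, of "d s" "d s"] by (simp add: inner_commute)
    moreover have "((\<lambda>s. d s \<bullet> d s) has_vector_derivative (d s \<bullet> (c *\<^sub>R (S *v d s)) + (c *\<^sub>R (S *v d s)) \<bullet> d s)) (at s)"
      by (rule bounded_bilinear.has_vector_derivative[OF bounded_bilinear_inner d d])
    ultimately show ?thesis by (simp add: inner_commute has_real_derivative_iff_has_vector_derivative)
  qed
  then have "d s \<bullet> d s = d r \<bullet> d r" using DERIV_isconst_all[of "\<lambda>s. d s \<bullet> d s"] by blast
  then show ?thesis by (simp add: norm_eq_sqrt_inner)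
qed

lemma has_vector_derivative_matrix_vector:
  fixes A :: "real^'n::finite^'n"
  assumes "(f has_vector_derivative f') F"
  shows "((\<lambda>s. A *v f s) has_vector_derivative (A *v f')) F"
  by (rule bounded_linear.has_vector_derivative[OF matrix_vector_mul_bounded_linear assms])

locale metivier_group =
  fixes U :: "'m::finite \<Rightarrow> real^'q::finite^'q"
  assumes met: "metivier U"
begin

abbreviation "S \<equiv> Smat U"

lemma skew: "transpose (S \<tau>) = - S \<tau>"
proof -
  have sk: "U j $ k $ i = - (U j $ i $ k)" for j i k
  proof -
    have "U j $ k $ i = transpose (U j) $ i $ k" by (simp add: transpose_def)
    also have "transpose (U j) = - U j" using met by (simp add: metivier_def)
    finally show ?thesis by simp
  qed
  have "transpose (S \<tau>) $ i $ k = (- S \<tau>) $ i $ k" for i k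
  proof -
    have "transpose (S \<tau>) $ i $ k = (\<Sum>j\<in>UNIV. \<tau> $ j * (U j $ k $ i))"
      by (simp add: Smat_def transpose_def sum_component vector_scaleR_component)
    also have "\<dots> = - (\<Sum>j\<in>UNIV. \<tau> $ j * (U j $ i $ k))"
      by (subst sk) (simp add: sum_negf)
    finally show ?thesis by (simp add: Smat_def sum_component vector_scaleR_component)
  qed
  then show ?thesis by (simp only: vec_eq_iff) blast
qed

lemma S_add: "S (a + b) = S a + S b"
  by (simp add: Smat_def scaleR_left_distrib sum.distrib)

lemma S_scale: "S (c *\<^sub>R a) = c *\<^sub>R S a"
  by (simp add: Smat_def scaleR_right.sum)

lemma S_mult: "S (a + b) *v x = S a *v x + S b *v x" "S (a - b) *v x = S a *v x - S b *v x"
  "S (c *\<^sub>R a) *v x = c *\<^sub>R (S a *v x)" "S 0 *v x = 0" "S (- a) *v x = - (S a *v x)"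
proof -
  show 1: "S (a + b) *v x = S a *v x + S b *v x" for a b by (simp add: S_add matrix_vector_mult_add_rdistrib)
  show 2: "S (c *\<^sub>R a) *v x = c *\<^sub>R (S a *v x)" for c a by (simp add: S_scale scaleR_matrix_vector_assoc)
  show 3: "S (- a) *v x = - (S a *v x)" using 2[of "-1" a] by simp
  show "S (a - b) *v x = S a *v x - S b *v x" using 1[of a "-1 *\<^sub>R b"] 2[of "-1" b] by simp
  show "S 0 *v x = 0" using 2[of 0 a] by simp
qed

lemma S_nonzero: "h \<noteq> 0 \<Longrightarrow> v \<noteq> 0 \<Longrightarrow> S h *v v \<noteq> 0"
proof
  assume "h \<noteq> 0" "v \<noteq> 0" "S h *v v = 0"
  then have "invertible (S h)" using met by (simp add: metivier_def Smat_def)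
  then obtain B where "B ** S h = mat 1" by (auto simp: invertible_def)
  then have "v = B *v (S h *v v)" by (simp add: matrix_vector_mul_assoc)
  with \<open>S h *v v = 0\<close> \<open>v \<noteq> 0\<close> show False by simp
qed

lemma S_skew: "(S \<tau> *v x) \<bullet> y = - ((S \<tau> *v y) \<bullet> x)" "(S \<tau> *v x) \<bullet> x = 0"
  using skew_inner[OF skew, of \<tau> x y] skew_inner[OF skew, of \<tau> x x] by (simp_all add: inner_commute)

lemma inner_Uform: "\<tau> \<bullet> Uform U x y = (S \<tau> *v x) \<bullet> y"
proof -
  have "S \<tau> *v x = (\<Sum>j\<in>UNIV. (\<tau> $ j) *\<^sub>R (U j *v x))"
    unfolding Smat_def
    by (induction rule: infinite_finite_induct[of _ UNIV])
      (simp_all add: matrix_vector_mult_add_rdistrib scaleR_matrix_vector_assoc)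
  then show ?thesis by (simp add: Uform_def inner_vec_def[of \<tau>] inner_sum_left)
qed

definition SL :: "real^'m \<Rightarrow> (real^'q) \<Rightarrow>\<^sub>L (real^'q)" where
  "SL \<tau> = Blinfun ((*v) (S \<tau>))"

lemma SL_apply: "blinfun_apply (SL \<tau>) x = S \<tau> *v x"
  unfolding SL_def by (simp add: bounded_linear_Blinfun_apply matrix_vector_mul_bounded_linear)

lemma linear_SL: "linear SL"
  by (rule linearI; rule blinfun_eqI) (simp_all add: SL_apply S_mult plus_blinfun.rep_eq scaleR_blinfun.rep_eq)

lemma bounded_linear_SL: "bounded_linear SL"
  using linear_SL by (simp add: linear_conv_bounded_linear)

lemma norm_SL: "norm (SL \<tau>) = onorm ((*v) (S \<tau>))"
  by (simp add: norm_blinfun.rep_eq SL_apply[abs_def, symmetric])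

lemma Omega_SL: "Omega U = {\<tau>. norm (SL \<tau>) < pi}"
  by (simp add: Omega_def norm_SL)

lemma open_Omega: "open (Omega U)"
  unfolding Omega_SL
  by (intro open_Collect_less continuous_intros linear_continuous_on bounded_linear_SL)

lemma zero_in_Omega: "0 \<in> Omega U"
  by (simp add: Omega_SL linear_0[OF linear_SL])

lemma convex_Omega: "convex (Omega U)"
  unfolding convex_def
proof (intro ballI allI impI)
  fix x y and u v :: real assume h: "x \<in> Omega U" "y \<in> Omega U" "0 \<le> u" "0 \<le> v" "u + v = 1"
  have "norm (SL (u *\<^sub>R x + v *\<^sub>R y)) \<le> u * norm (SL x) + v * norm (SL y)"
    using h by (simp add: linear_add[OF linear_SL] linear_scale[OF linear_SL] norm_triangle_le)
  also have "\<dots> < pi" using h convex_bound_lt[of "norm (SL x)" pi "norm (SL y)" u v] by (simp add: Omega_SL)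
  finally show "u *\<^sub>R x + v *\<^sub>R y \<in> Omega U" by (simp add: Omega_SL)
qed

text \<open>For one fixed unit vector \<open>v\<close> the linear map sending \<open>\<tau>\<close>
  to \<open>S \<tau> *v v\<close> is injective by the Metivier condition, so its norm, which is
  below \<open>pi\<close> on the set, controls \<open>\<tau>\<close>.\<close>

lemma bounded_Omega: "bounded (Omega U)"
proof -
  define v where "v = (axis undefined 1 :: real^'q)"
  have v: "norm v = 1" by (simp add: v_def)
  have lin: "linear (\<lambda>\<tau>. S \<tau> *v v)" by (rule linearI) (simp_all add: S_mult)
  have "inj (\<lambda>\<tau>. S \<tau> *v v)"
    unfolding linear_injective_0[OF lin] using S_nonzero[of _ v] v by (metis norm_zero zero_neq_one)
  then obtain B where B: "B > 0" "\<And>\<tau>. B * norm \<tau> \<le> norm (S \<tau> *v v)"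
    using linear_inj_bounded_below_pos[OF lin] by metis
  have "norm x \<le> pi / B" if "x \<in> Omega U" for x
    using B(2)[of x] B(1) norm_blinfun[of "SL x" v] that v by (simp add: Omega_SL SL_apply field_simps)
  then show ?thesis unfolding bounded_iff by blast
qed

lemma closure_Omega_le: "\<tau> \<in> closure (Omega U) \<Longrightarrow> norm (SL \<tau>) \<le> pi"
proof -
  have "closed {\<tau>. norm (SL \<tau>) \<le> pi}"
    by (intro closed_Collect_le continuous_intros linear_continuous_on bounded_linear_SL)
  moreover have "Omega U \<subseteq> {\<tau>. norm (SL \<tau>) \<le> pi}" by (auto simp: Omega_SL)
  ultimately show "\<tau> \<in> closure (Omega U) \<Longrightarrow> norm (SL \<tau>) \<le> pi" using closure_minimal by blast
qed

lemma scale_closure_Omega: "\<tau> \<in> closure (Omega U) \<Longrightarrow> 0 \<le> r \<Longrightarrow> r < 1 \<Longrightarrow> r *\<^sub>R \<tau> \<in> Omega U"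
proof -
  assume h: "\<tau> \<in> closure (Omega U)" "0 \<le> r" "r < 1"
  have "r * norm (SL \<tau>) \<le> r * pi" using closure_Omega_le[OF h(1)] h by (intro mult_left_mono)
  also have "\<dots> < pi" using h by simp
  finally show ?thesis using h by (simp add: Omega_SL linear_scale[OF linear_SL])
qed

text \<open>The test vector \<open>v\<close> realizes the operator norm of the midpoint.
  \<open>S a *v v\<close> and \<open>S b *v v\<close> differ because \<open>S (a - b)\<close> is
  injective, and the parallelogram identity makes their mean strictly shorter than
  \<open>pi\<close>.\<close>

lemma strict_convex_Omega:
  assumes "a \<in> closure (Omega U)" "b \<in> closure (Omega U)" "a \<noteq> b"
  shows "(1/2) *\<^sub>R (a + b) \<in> Omega U"
proof -
  let ?m = "(1/2) *\<^sub>R (a + b)"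
  have cs: "compact (sphere (0::real^'q) 1)" "sphere (0::real^'q) 1 \<noteq> {}"
    by (auto simp: sphere_eq_empty)
  have "continuous_on (sphere 0 1) (\<lambda>v. norm (S ?m *v v))"
    by (intro continuous_intros linear_continuous_on matrix_vector_mul_bounded_linear)
  then obtain v where v: "v \<in> sphere 0 1" and vm: "\<And>w. w \<in> sphere 0 1 \<Longrightarrow> norm (S ?m *v w) \<le> norm (S ?m *v v)"
    using continuous_attains_sup[OF cs] by blast
  have nv: "norm v = 1" using v by simp
  have on: "norm (SL ?m) \<le> norm (S ?m *v v)"
  proof (rule norm_blinfun_bound)
    fix x :: "real^'q"
    show "norm (SL ?m x) \<le> norm (S ?m *v v) * norm x"
    proof (cases "x = 0")
      case False
      have "norm (S ?m *v ((1 / norm x) *\<^sub>R x)) \<le> norm (S ?m *v v)" using False by (intro vm) simp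
      then show ?thesis using False by (simp add: SL_apply matrix_vector_mult_scaleR field_simps)
    qed simp
  qed simp
  have le: "norm (S c *v v) \<le> pi" if "c \<in> closure (Omega U)" for c
    using norm_blinfun[of "SL c" v] closure_Omega_le[OF that] nv by (simp add: SL_apply)
  have ne: "S a *v v \<noteq> S b *v v"
  proof
    assume "S a *v v = S b *v v"
    then have "S (a - b) *v v = 0" by (simp add: S_mult)
    moreover have "v \<noteq> 0" using nv by auto
    ultimately show False using S_nonzero[of "a - b" v] assms by simp
  qed
  have "4 * (norm (S ?m *v v))\<^sup>2 + (norm (S a *v v - S b *v v))\<^sup>2 = 2 * (norm (S a *v v))\<^sup>2 + 2 * (norm (S b *v v))\<^sup>2"
    unfolding power2_norm_eq_inner by (simp add: S_mult inner_add_left inner_add_right inner_diff_left inner_diff_right algebra_simps inner_commute)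
  moreover have "(norm (S a *v v))\<^sup>2 \<le> pi\<^sup>2" "(norm (S b *v v))\<^sup>2 \<le> pi\<^sup>2" using le assms by (auto intro!: power_mono)
  moreover have "0 < (norm (S a *v v - S b *v v))\<^sup>2" using ne by simp
  ultimately have "(norm (S ?m *v v))\<^sup>2 < pi\<^sup>2" by linarith
  then have "norm (S ?m *v v) < pi" by (rule power2_less_imp_less) simp
  then show ?thesis using on by (simp add: Omega_SL)
qed

section \<open>Geodesics as solutions of a linear differential equation\<close>

definition geo :: "real^'m \<Rightarrow> real^'q \<Rightarrow> real \<Rightarrow> real^'q" where
  "geo \<tau> p s = s *\<^sub>R blinfun_apply (expm1_div (s *\<^sub>R (2 *\<^sub>R SL \<tau>))) p"

definition dgeo :: "real^'m \<Rightarrow> real^'q \<Rightarrow> real \<Rightarrow> real^'q" where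
  "dgeo \<tau> p s = p + 2 *\<^sub>R (S \<tau> *v geo \<tau> p s)"

definition tgeo :: "real^'m \<Rightarrow> real^'q \<Rightarrow> real^'m" where
  "tgeo \<tau> p = integral {0..1} (\<lambda>s. (1/2) *\<^sub>R Uform U (geo \<tau> p s) (dgeo \<tau> p s))"

lemma geo_0: "geo \<tau> p 0 = 0" by (simp add: geo_def)

lemma geo_linear: "geo \<tau> (p + r) s = geo \<tau> p s + geo \<tau> r s" "geo \<tau> (c *\<^sub>R p) s = c *\<^sub>R geo \<tau> p s"
  by (simp_all add: geo_def blinfun.add_right blinfun.scaleR_right scaleR_right_distrib)

lemma has_vector_derivative_geo: "(geo \<tau> p has_vector_derivative dgeo \<tau> p s) (at s)"
proof -
  let ?X = "2 *\<^sub>R SL \<tau>"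
  have lin: "dexpm1_div X (c *\<^sub>R H) = c *\<^sub>R dexpm1_div X H" for X H :: "(real^'q) \<Rightarrow>\<^sub>L (real^'q)" and c
    using linear_scale[OF has_derivative_linear[OF has_derivative_expm1_div]] by blast
  have a: "((\<lambda>s. s *\<^sub>R ?X) has_derivative (\<lambda>h. h *\<^sub>R ?X)) (at s)"
    by (auto intro!: derivative_eq_intros)
  have "((\<lambda>s. expm1_div (s *\<^sub>R ?X)) has_derivative (\<lambda>h. dexpm1_div (s *\<^sub>R ?X) (h *\<^sub>R ?X))) (at s)"
    by (rule has_derivative_compose[OF a has_derivative_expm1_div])
  then have "((\<lambda>s. expm1_div (s *\<^sub>R ?X)) has_vector_derivative dexpm1_div (s *\<^sub>R ?X) ?X) (at s)"
    unfolding has_vector_derivative_def lin .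
  then have "((\<lambda>s. s *\<^sub>R expm1_div (s *\<^sub>R ?X)) has_vector_derivative (s *\<^sub>R dexpm1_div (s *\<^sub>R ?X) ?X + 1 *\<^sub>R expm1_div (s *\<^sub>R ?X))) (at s)"
    by (intro has_vector_derivative_scaleR) (auto intro!: derivative_eq_intros)
  also have "s *\<^sub>R dexpm1_div (s *\<^sub>R ?X) ?X + 1 *\<^sub>R expm1_div (s *\<^sub>R ?X) = id_blinfun + (s *\<^sub>R ?X o\<^sub>L expm1_div (s *\<^sub>R ?X))"
    using expm1_div_add_dexpm1_div_self[of "s *\<^sub>R ?X"] by (simp add: lin add.commute)
  finally have "((\<lambda>s. blinfun_apply (s *\<^sub>R expm1_div (s *\<^sub>R ?X)) p) has_vector_derivative
      blinfun_apply (id_blinfun + (s *\<^sub>R ?X o\<^sub>L expm1_div (s *\<^sub>R ?X))) p) (at s)"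
    by (rule bounded_linear.has_vector_derivative[OF blinfun.bounded_linear_left])
  then show ?thesis
    unfolding geo_def[abs_def] dgeo_def
    by (simp add: blinfun.scaleR_left blinfun.add_left SL_apply matrix_vector_mult_scaleR mult.commute)
qed

lemma has_vector_derivative_dgeo: "(dgeo \<tau> p has_vector_derivative 2 *\<^sub>R (S \<tau> *v dgeo \<tau> p s)) (at s)"
  unfolding dgeo_def[abs_def]
  by (rule derivative_eq_intros has_vector_derivative_matrix_vector has_vector_derivative_geo refl | simp add: dgeo_def)+

lemma continuous_geo: "continuous_on A (geo \<tau> p)" "continuous_on A (dgeo \<tau> p)"
  using has_vector_derivative_geo has_vector_derivative_dgeo
  by (auto intro!: continuous_at_imp_continuous_on has_vector_derivative_continuous)

lemma norm_dgeo: "norm (dgeo \<tau> p s) = norm p"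
  using skew_flow_norm_const[OF skew has_vector_derivative_dgeo, of \<tau> p s 0] by (simp add: dgeo_def geo_0)

lemma ode_unique:
  assumes "\<And>s. (y has_vector_derivative p + 2 *\<^sub>R (S \<tau> *v y s)) (at s)" "y 0 = 0"
  shows "geo \<tau> p s = y s"
proof -
  have "((\<lambda>s. geo \<tau> p s - y s) has_vector_derivative 2 *\<^sub>R (S \<tau> *v (geo \<tau> p s - y s))) (at s)" for s
    using has_vector_derivative_diff[OF has_vector_derivative_geo assms(1), of \<tau> p s]
    by (simp add: dgeo_def matrix_vector_mult_diff_distrib scaleR_right_diff_distrib)
  from skew_flow_norm_const[OF skew this, of s 0] show ?thesis by (simp add: geo_0 assms(2))
qed

end

text \<open>The identity \<open>P s - P t = - P s (E s - E t) P t\<close> yields first local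
  boundedness, then continuity and finally the derivative of \<open>P\<close>, with no regularity of
  \<open>P\<close> assumed.\<close>

lemma has_derivative_blinfun_inverse:
  fixes E P :: "'b::real_normed_vector \<Rightarrow> ('a::banach \<Rightarrow>\<^sub>L 'a)"
  assumes E: "(E has_derivative E') (at t)" and T: "open T" "t \<in> T"
    and PE: "\<And>s. s \<in> T \<Longrightarrow> (P s o\<^sub>L E s) = id_blinfun" and EP: "\<And>s. s \<in> T \<Longrightarrow> (E s o\<^sub>L P s) = id_blinfun"
  shows "(P has_derivative (\<lambda>h. - (P t o\<^sub>L (E' h o\<^sub>L P t)))) (at t)"
proof -
  note comp_bl = bounded_bilinear_blinfun_compose
  have id: "P s - P t = - (P s o\<^sub>L ((E s - E t) o\<^sub>L P t))" if "s \<in> T" for s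
  proof -
    have "blinfun_apply (P s - P t) x = blinfun_apply (- (P s o\<^sub>L ((E s - E t) o\<^sub>L P t))) x" for x
    proof -
      have 1: "P s (E s y) = y" for y using arg_cong[OF PE[OF that], of "\<lambda>f. blinfun_apply f y"] by simp
      have 2: "E t (P t y) = y" for y using arg_cong[OF EP[OF T(2)], of "\<lambda>f. blinfun_apply f y"] by simp
      show ?thesis by (simp add: blinfun.diff_left blinfun.minus_left blinfun.diff_right 1 2)
    qed
    then show ?thesis by (rule blinfun_eqI)
  qed
  have nearT: "\<forall>\<^sub>F s in at t. s \<in> T" using T by (simp add: eventually_at_topological) blast
  have Econt: "(E \<longlongrightarrow> E t) (at t)" using has_derivative_continuous[OF E] by (simp add: continuous_at)
  then have E0: "((\<lambda>s. norm (E s - E t)) \<longlongrightarrow> 0) (at t)" by (simp add: LIM_zero tendsto_norm_zero)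
  have "((\<lambda>s. norm (E s - E t) * norm (P t)) \<longlongrightarrow> 0) (at t)" using E0 by (rule tendsto_mult_left_zero)
  then have small: "\<forall>\<^sub>F s in at t. norm (E s - E t) * norm (P t) < 1/2" by (rule order_tendstoD) simp
  have diffP: "norm (P s - P t) \<le> norm (P s) * (norm (E s - E t) * norm (P t))" if "s \<in> T" for s
    unfolding id[OF that] norm_minus_cancel
    by (rule norm_compose_le[OF order_refl norm_compose_le[OF order_refl order_refl]])
  \<comment> \<open>Once \<open>|E s - E t| * |P t|\<close> is below one half,
    \<open>|P s| \<le> |P t| + |P s| / 2\<close>, and the last term is absorbed.\<close>
  have bd: "\<forall>\<^sub>F s in at t. norm (P s) \<le> 2 * norm (P t)"
    using nearT small
  proof eventually_elim
    case (elim s)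
    have "norm (P s) \<le> norm (P t) + norm (P s - P t)" by (metis add.commute diff_add_cancel norm_triangle_ineq)
    also have "norm (P s - P t) \<le> norm (P s) * (1/2)"
      using diffP[OF elim(1)] elim(2) by (meson less_imp_le mult_left_mono norm_ge_zero order_trans)
    finally show ?case by simp
  qed
  have "((\<lambda>s. P s - P t) \<longlongrightarrow> 0) (at t)"
  proof (rule Lim_null_comparison)
    show "((\<lambda>s. 2 * norm (P t) * (norm (E s - E t) * norm (P t))) \<longlongrightarrow> 0) (at t)"
      using tendsto_mult_right_zero[OF tendsto_mult_left_zero[OF E0]] by blast
    show "\<forall>\<^sub>F s in at t. norm (P s - P t) \<le> 2 * norm (P t) * (norm (E s - E t) * norm (P t))"
      using nearT bd
    proof eventually_elim
      case (elim s)
      have "norm (P s) * (norm (E s - E t) * norm (P t)) \<le> 2 * norm (P t) * (norm (E s - E t) * norm (P t))"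
        using elim(2) by (intro mult_right_mono) auto
      then show ?case using diffP[OF elim(1)] by linarith
    qed
  qed
  then have Pcont: "(P \<longlongrightarrow> P t) (at t)" by (rule LIM_zero_cancel)
  have blE: "bounded_linear E'" using E by (rule has_derivative_bounded_linear)
  have bl: "bounded_linear (\<lambda>h. - (P t o\<^sub>L (E' h o\<^sub>L P t)))"
    by (intro bounded_linear_minus bounded_linear_compose[OF bounded_bilinear.bounded_linear_right[OF comp_bl]]
        bounded_linear_compose[OF bounded_bilinear.bounded_linear_left[OF comp_bl] blE])
  \<comment> \<open>The error quotient equals \<open>- P s R P t - (P s - P t) V P t\<close>:
    \<open>R\<close> tends to zero by differentiability of \<open>E\<close>, and \<open>V\<close> is
    bounded while its factor \<open>P s - P t\<close> tends to zero.\<close>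
  define R where "R s = (E s - E t - E' (s - t)) /\<^sub>R norm (s - t)" for s
  have R0: "(R \<longlongrightarrow> 0) (at t)" using E unfolding has_derivative_at_within R_def by blast
  define V where "V s = (E' (s - t)) /\<^sub>R norm (s - t)" for s
  obtain B where B: "B \<ge> 0" "\<And>h. norm (E' h) \<le> norm h * B" using bounded_linear.nonneg_bounded[OF blE] by blast
  have V: "norm (V s) \<le> B" if "s \<noteq> t" for s
    using B(2)[of "s - t"] that by (simp add: V_def field_simps)
  have t1: "((\<lambda>s. P s o\<^sub>L (R s o\<^sub>L P t)) \<longlongrightarrow> 0) (at t)"
    using bounded_bilinear.tendsto[OF comp_bl Pcont bounded_bilinear.tendsto[OF comp_bl R0 tendsto_const[of "P t"]]]
    by (simp add: bounded_bilinear.zero_left[OF comp_bl] bounded_bilinear.zero_right[OF comp_bl])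
  have t2: "((\<lambda>s. (P s - P t) o\<^sub>L (V s o\<^sub>L P t)) \<longlongrightarrow> 0) (at t)"
  proof (rule Lim_null_comparison)
    show "((\<lambda>s. norm (P s - P t) * (B * norm (P t))) \<longlongrightarrow> 0) (at t)"
      using Pcont by (intro tendsto_mult_left_zero tendsto_norm_zero LIM_zero)
    show "\<forall>\<^sub>F s in at t. norm ((P s - P t) o\<^sub>L (V s o\<^sub>L P t)) \<le> norm (P s - P t) * (B * norm (P t))"
      unfolding eventually_at_filter
      by (rule always_eventually) (use V in \<open>auto intro!: norm_compose_le\<close>)
  qed
  have "((\<lambda>s. - (P s o\<^sub>L (R s o\<^sub>L P t)) - ((P s - P t) o\<^sub>L (V s o\<^sub>L P t))) \<longlongrightarrow> - 0 - 0) (at t)"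
    by (intro tendsto_diff tendsto_minus t1 t2)
  moreover have "\<forall>\<^sub>F s in at t. - (P s o\<^sub>L (R s o\<^sub>L P t)) - ((P s - P t) o\<^sub>L (V s o\<^sub>L P t)) =
     (P s - P t - (- (P t o\<^sub>L (E' (s - t) o\<^sub>L P t)))) /\<^sub>R norm (s - t)"
    using nearT
  proof eventually_elim
    case (elim s)
    have eq: "P s - P t - (- (P t o\<^sub>L (E' (s - t) o\<^sub>L P t))) = - (P s o\<^sub>L ((E s - E t) o\<^sub>L P t)) + (P t o\<^sub>L (E' (s - t) o\<^sub>L P t))"
      by (subst id[OF elim]) simp
    show ?case
      unfolding eq R_def V_def
      by (intro blinfun_eqI) (simp add: blinfun.diff_left blinfun.minus_left blinfun.scaleR_left blinfun.diff_right
          blinfun.scaleR_right blinfun.add_left blinfun.add_right blinfun.minus_right algebra_simps)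
  qed
  ultimately have "((\<lambda>s. (P s - P t - (- (P t o\<^sub>L (E' (s - t) o\<^sub>L P t)))) /\<^sub>R norm (s - t)) \<longlongrightarrow> 0) (at t)"
    using tendsto_cong by fastforce
  then show ?thesis using bl unfolding has_derivative_at_within by blast
qed

context metivier_group
begin

section \<open>Length, area and energy of a geodesic\<close>

lemma continuous_on_Uform:
  assumes "continuous_on A f" "continuous_on A g"
  shows "continuous_on A (\<lambda>s. Uform U (f s) (g s))"
  unfolding Uform_def
  by (intro continuous_on_vec_lambda continuous_on_inner assms
     bounded_linear.continuous_on[OF matrix_vector_mul_bounded_linear])

lemma length_geo: "norm p \<in> horiz_lengths U (geo \<tau> p 1, tgeo \<tau> p)"
proof -
  have ftc: "(dgeo \<tau> p has_integral (geo \<tau> p s - geo \<tau> p 0)) {0..s}" if "0 \<le> s" for s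
    using that by (rule fundamental_theorem_of_calculus) (auto intro: has_vector_derivative_at_within has_vector_derivative_geo)
  have x: "geo \<tau> p s = integral {0..s} (dgeo \<tau> p)" if "s \<in> {0..1}" for s
    using integral_unique[OF ftc[of s]] that by (simp add: geo_0)
  have c: "continuous_on {0..1} (\<lambda>s. (1/2) *\<^sub>R Uform U (geo \<tau> p s) (dgeo \<tau> p s))"
    by (intro continuous_intros continuous_on_Uform continuous_geo)
  have "norm p = integral {0..1} (\<lambda>s. norm (dgeo \<tau> p s))" by (simp add: norm_dgeo)
  then show ?thesis
    unfolding horiz_lengths_def
    by (intro CollectI exI[of _ "dgeo \<tau> p"] exI[of _ "geo \<tau> p"]
        exI[of _ "\<lambda>s. integral {0..s} (\<lambda>r. (1/2) *\<^sub>R Uform U (geo \<tau> p r) (dgeo \<tau> p r))"] conjI)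
      (use x c in \<open>auto simp: tgeo_def intro!: absolutely_integrable_continuous_real continuous_geo\<close>)
qed

lemma integral_S_geo:
  "2 * integral {0..1} (\<lambda>s. (S \<sigma> *v geo \<tau> p s) \<bullet> dgeo \<tau> p s) = 4 * (\<sigma> \<bullet> tgeo \<tau> p)"
proof -
  have "(\<lambda>s. (1/2) *\<^sub>R Uform U (geo \<tau> p s) (dgeo \<tau> p s)) integrable_on {0..1}"
    by (intro integrable_continuous_real continuous_intros continuous_on_Uform continuous_geo)
  from integral_linear[OF this bounded_linear_inner_right[of \<sigma>]]
  have "\<sigma> \<bullet> tgeo \<tau> p = integral {0..1} (\<lambda>s. (1/2) * ((S \<sigma> *v geo \<tau> p s) \<bullet> dgeo \<tau> p s))"
    by (simp add: o_def tgeo_def inner_Uform)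
  also have "\<dots> = (1/2) * integral {0..1} (\<lambda>s. (S \<sigma> *v geo \<tau> p s) \<bullet> dgeo \<tau> p s)"
    by (rule integral_mult_right)
  finally show ?thesis by simp
qed

text \<open>Pairing \<open>y' = p + 2 S y\<close> with \<open>y'\<close> gives
  \<open>|p|^2 = p \<bullet> y' + 2 (S y \<bullet> y')\<close>, as the speed is constant; this is
  integrated. For \<open>p = Pv \<tau> x\<close> the result says that \<open>phi\<close> at
  \<open>\<tau>\<close> is the squared length.\<close>

lemma energy_geo: "p \<bullet> geo \<tau> p 1 = (norm p)\<^sup>2 - 4 * (\<tau> \<bullet> tgeo \<tau> p)"
proof -
  have "(dgeo \<tau> p has_integral (geo \<tau> p 1 - geo \<tau> p 0)) {0..1}"
    by (rule fundamental_theorem_of_calculus) (auto intro: has_vector_derivative_at_within has_vector_derivative_geo)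
  from has_integral_linear[OF this bounded_linear_inner_right[of p]]
  have i: "((\<lambda>s. p \<bullet> dgeo \<tau> p s) has_integral (p \<bullet> geo \<tau> p 1)) {0..1}" by (simp add: o_def geo_0)
  have eq: "p \<bullet> dgeo \<tau> p s = (norm p)\<^sup>2 - 2 * ((S \<tau> *v geo \<tau> p s) \<bullet> dgeo \<tau> p s)" for s
  proof -
    have "(norm p)\<^sup>2 = dgeo \<tau> p s \<bullet> dgeo \<tau> p s" by (metis norm_dgeo power2_norm_eq_inner)
    also have "\<dots> = (p + 2 *\<^sub>R (S \<tau> *v geo \<tau> p s)) \<bullet> dgeo \<tau> p s" by (subst (1) dgeo_def) simp
    finally show ?thesis by (simp add: inner_add_left)
  qed
  have c: "continuous_on {0..1} (\<lambda>s. (S \<tau> *v geo \<tau> p s) \<bullet> dgeo \<tau> p s)"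
    by (intro continuous_on_inner bounded_linear.continuous_on[OF matrix_vector_mul_bounded_linear] continuous_geo)
  have "p \<bullet> geo \<tau> p 1 = integral {0..1} (\<lambda>s. (norm p)\<^sup>2 - 2 * ((S \<tau> *v geo \<tau> p s) \<bullet> dgeo \<tau> p s))"
    using integral_unique[OF i] unfolding eq by simp
  also have "\<dots> = (norm p)\<^sup>2 - 2 * integral {0..1} (\<lambda>s. (S \<tau> *v geo \<tau> p s) \<bullet> dgeo \<tau> p s)"
    by (subst integral_diff) (auto intro!: integrable_continuous_real continuous_intros c)
  finally show ?thesis unfolding integral_S_geo .
qed

section \<open>Inverting the endpoint map\<close>

definition Pv :: "real^'m \<Rightarrow> real^'q \<Rightarrow> real^'q" where
  "Pv \<tau> x = UcotU U \<tau> *v x - S \<tau> *v x"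

lemma Pv_inner: "Pv \<tau> x \<bullet> x = (UcotU U \<tau> *v x) \<bullet> x"
  by (simp add: Pv_def inner_diff_left S_skew(2))

text \<open>On the span of \<open>u\<close> and \<open>S u\<close> the matrix \<open>S\<close> acts
  like \<open>w\<close> times a quarter turn, and the solution is a circular arc run with angular
  speed \<open>2 * w\<close>.\<close>

lemma geo_eigenvector:
  assumes w: "w > 0" and SS: "S \<tau> *v (S \<tau> *v u) = - ((w * w) *\<^sub>R u)"
  shows "geo \<tau> u 1 = (sin w * cos w / w) *\<^sub>R u + ((sin w)\<^sup>2 / (w * w)) *\<^sub>R (S \<tau> *v u)"
proof -
  define y where "y s = (sin (2 * (w * s)) / (2 * w)) *\<^sub>R u + ((sin (w * s))\<^sup>2 / (w * w)) *\<^sub>R (S \<tau> *v u)" for s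
  have "geo \<tau> u 1 = y 1"
  proof (rule ode_unique)
    fix s
    have a: "((\<lambda>s. sin (2 * (w * s)) / (2 * w)) has_real_derivative cos (2 * (w * s))) (at s)"
      using w by (auto intro!: derivative_eq_intros)
    have b: "((\<lambda>s. (sin (w * s))\<^sup>2 / (w * w)) has_real_derivative 2 * sin (w * s) * cos (w * s) / w) (at s)"
      using w by (auto intro!: derivative_eq_intros simp: field_simps)
    have "(y has_vector_derivative (cos (2 * (w * s)) *\<^sub>R u + (sin (2 * (w * s)) / w) *\<^sub>R (S \<tau> *v u))) (at s)"
      unfolding y_def[abs_def]
      using has_vector_derivative_add[OF has_vector_derivative_scaleR[OF a has_vector_derivative_const[of u]]
        has_vector_derivative_scaleR[OF b[folded sin_double] has_vector_derivative_const[of "S \<tau> *v u"]]] by simp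
    also have "cos (2 * (w * s)) *\<^sub>R u + (sin (2 * (w * s)) / w) *\<^sub>R (S \<tau> *v u) = u + 2 *\<^sub>R (S \<tau> *v y s)"
    proof -
      have "2 *\<^sub>R (S \<tau> *v y s) = (sin (2 * (w * s)) / w) *\<^sub>R (S \<tau> *v u) - (2 * (sin (w * s))\<^sup>2) *\<^sub>R u"
        using w by (simp add: y_def matrix_vector_right_distrib matrix_vector_mult_scaleR SS scaleR_right_diff_distrib)
      moreover have "cos (2 * (w * s)) = 1 - 2 * (sin (w * s))\<^sup>2" using cos_double_sin[of "w * s"] by simp
      ultimately show ?thesis by (simp add: scaleR_left_diff_distrib)
    qed
    finally show "(y has_vector_derivative u + 2 *\<^sub>R (S \<tau> *v y s)) (at s)" .
  qed (simp add: y_def)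
  then show ?thesis by (simp add: y_def sin_double)
qed

text \<open>For each eigenvector two coefficients are compared, \<open>e1\<close> for
  \<open>u\<close> and \<open>e2\<close> for \<open>S u\<close>. Dividing by \<open>sin w\<close> is
  where the bound by \<open>pi\<close> is needed; for \<open>l = 0\<close> the geodesic is a
  straight line.\<close>

lemma geo_Pv_matrix:
  assumes \<tau>: "\<tau> \<in> Omega U"
  shows "matrix (\<lambda>p. geo \<tau> p 1) ** (UcotU U \<tau> - S \<tau>) = mat 1"
proof (rule matrix_eq_on_eigenvectors[OF transpose_mult_self_symmetric[of "S \<tau>"]])
  fix u l assume u: "(transpose (S \<tau>) ** S \<tau>) *v u = l *\<^sub>R u" "norm u = 1"
  have lin: "linear (\<lambda>p. geo \<tau> p 1)" by (rule linearI) (simp_all add: geo_linear)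
  have mw: "matrix (\<lambda>p. geo \<tau> p 1) *v p = geo \<tau> p 1" for p using lin by (simp add: matrix_works)
  have Uu: "UcotU U \<tau> *v u = zcotz_sq l *\<^sub>R u"
    unfolding UcotU_def by (rule matfun_eigenvector[OF transpose_mult_self_symmetric u(1)])
  have bl: "0 \<le> l" "sqrt l < pi"
    using eigenvalue_transpose_mult_self_bounds[OF u order_refl] \<tau> by (auto simp: Omega_def)
  note SS = skew_sq_eigenvector(1)[OF skew u(1)]
  have "geo \<tau> (zcotz_sq l *\<^sub>R u - S \<tau> *v u) 1 = u"
  proof (cases "l = 0")
    case True
    then have "S \<tau> *v u = 0" using eigenvalue_transpose_mult_self[OF u] by simp
    moreover have "geo \<tau> u 1 = 1 *\<^sub>R u"
    proof (rule ode_unique[where y = "\<lambda>s. s *\<^sub>R u"])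
      show "((\<lambda>s. s *\<^sub>R u) has_vector_derivative u + 2 *\<^sub>R (S \<tau> *v (s *\<^sub>R u))) (at s)" for s
        using \<open>S \<tau> *v u = 0\<close> by (auto intro!: derivative_eq_intros simp: matrix_vector_mult_scaleR)
    qed simp
    ultimately show ?thesis by (simp add: True zcotz_sq_def)
  next
    case False
    define w where "w = sqrt l"
    have w: "w > 0" "w < pi" "w * w = l" using False bl by (auto simp: w_def)
    have sw: "sin w > 0" using w by (intro sin_gt_zero) auto
    have z: "zcotz_sq l = w * (cos w / sin w)" using False by (simp add: zcotz_sq_def w_def cot_def)
    have SSw: "S \<tau> *v (S \<tau> *v u) = - ((w * w) *\<^sub>R u)" using SS w(3) by simp
    have "S \<tau> *v (S \<tau> *v (S \<tau> *v u)) = - ((w * w) *\<^sub>R (S \<tau> *v u))"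
      unfolding SSw using matrix_vector_mult_scaleR[of "S \<tau>" "- (w * w)" u] by simp
    note g2 = geo_eigenvector[OF w(1) this] and g1 = geo_eigenvector[OF w(1) SSw]
    let ?k = "w * (cos w / sin w)" let ?a = "sin w * cos w / w" let ?b = "(sin w)\<^sup>2 / (w * w)"
    have e1: "?k * ?a + ?b * (w * w) = 1"
      using sw w(1) sin_cos_squared_add[of w] by (simp add: power2_eq_square)
    have e2: "?k * ?b = ?a" using sw w(1) by (simp add: power2_eq_square)
    have "geo \<tau> (?k *\<^sub>R u - S \<tau> *v u) 1 = ?k *\<^sub>R geo \<tau> u 1 - geo \<tau> (S \<tau> *v u) 1"
      using linear_diff[OF lin] linear_scale[OF lin] by simp
    also have "\<dots> = (?k * ?a + ?b * (w * w)) *\<^sub>R u + (?k * ?b - ?a) *\<^sub>R (S \<tau> *v u)"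
      unfolding g1 g2 SSw by (simp only: scaleR_right_distrib scaleR_left_distrib scaleR_left_diff_distrib scaleR_scaleR scaleR_minus_right) simp
    also have "\<dots> = u" unfolding e1 e2 by simp
    finally show ?thesis unfolding z .
  qed
  then show "(matrix (\<lambda>p. geo \<tau> p 1) ** (UcotU U \<tau> - S \<tau>)) *v u = mat 1 *v u"
    by (simp add: matrix_vector_mul_assoc[symmetric] matrix_vector_mult_diff_rdistrib Uu mw)
qed

lemma geo_Pv: "\<tau> \<in> Omega U \<Longrightarrow> geo \<tau> (Pv \<tau> x) 1 = x" and Pv_geo: "\<tau> \<in> Omega U \<Longrightarrow> Pv \<tau> (geo \<tau> p 1) = p"
proof -
  assume t: "\<tau> \<in> Omega U"
  have lin: "linear (\<lambda>p. geo \<tau> p 1)" by (rule linearI) (simp_all add: geo_linear)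
  have P: "Pv \<tau> x = (UcotU U \<tau> - S \<tau>) *v x" for x by (simp add: Pv_def matrix_vector_mult_diff_rdistrib)
  define G where "G = matrix (\<lambda>p. geo \<tau> p 1)"
  have G: "geo \<tau> p 1 = G *v p" for p unfolding G_def using lin by (simp add: matrix_works)
  note M = geo_Pv_matrix[OF t, folded G_def]
  show "geo \<tau> (Pv \<tau> x) 1 = x" unfolding G P matrix_vector_mul_assoc M by simp
  have "(UcotU U \<tau> - S \<tau>) ** G = mat 1" using M matrix_left_right_inverse by blast
  then show "Pv \<tau> (geo \<tau> p 1) = p" unfolding G P matrix_vector_mul_assoc by simp
qed

section \<open>Lower bounds for the distance\<close>

lemma phi_le_length:
  assumes L: "L \<in> horiz_lengths U g" and \<tau>: "\<tau> \<in> Omega U"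
  shows "phi U g \<tau> \<le> L\<^sup>2"
proof -
  obtain x' x :: "real \<Rightarrow> real^'q" and t :: "real \<Rightarrow> real^'m"
    where L_eq: "L = integral {0..1} (\<lambda>s. norm (x' s))" and ai: "x' absolutely_integrable_on {0..1}"
    and x0: "\<forall>s\<in>{0..1}. x s = integral {0..s} x'"
    and Ui: "(\<lambda>s. (1/2) *\<^sub>R Uform U (x s) (x' s)) absolutely_integrable_on {0..1}"
    and t0: "\<forall>s\<in>{0..1}. t s = integral {0..s} (\<lambda>r. (1/2) *\<^sub>R Uform U (x r) (x' r))"
    and g: "(x 1, t 1) = g"
    using L[unfolded horiz_lengths_def, THEN CollectD] by (elim exE conjE) (rule that, assumption+)
  note x = bspec[OF x0] and t = bspec[OF t0]
  have Ui': "(\<lambda>s. (1/2) *\<^sub>R Uform U (x s) (x' s)) integrable_on {0..1}"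
    using Ui absolutely_integrable_on_def by blast
  have "((\<lambda>v. \<tau> \<bullet> v) \<circ> (\<lambda>s. (1/2) *\<^sub>R Uform U (x s) (x' s))) integrable_on {0..1}"
    by (rule integrable_linear[OF Ui' bounded_linear_inner_right])
  then have hi: "(\<lambda>s. (1/2) * ((S \<tau> *v x s) \<bullet> x' s)) integrable_on {0..1}" by (simp add: o_def inner_Uform)
  have ii: "(\<lambda>s. (S \<tau> *v x s) \<bullet> x' s) integrable_on {0..1}"
    using integrable_on_mult_right[OF hi, of 2] by simp
  have t1: "t 1 = integral {0..1} (\<lambda>r. (1/2) *\<^sub>R Uform U (x r) (x' r))" by (rule t) simp
  have "\<tau> \<bullet> t 1 = integral {0..1} (\<lambda>s. (1/2) * ((S \<tau> *v x s) \<bullet> x' s))"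
    using integral_linear[OF Ui' bounded_linear_inner_right[of \<tau>]]
    by (simp only: t1 o_def inner_Uform inner_scaleR_right)
  also have "\<dots> = (1/2) * integral {0..1} (\<lambda>s. (S \<tau> *v x s) \<bullet> x' s)" by (rule integral_mult_right)
  finally have tt: "4 * (t 1 \<bullet> \<tau>) = 2 * integral {0..1} (\<lambda>s. (S \<tau> *v x s) \<bullet> x' s)" by (simp add: inner_commute)
  have on: "onorm ((*v) (S \<tau>)) < pi" using \<tau> by (simp add: Omega_def)
  show ?thesis
    using zcotz_quad_le_length[OF skew on ai x ii] tt g[symmetric]
    by (simp add: phi_def UcotU_def L_eq)
qed

lemma phi_geo:
  assumes "\<tau> \<in> Omega U"
  shows "phi U (x, tgeo \<tau> (Pv \<tau> x)) \<tau> = (norm (Pv \<tau> x))\<^sup>2"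
  using energy_geo[of "Pv \<tau> x" \<tau>] unfolding geo_Pv[OF assms] Pv_inner
  by (simp add: phi_def inner_commute)

text \<open>The squared length of the geodesic of \<open>\<tau>\<close> equals \<open>phi\<close> at
  \<open>\<tau>\<close> and bounds \<open>phi\<close> at every \<open>\<sigma>\<close>. Gradients
  and concavity are derived from this maximality.\<close>

lemma phi_geo_max:
  assumes "\<tau> \<in> Omega U" "\<sigma> \<in> Omega U"
  shows "phi U (x, tgeo \<tau> (Pv \<tau> x)) \<sigma> \<le> phi U (x, tgeo \<tau> (Pv \<tau> x)) \<tau>"
  using phi_le_length[OF length_geo[of "Pv \<tau> x" \<tau>] assms(2)] unfolding geo_Pv[OF assms(1)] phi_geo[OF assms(1)] .

lemma horiz_lengths_nonneg: "L \<in> horiz_lengths U g \<Longrightarrow> 0 \<le> L"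
  unfolding horiz_lengths_def absolutely_integrable_on_def by (auto intro!: integral_nonneg)

lemma cc_dist_le: "L \<in> horiz_lengths U g \<Longrightarrow> cc_dist U g \<le> L"
  unfolding cc_dist_def by (rule cInf_lower) (auto intro!: bdd_belowI horiz_lengths_nonneg)

lemma phi_le_cc_dist:
  assumes "horiz_lengths U g \<noteq> {}" "\<tau> \<in> Omega U"
  shows "phi U g \<tau> \<le> (cc_dist U g)\<^sup>2"
proof -
  \<comment> \<open>\<open>phi\<close> can be negative, where comparing squares says nothing;
    truncation at zero gives a root that can be compared with the infimum.\<close>
  have "sqrt (max 0 (phi U g \<tau>)) \<le> L" if "L \<in> horiz_lengths U g" for L
    using phi_le_length[OF that assms(2)] horiz_lengths_nonneg[OF that] by (intro real_le_lsqrt) auto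
  then have "sqrt (max 0 (phi U g \<tau>)) \<le> cc_dist U g"
    unfolding cc_dist_def using assms(1) by (intro cInf_greatest)
  then have "(sqrt (max 0 (phi U g \<tau>)))\<^sup>2 \<le> (cc_dist U g)\<^sup>2" by (intro power_mono) auto
  then show ?thesis by simp
qed

lemma cc_dist_nonneg: "horiz_lengths U g \<noteq> {} \<Longrightarrow> 0 \<le> cc_dist U g"
  unfolding cc_dist_def by (intro cInf_greatest horiz_lengths_nonneg)

end

section \<open>Differentiability and strict concavity\<close>

text \<open>Nonnegativity of the variance of \<open>f\<close> on the unit interval.\<close>

lemma Cauchy_Schwarz_integral_01:
  fixes f :: "real \<Rightarrow> real"
  assumes "continuous_on {0..1} f"
  shows "(integral {0..1} f)\<^sup>2 \<le> integral {0..1} (\<lambda>s. (f s)\<^sup>2)"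
proof -
  let ?m = "integral {0..1} f"
  have "0 \<le> integral {0..1} (\<lambda>s. (f s - ?m)\<^sup>2)"
    by (intro integral_nonneg integrable_continuous_real continuous_intros assms) auto
  also have "(\<lambda>s. (f s - ?m)\<^sup>2) = (\<lambda>s. ((f s)\<^sup>2 - 2 * ?m * f s) + ?m\<^sup>2)"
    by (simp add: fun_eq_iff power2_eq_square algebra_simps)
  also have "integral {0..1} \<dots> = integral {0..1} (\<lambda>s. (f s)\<^sup>2) - 2 * ?m * ?m + ?m\<^sup>2"
    using assms by (subst integral_add integral_diff integral_mult_right,
       (auto intro!: integrable_continuous_real continuous_intros)[2])+ simp
  finally show ?thesis by (simp add: power2_eq_square)
qed

context metivier_group
begin

section \<open>Smoothness through the inverse of the endpoint map\<close>

definition EL :: "real^'m \<Rightarrow> (real^'q) \<Rightarrow>\<^sub>L (real^'q)" where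
  "EL \<tau> = expm1_div (2 *\<^sub>R SL \<tau>)"

definition PL :: "real^'m \<Rightarrow> (real^'q) \<Rightarrow>\<^sub>L (real^'q)" where
  "PL \<tau> = Blinfun (Pv \<tau>)"

lemma EL_apply: "blinfun_apply (EL \<tau>) p = geo \<tau> p 1"
  by (simp add: EL_def geo_def)

lemma PL_apply: "blinfun_apply (PL \<tau>) x = Pv \<tau> x"
proof -
  have "bounded_linear (Pv \<tau>)"
    unfolding Pv_def[abs_def] by (intro bounded_linear_sub matrix_vector_mul_bounded_linear)
  then show ?thesis by (simp add: PL_def bounded_linear_Blinfun_apply)
qed

lemma has_derivative_SL2: "((\<lambda>\<tau>. 2 *\<^sub>R SL \<tau>) has_derivative (\<lambda>h. 2 *\<^sub>R SL h)) (at \<tau>)"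
  by (intro has_derivative_scaleR_right bounded_linear_imp_has_derivative bounded_linear_SL)

lemma has_derivative_EL: "(EL has_derivative (\<lambda>h. dexpm1_div (2 *\<^sub>R SL \<tau>) (2 *\<^sub>R SL h))) (at \<tau>)"
  unfolding EL_def[abs_def] by (rule has_derivative_compose[OF has_derivative_SL2 has_derivative_expm1_div])

lemma has_derivative_PL:
  assumes "\<tau> \<in> Omega U"
  shows "(PL has_derivative (\<lambda>h. - (PL \<tau> o\<^sub>L (dexpm1_div (2 *\<^sub>R SL \<tau>) (2 *\<^sub>R SL h) o\<^sub>L PL \<tau>)))) (at \<tau>)"
  by (rule has_derivative_blinfun_inverse[OF has_derivative_EL open_Omega assms];
      rule blinfun_eqI; simp add: EL_apply PL_apply geo_Pv Pv_geo)

text \<open>The derivative of \<open>PL\<close> is built from \<open>PL\<close> and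
  \<open>dexpm1_div\<close>, both differentiable in \<open>\<tau>\<close>, so it can be
  differentiated again. The skew part of \<open>Pv\<close> drops out when \<open>PL\<close> is
  turned into a quadratic form.\<close>

lemma UcotU_quad_twice_differentiable:
  "\<exists>G :: real^'m \<Rightarrow> real^'m. \<forall>\<sigma>\<in>Omega U. ((\<lambda>\<tau>. (UcotU U \<tau> *v x) \<bullet> x) has_derivative (\<lambda>h. G \<sigma> \<bullet> h)) (at \<sigma>) \<and>
     (\<exists>H. (G has_derivative H) (at \<sigma>))"
proof -
  define C where "C \<tau> h = - (PL \<tau> o\<^sub>L (dexpm1_div (2 *\<^sub>R SL \<tau>) (2 *\<^sub>R SL h) o\<^sub>L PL \<tau>))" for \<tau> h
  define ev where "ev = (\<lambda>C :: (real^'q) \<Rightarrow>\<^sub>L (real^'q). blinfun_apply C x \<bullet> x)"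
  have blev: "bounded_linear ev"
    unfolding ev_def by (intro bounded_linear_compose[OF bounded_linear_inner_left] blinfun.bounded_linear_left)
  define G where "G \<tau> = (\<Sum>i\<in>UNIV. ev (C \<tau> (axis i 1)) *\<^sub>R (axis i 1 :: real^'m))" for \<tau>
  note comp_bl = bounded_bilinear_blinfun_compose
  show ?thesis
  proof (rule exI[of _ G], intro ballI conjI)
    fix \<sigma> assume s: "\<sigma> \<in> Omega U"
    have CD: "(PL has_derivative C \<sigma>) (at \<sigma>)"
      unfolding C_def by (rule has_derivative_PL[OF s])
    have evC: "((\<lambda>\<tau>. ev (PL \<tau>)) has_derivative (\<lambda>h. ev (C \<sigma> h))) (at \<sigma>)"
      by (rule bounded_linear.has_derivative[OF blev CD])
    have lin: "linear (\<lambda>h. ev (C \<sigma> h))" using evC by (rule has_derivative_linear)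
    have "ev (C \<sigma> h) = G \<sigma> \<bullet> h" for h
    proof -
      have "h = (\<Sum>i\<in>UNIV. (h $ i) *\<^sub>R axis i 1)" using basis_expansion[of h] by (simp add: scalar_mult_eq_scaleR)
      then have "ev (C \<sigma> h) = ev (C \<sigma> (\<Sum>i\<in>UNIV. (h $ i) *\<^sub>R axis i 1))" by simp
      also have "\<dots> = (\<Sum>i\<in>UNIV. (h $ i) * ev (C \<sigma> (axis i 1)))"
        by (simp add: linear_sum[OF lin] linear_scale[OF lin])
      also have "\<dots> = G \<sigma> \<bullet> h"
        unfolding G_def by (simp add: inner_sum_left inner_axis' mult.commute)
      finally show ?thesis .
    qed
    moreover have "ev (PL \<tau>) = (UcotU U \<tau> *v x) \<bullet> x" for \<tau> by (simp add: ev_def PL_apply Pv_inner)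
    ultimately show "((\<lambda>\<tau>. (UcotU U \<tau> *v x) \<bullet> x) has_derivative (\<lambda>h. G \<sigma> \<bullet> h)) (at \<sigma>)"
      using evC by simp
    have "\<exists>D. ((\<lambda>\<tau>. ev (C \<tau> (axis i 1)) *\<^sub>R (axis i 1 :: real^'m)) has_derivative D) (at \<sigma>)" for i
    proof -
      let ?K = "2 *\<^sub>R SL (axis i 1)"
      have d1: "((\<lambda>\<tau>. dexpm1_div (2 *\<^sub>R SL \<tau>) ?K) has_derivative (\<lambda>h. d2expm1_div (2 *\<^sub>R SL \<sigma>) ?K (2 *\<^sub>R SL h))) (at \<sigma>)"
        by (rule has_derivative_compose[OF has_derivative_SL2 has_derivative_dexpm1_div])
      note d2 = has_derivative_minus[OF bounded_bilinear.FDERIV[OF comp_bl CD bounded_bilinear.FDERIV[OF comp_bl d1 CD]]]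
      note d3 = has_derivative_scaleR_left[OF bounded_linear.has_derivative[OF blev d2], of "axis i 1 :: real^'m"]
      show ?thesis unfolding C_def by (rule exI, rule d3)
    qed
    then obtain D where "\<And>i. ((\<lambda>\<tau>. ev (C \<tau> (axis i 1)) *\<^sub>R (axis i 1 :: real^'m)) has_derivative D i) (at \<sigma>)" by metis
    then have "(G has_derivative (\<lambda>h. \<Sum>i\<in>UNIV. D i h)) (at \<sigma>)"
      unfolding G_def[abs_def] by (intro has_derivative_sum)
    then show "\<exists>H. (G has_derivative H) (at \<sigma>)" by blast
  qed
qed

text \<open>Passing from length to energy makes the bound quadratic in the curve, so that perturbed
  curves can be expanded exactly.\<close>

lemma UcotU_quad_le_energy:
  assumes z: "\<And>s. (z has_vector_derivative z' s) (at s)" and c: "continuous_on {0..1} z'" and z0: "z 0 = 0"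
    and \<sigma>: "\<sigma> \<in> Omega U"
  shows "(UcotU U \<sigma> *v z 1) \<bullet> z 1 \<le> integral {0..1} (\<lambda>s. z' s \<bullet> z' s - 2 * ((S \<sigma> *v z s) \<bullet> z' s))"
proof -
  have ftc: "(z' has_integral (z s - z 0)) {0..s}" if "0 \<le> s" for s
    using that by (rule fundamental_theorem_of_calculus) (auto intro: has_vector_derivative_at_within z)
  have x: "z s = integral {0..s} z'" if "s \<in> {0..1}" for s
    using integral_unique[OF ftc[of s]] that by (simp add: z0)
  have cz: "continuous_on {0..1} z"
    using z by (auto intro!: continuous_at_imp_continuous_on has_vector_derivative_continuous)
  have ci: "continuous_on {0..1} (\<lambda>s. (S \<sigma> *v z s) \<bullet> z' s)"
    by (intro continuous_on_inner bounded_linear.continuous_on[OF matrix_vector_mul_bounded_linear] cz c)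
  have on: "onorm ((*v) (S \<sigma>)) < pi" using \<sigma> by (simp add: Omega_def)
  have "(UcotU U \<sigma> *v z 1) \<bullet> z 1 \<le> (integral {0..1} (\<lambda>s. norm (z' s)))\<^sup>2 - 2 * integral {0..1} (\<lambda>s. (S \<sigma> *v z s) \<bullet> z' s)"
    unfolding UcotU_def
    by (rule zcotz_quad_le_length[OF skew on absolutely_integrable_continuous_real[OF c] x integrable_continuous_real[OF ci]])
  also have "(integral {0..1} (\<lambda>s. norm (z' s)))\<^sup>2 \<le> integral {0..1} (\<lambda>s. (norm (z' s))\<^sup>2)"
    by (intro Cauchy_Schwarz_integral_01 continuous_intros c)
  also have "integral {0..1} (\<lambda>s. (norm (z' s))\<^sup>2) - 2 * integral {0..1} (\<lambda>s. (S \<sigma> *v z s) \<bullet> z' s) =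
     integral {0..1} (\<lambda>s. z' s \<bullet> z' s - 2 * ((S \<sigma> *v z s) \<bullet> z' s))"
    by (subst integral_diff) (auto intro!: integrable_continuous_real continuous_intros c ci simp: power2_norm_eq_inner)
  finally show ?thesis by simp
qed

text \<open>The geodesic \<open>y\<close> for \<open>\<tau>\<close> minimizes the energy whose minimum is the quadratic form at \<open>\<tau>\<close>; testing
  the forms at \<open>\<tau> \<plusminus> e h\<close> with \<open>y \<plusminus> e w\<close>, where \<open>w\<close> points against \<open>S h y'\<close>, gives strictness.\<close>
lemma UcotU_quad_strictly_concave:
  assumes \<tau>: "\<tau> \<in> Omega U" and x: "x \<noteq> 0" and h: "h \<noteq> 0"
  shows "\<exists>c>0. \<forall>e. \<tau> + e *\<^sub>R h \<in> Omega U \<longrightarrow> \<tau> - e *\<^sub>R h \<in> Omega U \<longrightarrow>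
     (UcotU U (\<tau> + e *\<^sub>R h) *v x) \<bullet> x + (UcotU U (\<tau> - e *\<^sub>R h) *v x) \<bullet> x \<le> 2 * ((UcotU U \<tau> *v x) \<bullet> x) - c * e\<^sup>2"
proof -
  define p where "p = Pv \<tau> x"
  have gp: "geo \<tau> p 1 = x" unfolding p_def by (rule geo_Pv[OF \<tau>])
  have p0: "p \<noteq> 0" using gp x geo_linear(2)[of \<tau> 0 p 1] by auto
  let ?y = "geo \<tau> p" and ?y' = "dgeo \<tau> p"
  \<comment> \<open>The factor \<open>s * (1 - s)\<close> fixes both endpoints. The direction turns
    \<open>b\<close> below into the integral of \<open>s * (1 - s) * |S h y'|^2\<close>, positive
    because \<open>y'\<close> never vanishes.\<close>
  define w where "w s = (s * (1 - s)) *\<^sub>R (S h *v ?y' s)" for s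
  define w' where "w' s = (s * (1 - s)) *\<^sub>R (S h *v (2 *\<^sub>R (S \<tau> *v ?y' s))) + (1 - 2 * s) *\<^sub>R (S h *v ?y' s)" for s
  have dw: "(w has_vector_derivative w' s) (at s)" for s
    unfolding w_def[abs_def] w'_def
    by (intro has_vector_derivative_scaleR has_vector_derivative_matrix_vector has_vector_derivative_dgeo)
      (auto intro!: derivative_eq_intros)
  note mc = bounded_linear.continuous_on[OF matrix_vector_mul_bounded_linear]
  have cw: "continuous_on {0..1} w" "continuous_on {0..1} w'"
    unfolding w_def[abs_def] w'_def[abs_def] by (intro continuous_intros mc continuous_geo)+
  have w01: "w 0 = 0" "w 1 = 0" by (simp_all add: w_def)
  define a where "a = integral {0..1} (\<lambda>s. w' s \<bullet> w' s - 2 * ((S \<tau> *v w s) \<bullet> w' s))"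
  define b where "b = integral {0..1} (\<lambda>s. (S h *v ?y' s) \<bullet> w s)"
  have bp: "b > 0"
  proof -
    have eq: "(S h *v ?y' s) \<bullet> w s = s * (1 - s) * (norm (S h *v ?y' s))\<^sup>2" for s
      by (simp add: w_def power2_norm_eq_inner)
    have nn: "0 \<le> (S h *v ?y' s) \<bullet> w s" if "s \<in> {0..1}" for s using that unfolding eq by simp
    have cb: "continuous_on {0..1} (\<lambda>s. (S h *v ?y' s) \<bullet> w s)" by (intro continuous_on_inner mc continuous_geo cw)
    have "?y' (1/2) \<noteq> 0" using norm_dgeo[of \<tau> p "1/2"] p0 by auto
    then have "(S h *v ?y' (1/2)) \<bullet> w (1/2) \<noteq> 0" unfolding eq using S_nonzero[OF h] by simp
    then have "b \<noteq> 0" unfolding b_def using integral_eq_0_iff[OF cb _ nn] by force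
    moreover have "b \<ge> 0" unfolding b_def by (intro integral_nonneg integrable_continuous_real cb nn)
    ultimately show ?thesis by simp
  qed
  \<comment> \<open>Integration by parts with boundary terms that vanish with \<open>w\<close>; it
    removes the part of the cross term containing \<open>w'\<close>.\<close>
  have part: "integral {0..1} (\<lambda>s. (S h *v ?y' s) \<bullet> w s + (S h *v ?y s) \<bullet> w' s) = 0"
  proof -
    have "((\<lambda>s. (S h *v ?y' s) \<bullet> w s + (S h *v ?y s) \<bullet> w' s) has_integral ((S h *v ?y 1) \<bullet> w 1 - (S h *v ?y 0) \<bullet> w 0)) {0..1}"
    proof (rule fundamental_theorem_of_calculus)
      fix s :: real
      have "((\<lambda>s. (S h *v ?y s) \<bullet> w s) has_vector_derivative ((S h *v ?y s) \<bullet> w' s + (S h *v ?y' s) \<bullet> w s)) (at s within {0..1})"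
        by (intro bounded_bilinear.has_vector_derivative[OF bounded_bilinear_inner] has_vector_derivative_matrix_vector
            has_vector_derivative_at_within[OF has_vector_derivative_geo] has_vector_derivative_at_within[OF dw])
      then show "((\<lambda>s. (S h *v ?y s) \<bullet> w s) has_vector_derivative ((S h *v ?y' s) \<bullet> w s + (S h *v ?y s) \<bullet> w' s)) (at s within {0..1})"
        by (simp add: add.commute)
    qed simp
    from integral_unique[OF this] show ?thesis by (simp add: w_def)
  qed
  \<comment> \<open>The gain is linear in \<open>k\<close>, the cost \<open>k^2 * a\<close>
    quadratic; this \<open>k\<close> ensures \<open>k * a \<le> b\<close>, hence
    \<open>k * a - 4 * b < 0\<close>.\<close>
  define k where "k = b / (\<bar>a\<bar> + 1)"
  have k: "k > 0" using bp by (simp add: k_def)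
  define c where "c = - 2 * (k\<^sup>2 * a - 4 * k * b)"
  have cpos: "c > 0"
  proof -
    have "k * a \<le> k * \<bar>a\<bar>" using k by (intro mult_left_mono) auto
    also have "\<dots> \<le> b" using bp by (simp add: k_def field_simps)
    finally have "k * a - 4 * b < 0" using bp by simp
    then have "k * (k * a - 4 * b) < 0" using k by (simp add: mult_pos_neg)
    then show ?thesis by (simp add: c_def power2_eq_square algebra_simps)
  qed
  have E0: "integral {0..1} (\<lambda>s. ?y' s \<bullet> ?y' s - 2 * ((S \<tau> *v ?y s) \<bullet> ?y' s)) = (UcotU U \<tau> *v x) \<bullet> x"
  proof -
    have ci: "continuous_on {0..1} (\<lambda>s. (S \<tau> *v ?y s) \<bullet> ?y' s)" by (intro continuous_on_inner mc continuous_geo)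
    have n: "?y' s \<bullet> ?y' s = (norm p)\<^sup>2" for s by (metis norm_dgeo power2_norm_eq_inner)
    have "integral {0..1} (\<lambda>s. ?y' s \<bullet> ?y' s - 2 * ((S \<tau> *v ?y s) \<bullet> ?y' s)) = (norm p)\<^sup>2 - 4 * (\<tau> \<bullet> tgeo \<tau> p)"
      unfolding n by (subst integral_diff) (auto intro!: integrable_continuous_real continuous_intros ci simp: integral_S_geo)
    also have "\<dots> = p \<bullet> x" using energy_geo[of p \<tau>] gp by simp
    finally show ?thesis by (simp add: p_def Pv_inner)
  qed
  have "(UcotU U (\<tau> + e *\<^sub>R h) *v x) \<bullet> x + (UcotU U (\<tau> - e *\<^sub>R h) *v x) \<bullet> x \<le> 2 * ((UcotU U \<tau> *v x) \<bullet> x) - c * e\<^sup>2"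
    if ep: "\<tau> + e *\<^sub>R h \<in> Omega U" and em: "\<tau> - e *\<^sub>R h \<in> Omega U" for e
  proof -
    define I where "I r s = (?y' s - (r * k) *\<^sub>R w' s) \<bullet> (?y' s - (r * k) *\<^sub>R w' s)
       - 2 * ((S (\<tau> + r *\<^sub>R h) *v (?y s - (r * k) *\<^sub>R w s)) \<bullet> (?y' s - (r * k) *\<^sub>R w' s))" for r s
    have cI: "continuous_on {0..1} (I r)" for r
      unfolding I_def[abs_def] by (intro continuous_intros mc continuous_geo cw)
    have dz: "((\<lambda>s. ?y s - (r * k) *\<^sub>R w s) has_vector_derivative ?y' s - (r * k) *\<^sub>R w' s) (at s)" for r s
      using has_vector_derivative_diff[OF has_vector_derivative_geo
        bounded_linear.has_vector_derivative[OF bounded_linear_scaleR_right dw]] .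
    have le: "(UcotU U (\<tau> + r *\<^sub>R h) *v x) \<bullet> x \<le> integral {0..1} (I r)" if "\<tau> + r *\<^sub>R h \<in> Omega U" for r
    proof -
      have "continuous_on {0..1} (\<lambda>s. ?y' s - (r * k) *\<^sub>R w' s)" by (intro continuous_intros continuous_geo cw)
      from UcotU_quad_le_energy[OF dz this _ that] show ?thesis
        by (simp add: geo_0 gp w01 I_def[abs_def])
    qed
    \<comment> \<open>Adding the tests at \<open>e\<close> and \<open>- e\<close> cancels all terms
      odd in \<open>e\<close>; only orders \<open>0\<close> and \<open>2\<close> remain, so no error
      term is left to estimate.\<close>
    have pt: "I e s + I (- e) s = 2 * (?y' s \<bullet> ?y' s - 2 * ((S \<tau> *v ?y s) \<bullet> ?y' s))
       + 2 * (k * e)\<^sup>2 * (w' s \<bullet> w' s - 2 * ((S \<tau> *v w s) \<bullet> w' s))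
       + 4 * k * e\<^sup>2 * ((S h *v ?y' s) \<bullet> w s + (S h *v ?y s) \<bullet> w' s) - 8 * k * e\<^sup>2 * ((S h *v ?y' s) \<bullet> w s)" for s
    proof -
      have "(S h *v w s) \<bullet> ?y' s = - ((S h *v ?y' s) \<bullet> w s)" by (rule S_skew)
      then show ?thesis
        unfolding I_def
        by (simp add: S_mult matrix_vector_mult_diff_distrib matrix_vector_right_distrib matrix_vector_mult_scaleR
           inner_add_left inner_add_right inner_diff_left inner_diff_right inner_commute[of "w' s" "?y' s"]
           power2_eq_square algebra_simps)
    qed
    have "integral {0..1} (I e) + integral {0..1} (I (- e)) = integral {0..1} (\<lambda>s. I e s + I (- e) s)"
      by (rule integral_add[symmetric]) (intro integrable_continuous_real cI)+
    also have "\<dots> = 2 * ((UcotU U \<tau> *v x) \<bullet> x) + 2 * (k * e)\<^sup>2 * a 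
       + 4 * k * e\<^sup>2 * integral {0..1} (\<lambda>s. (S h *v ?y' s) \<bullet> w s + (S h *v ?y s) \<bullet> w' s) - 8 * k * e\<^sup>2 * b"
      unfolding pt E0[symmetric] a_def b_def
    proof (rule integral_unique, intro has_integral_diff has_integral_add has_integral_mult_right integrable_integral integrable_continuous_real)
    qed (intro continuous_intros mc continuous_geo cw)+
    also have "\<dots> = 2 * ((UcotU U \<tau> *v x) \<bullet> x) - c * e\<^sup>2"
      unfolding part by (simp add: c_def power2_eq_square algebra_simps)
    finally show ?thesis using le[OF ep] le[of "- e"] em by simp
  qed
  with cpos show ?thesis by blast
qed

section \<open>Maximizers and the distance\<close>

text \<open>Stated for all \<open>\<tau>\<close>: the entire series defines geodesics beyond
  \<open>\<Omega>\<^sub>*\<close>, so limits can be taken as \<open>\<tau>\<close> approaches the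
  boundary, where \<open>U cot U\<close> may blow up.\<close>

lemma continuous_endpoint:
  "continuous_on UNIV (\<lambda>z. (geo (fst z) (snd z) 1, tgeo (fst z) (snd z)))"
proof -
  have ce: "continuous_on UNIV (expm1_div :: ((real^'q) \<Rightarrow>\<^sub>L (real^'q)) \<Rightarrow> _)"
    by (intro continuous_at_imp_continuous_on ballI has_derivative_continuous[OF has_derivative_expm1_div])
  have c1: "continuous_on UNIV (\<lambda>(z :: (real^'m) \<times> (real^'q), s). geo (fst z) (snd z) s)"
    unfolding geo_def split_beta
    by (intro continuous_intros bounded_bilinear.continuous_on[OF bounded_bilinear_blinfun_apply]
        continuous_on_compose2[OF ce] bounded_linear.continuous_on[OF bounded_linear_SL]) auto
  have c2: "continuous_on UNIV (\<lambda>(z :: (real^'m) \<times> (real^'q), s). dgeo (fst z) (snd z) s)"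
    unfolding dgeo_def split_beta SL_apply[symmetric]
    by (intro continuous_intros bounded_bilinear.continuous_on[OF bounded_bilinear_blinfun_apply]
        bounded_linear.continuous_on[OF bounded_linear_SL] c1[unfolded split_beta])
  have "continuous_on UNIV (\<lambda>z. integral (cbox 0 1) (\<lambda>s. (1/2) *\<^sub>R Uform U (geo (fst z) (snd z) s) (dgeo (fst z) (snd z) s)))"
    by (rule integral_continuous_on_param)
      (use c1 c2 in \<open>auto simp: split_beta intro!: continuous_intros continuous_on_Uform intro: continuous_on_subset\<close>)
  then have t: "continuous_on UNIV (\<lambda>z. tgeo (fst z) (snd z))" by (simp add: tgeo_def)
  have "continuous_on UNIV (\<lambda>z. (\<lambda>(z, s). geo (fst z) (snd z) s) (z, 1))"
    by (rule continuous_on_compose2[OF c1]) (auto intro!: continuous_intros)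
  then show ?thesis using t by (intro continuous_on_Pair) auto
qed

text \<open>Changing \<open>t\<close> alters \<open>phi\<close> by a linear function of
  \<open>\<tau>\<close>, so maximality for the endpoint with \<open>t = tgeo\<close> becomes a
  tangent inequality for every \<open>t\<close>.\<close>

lemma phi_supergradient:
  assumes "\<tau> \<in> Omega U" "\<sigma> \<in> Omega U"
  shows "phi U (x, t) \<sigma> \<le> phi U (x, t) \<tau> + 4 * ((t - tgeo \<tau> (Pv \<tau> x)) \<bullet> (\<sigma> - \<tau>))"
  using phi_geo_max[OF assms, of x] by (simp add: phi_def inner_diff_left inner_diff_right algebra_simps)

lemma phi_concave:
  assumes "a \<in> Omega U" "b \<in> Omega U" "0 \<le> u" "0 \<le> v" "u + v = 1"
  shows "u * phi U g a + v * phi U g b \<le> phi U g (u *\<^sub>R a + v *\<^sub>R b)"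
proof -
  obtain x t where g: "g = (x, t)" by (cases g)
  let ?m = "u *\<^sub>R a + v *\<^sub>R b"
  have m: "?m \<in> Omega U" using convexD[OF convex_Omega] assms by blast
  let ?d = "4 *\<^sub>R (t - tgeo ?m (Pv ?m x))"
  have "u * phi U g a \<le> u * (phi U g ?m + ?d \<bullet> (a - ?m))" "v * phi U g b \<le> v * (phi U g ?m + ?d \<bullet> (b - ?m))"
    using phi_supergradient[OF m assms(1), of x t] phi_supergradient[OF m assms(2), of x t] assms
    by (auto simp: g intro!: mult_left_mono)
  moreover have "u * (phi U g ?m + ?d \<bullet> (a - ?m)) + v * (phi U g ?m + ?d \<bullet> (b - ?m))
      = (u + v) * phi U g ?m + ?d \<bullet> (u *\<^sub>R a + v *\<^sub>R b - (u + v) *\<^sub>R ?m)"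
    by (simp only: inner_diff_right inner_add_right inner_scaleR_right) (simp add: algebra_simps)
  ultimately show ?thesis using assms(5) by simp
qed

text \<open>No cotangent is differentiated: adding the linear term with \<open>t = tgeo\<close>
  produces a function with a maximum at \<open>\<tau>\<close>, whose derivative must vanish.\<close>

lemma has_derivative_UcotU_quad:
  assumes \<tau>: "\<tau> \<in> Omega U" and d: "((\<lambda>\<tau>. (UcotU U \<tau> *v x) \<bullet> x) has_derivative (\<lambda>h. G \<bullet> h)) (at \<tau>)"
  shows "G = - 4 *\<^sub>R tgeo \<tau> (Pv \<tau> x)"
proof -
  let ?t = "tgeo \<tau> (Pv \<tau> x)"
  have "((\<lambda>\<tau>. (UcotU U \<tau> *v x) \<bullet> x + 4 * (?t \<bullet> \<tau>)) has_derivative (\<lambda>h. G \<bullet> h + 4 * (?t \<bullet> h))) (at \<tau>)"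
    by (intro has_derivative_add d has_derivative_mult_right bounded_linear_imp_has_derivative bounded_linear_inner_right)
  then have "(phi U (x, ?t) has_derivative (\<lambda>h. G \<bullet> h + 4 * (?t \<bullet> h))) (at \<tau>)"
    by (simp add: phi_def[abs_def])
  then have "(\<lambda>h. G \<bullet> h + 4 * (?t \<bullet> h)) = (\<lambda>v. 0)"
    by (rule differential_zero_maxmin[OF \<tau> open_Omega]) (use phi_geo_max[OF \<tau>] in blast)
  then have "(G + 4 *\<^sub>R ?t) \<bullet> h = 0" for h by (auto simp: inner_add_left dest: fun_cong[of _ _ h])
  from this[of "G + 4 *\<^sub>R ?t"] show ?thesis by (simp add: eq_neg_iff_add_eq_0)
qed

lemma UcotU_quad_gradient:
  obtains G :: "real^'m \<Rightarrow> real^'m"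
  where "\<And>\<sigma>. \<sigma> \<in> Omega U \<Longrightarrow> ((\<lambda>\<tau>. (UcotU U \<tau> *v x) \<bullet> x) has_derivative (\<lambda>h. G \<sigma> \<bullet> h)) (at \<sigma>)"
    "\<And>\<sigma>. \<sigma> \<in> Omega U \<Longrightarrow> \<exists>H. (G has_derivative H) (at \<sigma>)"
    "\<And>\<sigma>. \<sigma> \<in> Omega U \<Longrightarrow> G \<sigma> = - 4 *\<^sub>R tgeo \<sigma> (Pv \<sigma> x)"
proof -
  obtain G :: "real^'m \<Rightarrow> real^'m" where
    G: "\<forall>\<sigma>\<in>Omega U. ((\<lambda>\<tau>. (UcotU U \<tau> *v x) \<bullet> x) has_derivative (\<lambda>h. G \<sigma> \<bullet> h)) (at \<sigma>) \<and> (\<exists>H. (G has_derivative H) (at \<sigma>))"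
    using UcotU_quad_twice_differentiable[of x] by blast
  show ?thesis by (rule that[of G]) (use G has_derivative_UcotU_quad in blast)+
qed

lemma isCont_phi: "\<tau> \<in> Omega U \<Longrightarrow> isCont (phi U g) \<tau>"
proof -
  assume t: "\<tau> \<in> Omega U"
  have "phi U g = (\<lambda>\<tau>. blinfun_apply (PL \<tau>) (fst g) \<bullet> fst g + 4 * (snd g \<bullet> \<tau>))"
    by (simp add: phi_def[abs_def] PL_apply Pv_inner)
  moreover have "isCont PL \<tau>" by (rule has_derivative_continuous[OF has_derivative_PL[OF t]])
  ultimately show ?thesis
    by (auto intro!: continuous_intros bounded_bilinear.continuous[OF bounded_bilinear_blinfun_apply])
qed

text \<open>If \<open>H h = 0\<close>, the gradient changes only by \<open>o(e)\<close> between the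
  points \<open>\<theta> \<plusminus> e h\<close>; the tangent inequalities at these points then
  contradict the quadratic drop supplied by strict concavity.\<close>

lemma Hessian_injective:
  assumes \<theta>: "\<theta> \<in> Omega U" and x: "x \<noteq> 0"
    and G: "\<And>\<sigma>. \<sigma> \<in> Omega U \<Longrightarrow> G \<sigma> = - 4 *\<^sub>R tgeo \<sigma> (Pv \<sigma> x)" and H: "(G has_derivative H) (at \<theta>)"
  shows "inj H"
proof -
  have lin: "linear H" using H by (rule has_derivative_linear)
  have "h = 0" if Hh: "H h = 0" for h
  proof (rule ccontr)
    assume h: "h \<noteq> 0"
    let ?Q = "\<lambda>\<tau>. (UcotU U \<tau> *v x) \<bullet> x"
    obtain c where c: "c > 0" and sc: "\<And>e. \<theta> + e *\<^sub>R h \<in> Omega U \<Longrightarrow> \<theta> - e *\<^sub>R h \<in> Omega U \<Longrightarrow>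
       ?Q (\<theta> + e *\<^sub>R h) + ?Q (\<theta> - e *\<^sub>R h) \<le> 2 * ?Q \<theta> - c * e\<^sup>2"
      using UcotU_quad_strictly_concave[OF \<theta> x h] by blast
    \<comment> \<open>The two gradient errors contribute at most
      \<open>2 * eps * |h|^2 * e^2\<close>, which this choice makes half of the drop
      \<open>c * e^2\<close>.\<close>
    define eps where "eps = c / (4 * (norm h)\<^sup>2)"
    have eps: "eps > 0" using c h by (simp add: eps_def)
    obtain d where d: "d > 0" and dG: "\<And>y. norm (y - \<theta>) < d \<Longrightarrow> norm (G y - G \<theta> - H (y - \<theta>)) \<le> eps * norm (y - \<theta>)"
      using H eps unfolding has_derivative_at_alt by metis
    obtain r where r: "r > 0" "ball \<theta> r \<subseteq> Omega U" using open_Omega \<theta> open_contains_ball by blast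
    define e where "e = min d r / (2 * norm h)"
    have e: "e > 0" using d r h by (simp add: e_def)
    have ne: "norm (e *\<^sub>R h) < d" "norm (e *\<^sub>R h) < r" using d r h by (auto simp: e_def)
    have inO: "\<theta> + e *\<^sub>R h \<in> Omega U" "\<theta> - e *\<^sub>R h \<in> Omega U"
      using r(2) ne(2) by (auto simp: subset_iff dist_norm)
    have Gp: "norm (G (\<theta> + e *\<^sub>R h) - G \<theta>) \<le> eps * (e * norm h)"
      using dG[of "\<theta> + e *\<^sub>R h"] ne(1) e by (simp add: linear_scale[OF lin] Hh)
    have Gm: "norm (G (\<theta> - e *\<^sub>R h) - G \<theta>) \<le> eps * (e * norm h)"
      using dG[of "\<theta> - e *\<^sub>R h"] ne(1) e by (simp add: linear_scale[OF lin] linear_neg[OF lin] Hh)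
    have sup: "?Q \<theta> \<le> ?Q \<sigma> + G \<sigma> \<bullet> (\<theta> - \<sigma>)" if "\<sigma> \<in> Omega U" for \<sigma>
      using phi_supergradient[OF that \<theta>, of x 0] G[OF that] by (simp add: phi_def)
    have ip: "G (\<theta> + e *\<^sub>R h) \<bullet> h - G \<theta> \<bullet> h \<ge> - (eps * (e * norm h) * norm h)"
    proof -
      have "\<bar>(G (\<theta> + e *\<^sub>R h) - G \<theta>) \<bullet> h\<bar> \<le> norm (G (\<theta> + e *\<^sub>R h) - G \<theta>) * norm h" by (rule Cauchy_Schwarz_ineq2)
      also have "\<dots> \<le> eps * (e * norm h) * norm h" using Gp by (intro mult_right_mono) auto
      finally show ?thesis by (simp add: inner_diff_left)
    qed
    have im: "G (\<theta> - e *\<^sub>R h) \<bullet> h - G \<theta> \<bullet> h \<le> eps * (e * norm h) * norm h"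
    proof -
      have "\<bar>(G (\<theta> - e *\<^sub>R h) - G \<theta>) \<bullet> h\<bar> \<le> norm (G (\<theta> - e *\<^sub>R h) - G \<theta>) * norm h" by (rule Cauchy_Schwarz_ineq2)
      also have "\<dots> \<le> eps * (e * norm h) * norm h" using Gm by (intro mult_right_mono) auto
      finally show ?thesis by (simp add: inner_diff_left)
    qed
    have "2 * ?Q \<theta> \<le> ?Q (\<theta> + e *\<^sub>R h) + ?Q (\<theta> - e *\<^sub>R h) - e * (G (\<theta> + e *\<^sub>R h) \<bullet> h) + e * (G (\<theta> - e *\<^sub>R h) \<bullet> h)"
      using sup[OF inO(1)] sup[OF inO(2)] by simp
    then have "c * e\<^sup>2 \<le> e * (G (\<theta> - e *\<^sub>R h) \<bullet> h) - e * (G (\<theta> + e *\<^sub>R h) \<bullet> h)" using sc[OF inO] by simp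
    also have "\<dots> = e * ((G (\<theta> - e *\<^sub>R h) \<bullet> h - G \<theta> \<bullet> h) - (G (\<theta> + e *\<^sub>R h) \<bullet> h - G \<theta> \<bullet> h))"
      by (simp add: algebra_simps)
    also have "\<dots> \<le> e * (eps * (e * norm h) * norm h + eps * (e * norm h) * norm h)"
      using e ip im by (intro mult_left_mono) linarith+
    also have "\<dots> = 2 * (eps * (norm h)\<^sup>2) * e\<^sup>2" by (simp add: power2_eq_square)
    also have "eps * (norm h)\<^sup>2 = c / 4" using h by (simp add: eps_def)
    finally show False using c e by simp
  qed
  then show ?thesis by (simp add: linear_injective_0[OF lin])
qed

text \<open>For \<open>x = 0\<close> the function is linear in \<open>\<tau>\<close>, so its Hessian
  is zero, which is not injective because \<open>m \<ge> 1\<close>. For \<open>x \<noteq> 0\<close>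
  every critical point is automatically nondegenerate, and only the first-order equation
  remains.\<close>

lemma Mset_eq:
  "Mset U = {(x, t) | x t \<theta>. x \<noteq> 0 \<and> \<theta> \<in> Omega U \<and>
            ((\<lambda>\<tau>. (UcotU U \<tau> *v x) \<bullet> x) has_derivative (\<lambda>h. (-4 *\<^sub>R t) \<bullet> h)) (at \<theta>)}"
proof (intro set_eqI iffI)
  fix g assume "g \<in> Mset U"
  then obtain \<tau> D H where \<tau>: "\<tau> \<in> Omega U"
    and D: "\<And>\<sigma>. \<sigma> \<in> Omega U \<Longrightarrow> (phi U g has_derivative (\<lambda>h. D \<sigma> \<bullet> h)) (at \<sigma>)"
    and D0: "D \<tau> = 0" and H: "(D has_derivative H) (at \<tau>)" and inj: "inj H"
    unfolding Mset_def by blast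
  obtain x t where g: "g = (x, t)" by (cases g)
  have "x \<noteq> 0"
  proof
    assume "x = 0"
    then have ph: "phi U g = (\<lambda>\<sigma>. 4 * (t \<bullet> \<sigma>))" by (simp add: g phi_def[abs_def])
    have "D \<sigma> = 4 *\<^sub>R t" if "\<sigma> \<in> Omega U" for \<sigma>
    proof -
      have "((\<lambda>\<sigma>. 4 * (t \<bullet> \<sigma>)) has_derivative (\<lambda>h. 4 * (t \<bullet> h))) (at \<sigma>)"
        by (intro has_derivative_mult_right bounded_linear_imp_has_derivative bounded_linear_inner_right)
      with D[OF that] have "(\<lambda>h. D \<sigma> \<bullet> h) = (\<lambda>h. 4 * (t \<bullet> h))" unfolding ph by (rule has_derivative_unique)
      then have "D \<sigma> \<bullet> h = (4 *\<^sub>R t) \<bullet> h" for h by (simp add: fun_eq_iff)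
      then show ?thesis using vector_eq_rdot[of "D \<sigma>" "4 *\<^sub>R t"] by blast
    qed
    then have "((\<lambda>\<sigma>. 4 *\<^sub>R t) has_derivative H) (at \<tau>)"
      by (rule has_derivative_transform_within_open[OF H open_Omega \<tau>])
    then have "H = (\<lambda>h. 0)" using has_derivative_unique[OF _ has_derivative_const] by blast
    then have "(axis undefined 1 :: real^'m) = 0" using inj by (simp add: inj_def)
    then show False by (simp add: axis_eq_0_iff)
  qed
  moreover have "((\<lambda>\<tau>. (UcotU U \<tau> *v x) \<bullet> x) has_derivative (\<lambda>h. (-4 *\<^sub>R t) \<bullet> h)) (at \<tau>)"
  proof -
    have "((\<lambda>\<tau>. phi U g \<tau> - 4 * (t \<bullet> \<tau>)) has_derivative (\<lambda>h. D \<tau> \<bullet> h - 4 * (t \<bullet> h))) (at \<tau>)"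
      by (intro has_derivative_diff D \<tau> has_derivative_mult_right bounded_linear_imp_has_derivative bounded_linear_inner_right)
    then show ?thesis by (simp add: D0 g phi_def)
  qed
  ultimately show "g \<in> {(x, t) | x t \<theta>. x \<noteq> 0 \<and> \<theta> \<in> Omega U \<and>
            ((\<lambda>\<tau>. (UcotU U \<tau> *v x) \<bullet> x) has_derivative (\<lambda>h. (-4 *\<^sub>R t) \<bullet> h)) (at \<theta>)}"
    using g \<tau> by blast
next
  fix g assume "g \<in> {(x, t) | x t \<theta>. x \<noteq> 0 \<and> \<theta> \<in> Omega U \<and>
            ((\<lambda>\<tau>. (UcotU U \<tau> *v x) \<bullet> x) has_derivative (\<lambda>h. (-4 *\<^sub>R t) \<bullet> h)) (at \<theta>)}"
  then obtain x t \<theta> where g: "g = (x, t)" and x: "x \<noteq> 0" and \<theta>: "\<theta> \<in> Omega U"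
    and d: "((\<lambda>\<tau>. (UcotU U \<tau> *v x) \<bullet> x) has_derivative (\<lambda>h. (-4 *\<^sub>R t) \<bullet> h)) (at \<theta>)" by blast
  obtain G where G: "\<And>\<sigma>. \<sigma> \<in> Omega U \<Longrightarrow> ((\<lambda>\<tau>. (UcotU U \<tau> *v x) \<bullet> x) has_derivative (\<lambda>h. G \<sigma> \<bullet> h)) (at \<sigma>)"
    "\<And>\<sigma>. \<sigma> \<in> Omega U \<Longrightarrow> \<exists>H. (G has_derivative H) (at \<sigma>)"
    "\<And>\<sigma>. \<sigma> \<in> Omega U \<Longrightarrow> G \<sigma> = - 4 *\<^sub>R tgeo \<sigma> (Pv \<sigma> x)"
    by (rule UcotU_quad_gradient[of x]) blast
  obtain H where H: "(G has_derivative H) (at \<theta>)" using G(2)[OF \<theta>] by blast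
  have "-4 *\<^sub>R t = G \<theta>" using has_derivative_UcotU_quad[OF \<theta> d] G(3)[OF \<theta>] by simp
  then have z: "G \<theta> + 4 *\<^sub>R t = 0" by (metis add.left_inverse scaleR_minus_left)
  have D: "(phi U g has_derivative (\<lambda>h. (G \<sigma> + 4 *\<^sub>R t) \<bullet> h)) (at \<sigma>)" if "\<sigma> \<in> Omega U" for \<sigma>
  proof -
    have "((\<lambda>\<tau>. (UcotU U \<tau> *v x) \<bullet> x + 4 * (t \<bullet> \<tau>)) has_derivative (\<lambda>h. G \<sigma> \<bullet> h + 4 * (t \<bullet> h))) (at \<sigma>)"
      by (intro has_derivative_add G(1) that has_derivative_mult_right bounded_linear_imp_has_derivative bounded_linear_inner_right)
    then show ?thesis by (simp add: g phi_def[abs_def] inner_add_left)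
  qed
  have "((\<lambda>\<sigma>. G \<sigma> + 4 *\<^sub>R t) has_derivative H) (at \<theta>)"
    using has_derivative_add[OF H has_derivative_const] by simp
  then show "g \<in> Mset U"
    unfolding Mset_def using D z Hessian_injective[OF \<theta> x G(3) H] \<theta>
    by (intro CollectI bexI[of _ \<theta>] exI[of _ "\<lambda>\<sigma>. G \<sigma> + 4 *\<^sub>R t"] exI[of _ H]) auto
qed

lemma Mset_geodesic:
  assumes "g \<in> Mset U"
  shows "\<exists>\<theta>\<in>Omega U. \<exists>p. g = (geo \<theta> p 1, tgeo \<theta> p) \<and> phi U g \<theta> = (norm p)\<^sup>2"
proof -
  obtain x t \<theta> where g: "g = (x, t)" and \<theta>: "\<theta> \<in> Omega U"
    and d: "((\<lambda>\<tau>. (UcotU U \<tau> *v x) \<bullet> x) has_derivative (\<lambda>h. (-4 *\<^sub>R t) \<bullet> h)) (at \<theta>)"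
    using assms unfolding Mset_eq by blast
  have "t = tgeo \<theta> (Pv \<theta> x)" using has_derivative_UcotU_quad[OF \<theta> d] by simp
  then show ?thesis using g \<theta> geo_Pv[OF \<theta>, of x] phi_geo[OF \<theta>, of x]
    by (intro bexI[of _ \<theta>] exI[of _ "Pv \<theta> x"]) auto
qed

lemma cc_dist_Mset:
  assumes "g \<in> Mset U"
  shows "(\<exists>\<tau>\<in>Omega U. phi U g \<tau> = (cc_dist U g)\<^sup>2) \<and> (\<forall>\<tau>\<in>Omega U. phi U g \<tau> \<le> (cc_dist U g)\<^sup>2)"
proof -
  obtain \<theta> p where \<theta>: "\<theta> \<in> Omega U" and g: "g = (geo \<theta> p 1, tgeo \<theta> p)" and p: "phi U g \<theta> = (norm p)\<^sup>2"
    using Mset_geodesic[OF assms] by blast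
  have L: "norm p \<in> horiz_lengths U g" unfolding g by (rule length_geo)
  then have ne: "horiz_lengths U g \<noteq> {}" by blast
  have "(cc_dist U g)\<^sup>2 \<le> (norm p)\<^sup>2" using cc_dist_le[OF L] cc_dist_nonneg[OF ne] by (intro power_mono)
  then have "phi U g \<theta> = (cc_dist U g)\<^sup>2" using phi_le_cc_dist[OF ne \<theta>] p by simp
  then show ?thesis using \<theta> phi_le_cc_dist[OF ne] by blast
qed

section \<open>Limits of geodesics and the closure of \<open>Mset U\<close>\<close>

lemma UcotU_quad_le: "\<tau> \<in> Omega U \<Longrightarrow> (UcotU U \<tau> *v x) \<bullet> x \<le> x \<bullet> x"
proof -
  have "((\<lambda>s. s *\<^sub>R x) has_vector_derivative x) (at s)" for s :: real
    using has_vector_derivative_scaleR[OF DERIV_ident has_vector_derivative_const[of x], of s UNIV] by simp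
  from UcotU_quad_le_energy[OF this, of \<tau>]
  show "\<tau> \<in> Omega U \<Longrightarrow> (UcotU U \<tau> *v x) \<bullet> x \<le> x \<bullet> x"
    by (simp add: matrix_vector_mult_scaleR S_skew(2))
qed

lemma phi_0_nonneg: "0 \<le> phi U g 0"
  using phi_geo[OF zero_in_Omega, of "fst g"] by (simp add: phi_def)

text \<open>Through \<open>phi = |p|^2\<close> this bounds the initial velocities of geodesics that
  reach a bounded set of points.\<close>

lemma phi_bounded: "\<exists>B\<ge>0. \<forall>g. \<forall>\<tau>\<in>Omega U. phi U g \<tau> \<le> (norm (fst g))\<^sup>2 + 4 * (norm (snd g) * B)"
proof -
  obtain B where B: "B > 0" "\<And>\<tau>. \<tau> \<in> Omega U \<Longrightarrow> norm \<tau> \<le> B" using bounded_Omega unfolding bounded_pos by blast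
  have "phi U g \<tau> \<le> (norm (fst g))\<^sup>2 + 4 * (norm (snd g) * B)" if "\<tau> \<in> Omega U" for g \<tau>
  proof -
    have "snd g \<bullet> \<tau> \<le> norm (snd g) * norm \<tau>" by (rule norm_cauchy_schwarz)
    also have "\<dots> \<le> norm (snd g) * B" using B(2)[OF that] by (intro mult_left_mono) auto
    finally show ?thesis using UcotU_quad_le[OF that, of "fst g"] by (simp add: phi_def power2_norm_eq_inner)
  qed
  then show ?thesis using B(1) by (intro exI[of _ B]) auto
qed

lemma cc_dist_closure_Mset:
  assumes "g \<in> closure (Mset U)"
  shows "ereal ((cc_dist U g)\<^sup>2) = (SUP \<tau>\<in>Omega U. ereal (phi U g \<tau>))"
proof -
  obtain gs where gs: "\<And>n. gs n \<in> Mset U" "gs \<longlonglongrightarrow> g" using assms unfolding closure_sequential by blast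
  have "\<forall>n. \<exists>\<theta> p. \<theta> \<in> Omega U \<and> gs n = (geo \<theta> p 1, tgeo \<theta> p) \<and> phi U (gs n) \<theta> = (norm p)\<^sup>2"
    using Mset_geodesic[OF gs(1)] by blast
  then obtain \<theta>s ps where \<theta>s: "\<And>n. \<theta>s n \<in> Omega U" and gsn: "\<And>n. gs n = (geo (\<theta>s n) (ps n) 1, tgeo (\<theta>s n) (ps n))"
    and ph: "\<And>n. phi U (gs n) (\<theta>s n) = (norm (ps n))\<^sup>2" by metis
  obtain B where B: "B \<ge> 0" "\<And>g \<tau>. \<tau> \<in> Omega U \<Longrightarrow> phi U g \<tau> \<le> (norm (fst g))\<^sup>2 + 4 * (norm (snd g) * B)"
    using phi_bounded by blast
  obtain C where C: "C > 0" "\<And>n. norm (gs n) \<le> C"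
    using convergent_imp_bounded[OF gs(2)] unfolding bounded_pos by auto
  have bp: "norm (ps n) \<le> sqrt (C\<^sup>2 + 4 * (C * B))" for n
  proof (rule real_le_rsqrt)
    have n1: "norm (fst (gs n)) \<le> C" "norm (snd (gs n)) \<le> C"
      using C(2)[of n] norm_fst_le[of "fst (gs n)" "snd (gs n)"] norm_snd_le[of "snd (gs n)" "fst (gs n)"] by auto
    have "(norm (ps n))\<^sup>2 \<le> (norm (fst (gs n)))\<^sup>2 + 4 * (norm (snd (gs n)) * B)"
      using B(2)[OF \<theta>s[of n], of "gs n"] ph[of n] by simp
    also have "\<dots> \<le> C\<^sup>2 + 4 * (C * B)"
      using n1 B(1) by (intro add_mono mult_left_mono mult_right_mono power_mono) auto
    finally show "(norm (ps n))\<^sup>2 \<le> C\<^sup>2 + 4 * (C * B)" .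
  qed
  have "bounded (range (\<lambda>n. (\<theta>s n, ps n)))"
  proof (rule bounded_subset[OF bounded_Times[OF bounded_Omega bounded_cball]])
    show "range (\<lambda>n. (\<theta>s n, ps n)) \<subseteq> Omega U \<times> cball 0 (sqrt (C\<^sup>2 + 4 * (C * B)))" using \<theta>s bp by auto
  qed
  then obtain z r where r: "strict_mono r" and z: "((\<lambda>n. (\<theta>s n, ps n)) \<circ> r) \<longlonglongrightarrow> z"
    using bounded_imp_convergent_subsequence by blast
  obtain \<theta> p where zz: "z = (\<theta>, p)" by (cases z)
  have l\<theta>: "(\<lambda>n. \<theta>s (r n)) \<longlonglongrightarrow> \<theta>" and lp: "(\<lambda>n. ps (r n)) \<longlonglongrightarrow> p"
    using tendsto_fst[OF z] tendsto_snd[OF z] by (simp_all add: zz o_def)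
  have lg: "(\<lambda>n. gs (r n)) \<longlonglongrightarrow> g" using LIMSEQ_subseq_LIMSEQ[OF gs(2) r] by (simp add: o_def)
  have \<theta>c: "\<theta> \<in> closure (Omega U)" unfolding closure_sequential using l\<theta> \<theta>s by (intro exI[of _ "\<lambda>n. \<theta>s (r n)"]) simp
  have "isCont (\<lambda>z. (geo (fst z) (snd z) 1, tgeo (fst z) (snd z))) z"
    using continuous_endpoint unfolding continuous_on_eq_continuous_at[OF open_UNIV] by blast
  from isCont_tendsto_compose[OF this z]
  have "(\<lambda>n. gs (r n)) \<longlonglongrightarrow> (geo \<theta> p 1, tgeo \<theta> p)" by (simp add: zz o_def gsn)
  then have g: "g = (geo \<theta> p 1, tgeo \<theta> p)" using lg LIMSEQ_unique by blast
  have L: "norm p \<in> horiz_lengths U g" unfolding g by (rule length_geo)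
  then have ne: "horiz_lengths U g \<noteq> {}" by blast
  have le1: "(cc_dist U g)\<^sup>2 \<le> (norm p)\<^sup>2" using cc_dist_le[OF L] cc_dist_nonneg[OF ne] by (intro power_mono)
  \<comment> \<open>For fixed \<open>u < 1\<close> the point \<open>u *\<^sub>R \<theta>\<close> is
    interior, so \<open>phi\<close> converges along the sequence. The inequality before the limit is
    concavity between \<open>\<theta>s (r n)\<close> and \<open>0\<close>, with the nonnegative
    value at \<open>0\<close> dropped.\<close>
  have rad: "u * (norm p)\<^sup>2 \<le> phi U g (u *\<^sub>R \<theta>)" if u: "0 \<le> u" "u < 1" for u
  proof (rule LIMSEQ_le)
    show "(\<lambda>n. u * (norm (ps (r n)))\<^sup>2) \<longlonglongrightarrow> u * (norm p)\<^sup>2" by (intro tendsto_intros lp)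
    have inO: "u *\<^sub>R \<theta> \<in> Omega U" by (rule scale_closure_Omega[OF \<theta>c u])
    have "isCont PL (u *\<^sub>R \<theta>)" by (rule has_derivative_continuous[OF has_derivative_PL[OF inO]])
    then have lP: "(\<lambda>n. PL (u *\<^sub>R \<theta>s (r n))) \<longlonglongrightarrow> PL (u *\<^sub>R \<theta>)"
      by (rule isCont_tendsto_compose) (intro tendsto_intros l\<theta>)
    have pe: "phi U g \<tau> = blinfun_apply (PL \<tau>) (fst g) \<bullet> fst g + 4 * (snd g \<bullet> \<tau>)" for g \<tau>
      by (simp add: phi_def PL_apply Pv_inner)
    show "(\<lambda>n. phi U (gs (r n)) (u *\<^sub>R \<theta>s (r n))) \<longlonglongrightarrow> phi U g (u *\<^sub>R \<theta>)"
      unfolding pe by (intro tendsto_intros bounded_bilinear.tendsto[OF bounded_bilinear_blinfun_apply] lP lg l\<theta>)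
    show "\<exists>N. \<forall>n\<ge>N. u * (norm (ps (r n)))\<^sup>2 \<le> phi U (gs (r n)) (u *\<^sub>R \<theta>s (r n))"
    proof (intro exI allI impI)
      fix n
      show "u * (norm (ps (r n)))\<^sup>2 \<le> phi U (gs (r n)) (u *\<^sub>R \<theta>s (r n))"
        using phi_concave[OF \<theta>s[of "r n"] zero_in_Omega, of u "1 - u" "gs (r n)"] u ph[of "r n"]
          mult_nonneg_nonneg[OF _ phi_0_nonneg[of "gs (r n)"], of "1 - u"] by simp
    qed
  qed
  have ge: "ereal ((norm p)\<^sup>2) \<le> (SUP \<tau>\<in>Omega U. ereal (phi U g \<tau>))"
  proof (rule tendsto_upperbound)
    show "((\<lambda>u. ereal (u * (norm p)\<^sup>2)) \<longlongrightarrow> ereal ((norm p)\<^sup>2)) (at_left 1)"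
      using tendsto_mult[OF tendsto_ident_at[of 1 "{..<1}"] tendsto_const[of "(norm p)\<^sup>2"]] by (simp add: tendsto_ereal)
    show "\<forall>\<^sub>F u in at_left 1. ereal (u * (norm p)\<^sup>2) \<le> (SUP \<tau>\<in>Omega U. ereal (phi U g \<tau>))"
      using eventually_at_left_real[of 0 1, OF zero_less_one]
    proof eventually_elim
      case (elim u)
      then have "ereal (u * (norm p)\<^sup>2) \<le> ereal (phi U g (u *\<^sub>R \<theta>))" using rad[of u] by simp
      also have "\<dots> \<le> (SUP \<tau>\<in>Omega U. ereal (phi U g \<tau>))" using elim by (intro SUP_upper scale_closure_Omega \<theta>c) auto
      finally show ?case .
    qed
  qed simp
  show ?thesis
  proof (rule antisym)
    show "ereal ((cc_dist U g)\<^sup>2) \<le> (SUP \<tau>\<in>Omega U. ereal (phi U g \<tau>))" using le1 ge order_trans ereal_less_eq(3) by meson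
    show "(SUP \<tau>\<in>Omega U. ereal (phi U g \<tau>)) \<le> ereal ((cc_dist U g)\<^sup>2)"
      using phi_le_cc_dist[OF ne] by (intro SUP_least) auto
  qed
qed

section \<open>Existence and uniqueness of the maximizer on the closure\<close>

lemma at_within_Omega_nontrivial: "\<theta> \<in> closure (Omega U) \<Longrightarrow> at \<theta> within Omega U \<noteq> bot"
proof -
  assume "\<theta> \<in> closure (Omega U)"
  then have "\<theta> islimpt Omega U"
    using open_Omega interior_limit_point[of \<theta> "Omega U"] by (auto simp: closure_def interior_open)
  then show ?thesis by (simp add: trivial_limit_within)
qed

text \<open>At \<open>a\<close> and \<open>b\<close>, possibly boundary points, values close to
  \<open>m\<close> are available only nearby. Concavity is applied to approximating sequences; the
  midpoint itself is interior, where \<open>phi\<close> is continuous.\<close>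

lemma midpoint_maximal:
  assumes a: "a \<in> closure (Omega U)" and b: "b \<in> closure (Omega U)" and ab: "a \<noteq> b"
    and ma: "\<And>e. e > 0 \<Longrightarrow> \<exists>\<sigma>\<in>Omega U. dist \<sigma> a < e \<and> m - e < phi U g \<sigma>"
    and mb: "\<And>e. e > 0 \<Longrightarrow> \<exists>\<sigma>\<in>Omega U. dist \<sigma> b < e \<and> m - e < phi U g \<sigma>"
  shows "m \<le> phi U g ((1/2) *\<^sub>R (a + b))"
proof -
  have inv: "0 < inverse (real (Suc n))" for n by simp
  obtain \<sigma> where \<sigma>: "\<And>n. \<sigma> n \<in> Omega U" "\<And>n. dist (\<sigma> n) a < inverse (real (Suc n))" "\<And>n. m - inverse (real (Suc n)) < phi U g (\<sigma> n)"
    using ma[OF inv] by metis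
  obtain \<rho> where \<rho>: "\<And>n. \<rho> n \<in> Omega U" "\<And>n. dist (\<rho> n) b < inverse (real (Suc n))" "\<And>n. m - inverse (real (Suc n)) < phi U g (\<rho> n)"
    using mb[OF inv] by metis
  have la: "\<sigma> \<longlonglongrightarrow> a" and lb: "\<rho> \<longlonglongrightarrow> b"
    using \<sigma>(2) \<rho>(2) by (auto simp: tendsto_dist_iff[of _ a] tendsto_dist_iff[of _ b] less_imp_le
        intro!: tendsto_sandwich[OF _ _ tendsto_const LIMSEQ_inverse_real_of_nat] always_eventually)
  have "isCont (phi U g) ((1/2) *\<^sub>R (a + b))" by (intro isCont_phi strict_convex_Omega a b ab)
  then have l: "(\<lambda>n. phi U g ((1/2) *\<^sub>R (\<sigma> n + \<rho> n))) \<longlonglongrightarrow> phi U g ((1/2) *\<^sub>R (a + b))"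
    by (rule isCont_tendsto_compose) (intro tendsto_intros la lb)
  have l2: "(\<lambda>n. m - inverse (real (Suc n))) \<longlonglongrightarrow> m - 0" by (intro tendsto_intros LIMSEQ_inverse_real_of_nat)
  have "m - 0 \<le> phi U g ((1/2) *\<^sub>R (a + b))"
  proof (rule LIMSEQ_le[OF l2 l], intro exI allI impI)
    fix n
    have "(1/2) * phi U g (\<sigma> n) + (1/2) * phi U g (\<rho> n) \<le> phi U g ((1/2) *\<^sub>R \<sigma> n + (1/2) *\<^sub>R \<rho> n)"
      by (rule phi_concave[OF \<sigma>(1) \<rho>(1)]) simp_all
    then show "m - inverse (real (Suc n)) \<le> phi U g ((1/2) *\<^sub>R (\<sigma> n + \<rho> n))"
      using \<sigma>(3)[of n] \<rho>(3)[of n] by (simp add: scaleR_right_distrib)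
  qed
  then show ?thesis by simp
qed

lemma unique_maximizer:
  assumes x: "x \<noteq> 0"
  shows "\<exists>!\<theta>. \<theta> \<in> closure (Omega U) \<and> cl_phi U (x, t) \<theta> = (SUP \<tau>\<in>Omega U. ereal (phi U (x, t) \<tau>))"
proof -
  let ?g = "(x, t)"
  define m where "m = (SUP \<tau>\<in>Omega U. phi U ?g \<tau>)"
  have bdd: "bdd_above (phi U ?g ` Omega U)"
    using phi_bounded unfolding bdd_above_def by blast
  have le_m: "phi U ?g \<tau> \<le> m" if "\<tau> \<in> Omega U" for \<tau>
    unfolding m_def by (rule cSUP_upper[OF that bdd])
  have ap_m: "\<exists>\<tau>\<in>Omega U. m - e < phi U ?g \<tau>" if "e > 0" for e
    using less_cSUP_iff[OF _ bdd, of "m - e"] zero_in_Omega that unfolding m_def by force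
  have SUPm: "(SUP \<tau>\<in>Omega U. ereal (phi U ?g \<tau>)) = ereal m"
  proof (rule antisym)
    show "(SUP \<tau>\<in>Omega U. ereal (phi U ?g \<tau>)) \<le> ereal m" using le_m by (intro SUP_least) auto
    show "ereal m \<le> (SUP \<tau>\<in>Omega U. ereal (phi U ?g \<tau>))"
    proof (rule ereal_le_epsilon2)
      fix e :: real assume "e > 0"
      then obtain \<tau> where "\<tau> \<in> Omega U" "m - e < phi U ?g \<tau>" using ap_m by blast
      then have "ereal m \<le> ereal (phi U ?g \<tau>) + ereal e" "ereal (phi U ?g \<tau>) \<le> (SUP \<tau>\<in>Omega U. ereal (phi U ?g \<tau>))"
        by (auto intro: SUP_upper)
      then show "ereal m \<le> (SUP \<tau>\<in>Omega U. ereal (phi U ?g \<tau>)) + ereal e" by (meson add_right_mono order_trans)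
    qed
  qed
  have cl_le: "cl_phi U ?g \<theta> \<le> ereal m" for \<theta>
    unfolding cl_phi_def by (rule Limsup_bounded) (auto simp: eventually_at_filter le_m)
  have near: "\<exists>\<sigma>\<in>Omega U. dist \<sigma> \<theta> < e \<and> m - e < phi U ?g \<sigma>" if cl: "cl_phi U ?g \<theta> = ereal m" and e: "e > 0" for \<theta> e
  proof (rule ccontr)
    assume "\<not> ?thesis"
    then have "\<forall>\<sigma>\<in>Omega U. dist \<sigma> \<theta> < e \<longrightarrow> phi U ?g \<sigma> \<le> m - e" by auto
    then have "\<forall>\<^sub>F \<sigma> in at \<theta> within Omega U. ereal (phi U ?g \<sigma>) \<le> ereal (m - e)"
      unfolding eventually_at using e by (auto intro!: exI[of _ e])
    then have "cl_phi U ?g \<theta> \<le> ereal (m - e)" unfolding cl_phi_def by (rule Limsup_bounded)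
    then show False using cl e by simp
  qed
  have ex: "\<exists>\<theta>. \<theta> \<in> closure (Omega U) \<and> cl_phi U ?g \<theta> = ereal m"
  proof -
    have inv: "0 < inverse (real (Suc n))" for n by simp
    obtain \<sigma> where \<sigma>: "\<And>n. \<sigma> n \<in> Omega U" "\<And>n. m - inverse (real (Suc n)) < phi U ?g (\<sigma> n)"
      using ap_m[OF inv] by metis
    have "bounded (range \<sigma>)" using bounded_subset[OF bounded_Omega] \<sigma>(1) by blast
    then obtain \<theta> r where r: "strict_mono r" and l: "(\<sigma> \<circ> r) \<longlonglongrightarrow> \<theta>" using bounded_imp_convergent_subsequence by blast
    have c: "\<theta> \<in> closure (Omega U)" using l \<sigma>(1) unfolding closure_sequential by (intro exI[of _ "\<sigma> \<circ> r"]) auto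
    have lm: "(\<lambda>n. phi U ?g (\<sigma> (r n))) \<longlonglongrightarrow> m"
    proof -
      have "(\<lambda>n. phi U ?g (\<sigma> n)) \<longlonglongrightarrow> m"
      proof (rule tendsto_sandwich)
        show "(\<lambda>n. m - inverse (real (Suc n))) \<longlonglongrightarrow> m"
          using tendsto_diff[OF tendsto_const LIMSEQ_inverse_real_of_nat, of m] by simp
        show "\<forall>\<^sub>F n in sequentially. m - inverse (real (Suc n)) \<le> phi U ?g (\<sigma> n)" using \<sigma>(2) less_imp_le by (intro always_eventually) blast
        show "\<forall>\<^sub>F n in sequentially. phi U ?g (\<sigma> n) \<le> m" using le_m[OF \<sigma>(1)] by (intro always_eventually) blast
      qed simp
      from LIMSEQ_subseq_LIMSEQ[OF this r] show ?thesis by (simp add: o_def)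
    qed
    \<comment> \<open>The limsup ignores the value at \<open>\<theta>\<close> itself. At an interior
      point continuity settles this; otherwise the maximizing sequence, which stays in
      \<open>Omega U\<close>, never meets \<open>\<theta>\<close> and converges along the punctured
      filter.\<close>
    have "ereal m \<le> cl_phi U ?g \<theta>"
    proof (cases "\<theta> \<in> Omega U")
      case True
      have "(\<lambda>n. phi U ?g (\<sigma> (r n))) \<longlonglongrightarrow> phi U ?g \<theta>"
        using isCont_tendsto_compose[OF isCont_phi[OF True] l] by (simp add: o_def)
      then have "phi U ?g \<theta> = m" using lm LIMSEQ_unique by blast
      moreover have lim: "((\<lambda>\<sigma>. ereal (phi U ?g \<sigma>)) \<longlongrightarrow> ereal (phi U ?g \<theta>)) (at \<theta> within Omega U)"
        by (rule tendsto_ereal[OF tendsto_within_subset[OF isCont_phi[OF True, unfolded continuous_at] subset_UNIV]])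
      ultimately show ?thesis
        unfolding cl_phi_def using lim_imp_Limsup[OF at_within_Omega_nontrivial[OF c] lim] by simp
    next
      case False
      show ?thesis
      proof (rule ccontr)
        assume "\<not> ereal m \<le> cl_phi U ?g \<theta>"
        then have "cl_phi U ?g \<theta> < ereal m" by (simp only: not_le)
        then obtain y where y: "cl_phi U ?g \<theta> < y" "y < ereal m" using dense by blast
        have "\<forall>\<^sub>F \<sigma> in at \<theta> within Omega U. ereal (phi U ?g \<sigma>) < y"
          using y(1) unfolding cl_phi_def by (rule Limsup_lessD)
        moreover have "filterlim (\<sigma> \<circ> r) (at \<theta> within Omega U) sequentially"
          unfolding filterlim_at using l \<sigma>(1) False by (auto intro!: always_eventually)
        ultimately have "\<forall>\<^sub>F n in sequentially. ereal (phi U ?g ((\<sigma> \<circ> r) n)) < y"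
          by (rule eventually_compose_filterlim)
        then have "\<forall>\<^sub>F n in sequentially. ereal (phi U ?g (\<sigma> (r n))) \<le> y" by eventually_elim simp
        then have "ereal m \<le> y" using tendsto_upperbound[OF tendsto_ereal[OF lm]] by simp
        then show False using y(2) by simp
      qed
    qed
    then show ?thesis using c cl_le by (intro exI[of _ \<theta>]) (simp add: antisym)
  qed
  have un: "a = b" if a: "a \<in> closure (Omega U)" "cl_phi U ?g a = ereal m" and b: "b \<in> closure (Omega U)" "cl_phi U ?g b = ereal m" for a b
  proof (rule ccontr)
    assume ab: "a \<noteq> b"
    \<comment> \<open>Strict concavity holds at interior points only and cannot be applied to
      \<open>a\<close> and \<open>b\<close>. Their midpoint \<open>c\<close> is interior and
      maximal, and halving again gives interior maximal points on either side of
      \<open>c\<close>.\<close>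
    define c where "c = (1/2) *\<^sub>R (a + b)"
    have cO: "c \<in> Omega U" unfolding c_def by (rule strict_convex_Omega[OF a(1) b(1) ab])
    then have cc: "c \<in> closure (Omega U)" using closure_subset by blast
    have "m \<le> phi U ?g c" unfolding c_def by (rule midpoint_maximal[OF a(1) b(1) ab near[OF a(2)] near[OF b(2)]])
    then have pc: "phi U ?g c = m" using le_m[OF cO] by simp
    have nc: "\<exists>\<sigma>\<in>Omega U. dist \<sigma> c < e \<and> m - e < phi U ?g \<sigma>" if "e > 0" for e
      using cO pc that by (intro bexI[of _ c]) auto
    have h2: "a - c = (1/2) *\<^sub>R (a - b)" "b - c = - ((1/2) *\<^sub>R (a - b))"
      unfolding c_def by (simp_all add: vec_eq_iff field_simps)
    have ac: "a \<noteq> c" "b \<noteq> c" using h2 ab by auto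
    have pa: "m \<le> phi U ?g ((1/2) *\<^sub>R (a + c))" by (rule midpoint_maximal[OF a(1) cc ac(1) near[OF a(2)] nc])
    have pb: "m \<le> phi U ?g ((1/2) *\<^sub>R (b + c))" by (rule midpoint_maximal[OF b(1) cc ac(2) near[OF b(2)] nc])
    \<comment> \<open>The two new midpoints are \<open>c + ?h\<close> and \<open>c - ?h\<close>, so
      strict concavity is used with \<open>e = 1\<close>; the linear terms in \<open>?h\<close>
      cancel in the sum.\<close>
    let ?h = "(1/4) *\<^sub>R (a - b)"
    have ea: "(1/2) *\<^sub>R (a + c) = c + 1 *\<^sub>R ?h" and eb: "(1/2) *\<^sub>R (b + c) = c - 1 *\<^sub>R ?h"
      unfolding c_def by (simp_all add: vec_eq_iff field_simps)
    have "?h \<noteq> 0" using ab by simp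
    then obtain k where k: "k > 0" and sc: "\<forall>e. c + e *\<^sub>R ?h \<in> Omega U \<longrightarrow> c - e *\<^sub>R ?h \<in> Omega U \<longrightarrow>
       (UcotU U (c + e *\<^sub>R ?h) *v x) \<bullet> x + (UcotU U (c - e *\<^sub>R ?h) *v x) \<bullet> x \<le> 2 * ((UcotU U c *v x) \<bullet> x) - k * e\<^sup>2"
      using UcotU_quad_strictly_concave[OF cO x] by blast
    have inO: "c + 1 *\<^sub>R ?h \<in> Omega U" "c - 1 *\<^sub>R ?h \<in> Omega U"
      unfolding ea[symmetric] eb[symmetric] by (rule strict_convex_Omega[OF a(1) cc ac(1)] strict_convex_Omega[OF b(1) cc ac(2)])+
    have "(UcotU U (c + 1 *\<^sub>R ?h) *v x) \<bullet> x + (UcotU U (c - 1 *\<^sub>R ?h) *v x) \<bullet> x \<le> 2 * ((UcotU U c *v x) \<bullet> x) - k * 1\<^sup>2"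
      using sc inO by blast
    moreover have "m \<le> (UcotU U (c + 1 *\<^sub>R ?h) *v x) \<bullet> x + 4 * (t \<bullet> c) + 4 * (t \<bullet> ?h)"
      using pa unfolding ea by (simp add: phi_def inner_add_right)
    moreover have "m \<le> (UcotU U (c - 1 *\<^sub>R ?h) *v x) \<bullet> x + 4 * (t \<bullet> c) - 4 * (t \<bullet> ?h)"
      using pb unfolding eb by (simp add: phi_def inner_diff_right)
    moreover have "(UcotU U c *v x) \<bullet> x + 4 * (t \<bullet> c) = m" using pc by (simp add: phi_def)
    ultimately show False using k by simp
  qed
  from ex un show ?thesis unfolding SUPm by blast
qed

end

theorem theorem9p2:
  fixes U :: "'m::finite \<Rightarrow> real^'q::finite^'q"
  assumes "metivier U"
  shows "Mset U = {(x, t) | x t \<theta>. x \<noteq> 0 \<and> \<theta> \<in> Omega U \<and>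
            ((\<lambda>\<tau>. (UcotU U \<tau> *v x) \<bullet> x) has_derivative (\<lambda>h. (-4 *\<^sub>R t) \<bullet> h)) (at \<theta>)}
       \<and> (\<forall>x t. x \<noteq> 0 \<longrightarrow>
            (\<exists>!\<theta>. \<theta> \<in> closure (Omega U) \<and>
                 cl_phi U (x, t) \<theta> = (SUP \<tau>\<in>Omega U. ereal (phi U (x, t) \<tau>))))
       \<and> (\<forall>g\<in>Mset U.
            (\<exists>\<tau>\<in>Omega U. phi U g \<tau> = (cc_dist U g)\<^sup>2) \<and>
            (\<forall>\<tau>\<in>Omega U. phi U g \<tau> \<le> (cc_dist U g)\<^sup>2))
       \<and> (\<forall>g\<in>closure (Mset U).
            ereal ((cc_dist U g)\<^sup>2) = (SUP \<tau>\<in>Omega U. ereal (phi U g \<tau>)))"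
proof -
  interpret metivier_group U by unfold_locales (rule assms)
  have "\<forall>g\<in>Mset U. (\<exists>\<tau>\<in>Omega U. phi U g \<tau> = (cc_dist U g)\<^sup>2) \<and> (\<forall>\<tau>\<in>Omega U. phi U g \<tau> \<le> (cc_dist U g)\<^sup>2)"
    by (rule ballI, rule cc_dist_Mset)
  moreover have "\<forall>g\<in>closure (Mset U). ereal ((cc_dist U g)\<^sup>2) = (SUP \<tau>\<in>Omega U. ereal (phi U g \<tau>))"
    by (rule ballI, rule cc_dist_closure_Mset)
  moreover have "\<forall>x t. x \<noteq> 0 \<longrightarrow> (\<exists>!\<theta>. \<theta> \<in> closure (Omega U) \<and>
      cl_phi U (x, t) \<theta> = (SUP \<tau>\<in>Omega U. ereal (phi U (x, t) \<tau>)))"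
    by (intro allI impI, rule unique_maximizer)
  ultimately show ?thesis using Mset_eq by (intro conjI)
qed

end
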